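(* Let $G=([n],E)$ be any undirected graph (graphical model), let $X$ be a generic $n$-player game with binary choices in normal form, let $\mathcal{C}=\mathrm{global}(G)$ and let $\mathcal{M}_{\mathcal{C}}$ be the discrete conditional independence model of $G$. Then the Spohn CI variety $\mathcal{V}_{X,\mathcal{C}}$ has codimension $n$ in $\mathcal{M}_{\mathcal{C}}$.
   Context: Notation: $[m]=\{1,\dots,m\}$. Varieties are over $\mathbb{C}$; payoffs are real. Game. An $n$-player game $X$ with binary choices is given by $n$ real payoff tensors $X^{(1)},\dots,X^{(n)}$ of format $2\times\cdots\times2$, with entries $X^{(i)}_{j_1\cdots j_n}$, $j_1,\dots,j_n\in[2]$. "Generic" means: for all $(X^{(1)},\dots,X^{(n)})\in(\mathbb{R}^{2^n})^n$ outside some proper Zariski closed subset. Spohn variety. Let $\mathbb{P}^{2^n-1}$ have coordinates $p_{j_1\cdots j_n}$, $j\in[2]^n$. A "$+$" in place of an index (or indices) means summing over it. The Spohn variety $\mathcal{V}_X\subseteq\mathbb{P}^{2^n-1}$ is the common zero locus of $\det M_1,\dots,\det M_n$, where for $k=1,2$ the $k$-th row of the $2\times2$ matrix $M_i$ is $$\Big(\ \sum_{j\in[2]^n:\,j_i=k}p_{j_1\cdots j_n},\quad \sum_{j\in[2]^n:\,j_i=k}X^{(i)}_{j_1\cdots j_n}p_{j_1\cdots j_n}\ \Big).$$ Independence model. Vertices of $G$ correspond to players. For pairwise disjoint $A,B,C\subseteq[n]$, $C$ separates $A$ and $B$ in $G$ if every path in $G$ from a vertex of $A$ to a vertex of $B$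 contains a vertex of $C$. $\mathrm{global}(G)$ is the set of all conditional independence (CI) statements "$A$ independent of $B$ given $C$" for disjoint $A,B,C$ such that $C$ separates $A$ and $B$. Such a statement imposes the quadratic equations $$p_{i_Ai_Bi_C+}\,p_{j_Aj_Bi_C+}-p_{i_Aj_Bi_C+}\,p_{j_Ai_Bi_C+}=0$$ for all $i_A,j_A\in[2]^A$, $i_B,j_B\in[2]^B$, $i_C\in[2]^C$, where $p_{i_Ai_Bi_C+}$ is the sum of all $p_j$ with $j$ restricting to $i_A,i_B,i_C$ on $A,B,C$. Let $\mathcal{W}$ be the union of all the coordinate hyperplanes $\{p_{j_1\cdots j_n}=0\}$ and the hyperplane $\{p_{++\cdots+}=0\}$. The discrete conditional independence model $\mathcal{M}_{\mathcal{C}}\subseteq\mathbb{P}^{2^n-1}$ is the projective variety defined by these equations for all statements in $\mathcal{C}=\mathrm{global}(G)$, with components lying in $\mathcal{W}$ removed. Spohn CI variety. $\mathcal{V}_{X,\mathcal{C}}:=\overline{(\mathcal{V}_X\cap\mathcal{M}_{\mathcal{C}})\setminus\mathcal{W}}$ (Zariski closure).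
   Formalization: The number of players n is assumed to be at least 2; for n = 1 the claim is false, since M_C is the projective line and the Spohn CI variety of a generic one-player game is empty. *)

theory Defs
  imports "HOL-Analysis.Analysis" "HOL-Library.Poly_Mapping"
begin

section \<open>Polynomials\<close>

text \<open>Polynomials in the variables \<^term>\<open>i :: 'i\<close> are finitely supported maps from
  monomials (exponent vectors) to coefficients.\<close>

type_synonym ('i, 'a) mpoly = "('i \<Rightarrow>\<^sub>0 nat) \<Rightarrow>\<^sub>0 'a"

definition monom_deg :: "('i \<Rightarrow>\<^sub>0 nat) \<Rightarrow> nat" where
  "monom_deg m = (\<Sum>i\<in>Poly_Mapping.keys m. Poly_Mapping.lookup m i)"

definition monom_eval :: "('i \<Rightarrow>\<^sub>0 nat) \<Rightarrow> 'a::comm_semiring_1 ^ 'i::finite \<Rightarrow> 'a" where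
  "monom_eval m x = (\<Prod>i\<in>Poly_Mapping.keys m. (x $ i) ^ Poly_Mapping.lookup m i)"

definition poly_eval :: "('i, 'a) mpoly \<Rightarrow> 'a::comm_semiring_1 ^ 'i::finite \<Rightarrow> 'a" where
  "poly_eval f x = (\<Sum>m\<in>Poly_Mapping.keys f. Poly_Mapping.lookup f m * monom_eval m x)"

definition homogeneous_poly :: "('i, 'a::zero) mpoly \<Rightarrow> bool" where
  "homogeneous_poly f \<longleftrightarrow> (\<exists>d. \<forall>m\<in>Poly_Mapping.keys f. monom_deg m = d)"

lemma monom_deg_add: "monom_deg (a + b) = monom_deg a + monom_deg b"
  unfolding monom_deg_def by (rule setsum_keys_plus_distrib) auto

lemma monom_eval_UNIV: "monom_eval m x = (\<Prod>i\<in>UNIV. (x $ i) ^ Poly_Mapping.lookup m i)"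
  unfolding monom_eval_def by (rule prod.mono_neutral_left) (auto simp: in_keys_iff)

lemma monom_eval_add: "monom_eval (a + b) x = monom_eval a x * monom_eval b x"
  by (simp add: monom_eval_UNIV lookup_add power_add prod.distrib)

lemma monom_eval_scale: "monom_eval m (c *s x) = c ^ monom_deg m * monom_eval m x"
  by (simp add: monom_eval_def monom_deg_def power_mult_distrib prod.distrib power_sum)

lemma poly_eval_0 [simp]: "poly_eval 0 x = 0"
  by (simp add: poly_eval_def)

lemma poly_eval_add: "poly_eval (f + g) x = poly_eval f x + poly_eval g x"
  unfolding poly_eval_def
  by (rule setsum_keys_plus_distrib[where f = "\<lambda>m c. c * monom_eval m x"])
     (auto simp: algebra_simps)

lemma poly_eval_sum: "poly_eval (sum f A) x = (\<Sum>a\<in>A. poly_eval (f a) x)"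
  by (induction A rule: infinite_finite_induct) (auto simp: poly_eval_add)

lemma poly_eval_single: "poly_eval (Poly_Mapping.single m c) x = c * monom_eval m x"
  by (simp add: poly_eval_def)

lemma mpoly_eq_sum_single:
  "(f :: ('i, 'a::comm_monoid_add) mpoly) =
     (\<Sum>m\<in>Poly_Mapping.keys f. Poly_Mapping.single m (Poly_Mapping.lookup f m))"
proof (rule poly_mapping_eqI)
  fix k
  show "Poly_Mapping.lookup f k =
      Poly_Mapping.lookup (\<Sum>m\<in>Poly_Mapping.keys f. Poly_Mapping.single m (Poly_Mapping.lookup f m)) k"
    by (cases "k \<in> Poly_Mapping.keys f") (auto simp: lookup_sum lookup_single when_def in_keys_iff sum.delta)
qed

lemma poly_eval_mult: "poly_eval (f * g) x = poly_eval f x * poly_eval g x"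
proof -
  have "f * g = (\<Sum>a\<in>Poly_Mapping.keys f. Poly_Mapping.single a (Poly_Mapping.lookup f a)) *
      (\<Sum>b\<in>Poly_Mapping.keys g. Poly_Mapping.single b (Poly_Mapping.lookup g b))"
    by (rule arg_cong2[where f = "(*)"]) (rule mpoly_eq_sum_single)+
  also have "\<dots> = (\<Sum>a\<in>Poly_Mapping.keys f. \<Sum>b\<in>Poly_Mapping.keys g.
      Poly_Mapping.single (a + b) (Poly_Mapping.lookup f a * Poly_Mapping.lookup g b))"
    by (simp add: sum_product mult_single)
  finally have "poly_eval (f * g) x = (\<Sum>a\<in>Poly_Mapping.keys f. \<Sum>b\<in>Poly_Mapping.keys g.
      (Poly_Mapping.lookup f a * Poly_Mapping.lookup g b) * (monom_eval a x * monom_eval b x))"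
    by (simp add: poly_eval_sum poly_eval_single monom_eval_add)
  then show ?thesis
    by (simp add: poly_eval_def sum_product mult_ac)
qed

lemma homogeneous_poly_mult:
  fixes f g :: "('i, 'a::comm_semiring_1) mpoly"
  assumes "homogeneous_poly f" "homogeneous_poly g"
  shows "homogeneous_poly (f * g)"
proof -
  from assms obtain d e where "\<forall>m\<in>Poly_Mapping.keys f. monom_deg m = d"
    "\<forall>m\<in>Poly_Mapping.keys g. monom_deg m = e"
    by (auto simp: homogeneous_poly_def)
  then have "\<forall>m\<in>Poly_Mapping.keys (f * g). monom_deg m = d + e"
    using keys_mult[of f g] by (fastforce simp: monom_deg_add)
  then show ?thesis
    by (auto simp: homogeneous_poly_def)
qed

lemma homogeneous_poly_scale:
  assumes "homogeneous_poly f"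
  obtains d where "\<And>c x. poly_eval f (c *s x) = c ^ d * poly_eval f x"
proof -
  from assms obtain d where "\<forall>m\<in>Poly_Mapping.keys f. monom_deg m = d"
    by (auto simp: homogeneous_poly_def)
  then have "poly_eval f (c *s x) = c ^ d * poly_eval f x" for c x
    by (auto simp: poly_eval_def monom_eval_scale sum_distrib_left mult_ac intro!: sum.cong)
  then show ?thesis
    using that by blast
qed


section \<open>Generic points of an affine space\<close>

definition affine_zariski_closed :: "('a::comm_semiring_1 ^ 'i::finite) set \<Rightarrow> bool" where
  "affine_zariski_closed S \<longleftrightarrow> (\<exists>F :: ('i, 'a) mpoly set. S = {x. \<forall>f\<in>F. poly_eval f x = 0})"

definition generic :: "('a::comm_semiring_1 ^ 'i::finite \<Rightarrow> bool) \<Rightarrow> bool" where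
  "generic P \<longleftrightarrow> (\<exists>S. affine_zariski_closed S \<and> S \<noteq> UNIV \<and> (\<forall>x. x \<notin> S \<longrightarrow> P x))"


section \<open>Irreducible sets and Krull dimension\<close>

definition irreducible_in :: "'a topology \<Rightarrow> 'a set \<Rightarrow> bool" where
  "irreducible_in T Z \<longleftrightarrow> Z \<subseteq> topspace T \<and> Z \<noteq> {} \<and>
     (\<forall>A B. closedin T A \<and> closedin T B \<and> Z \<subseteq> A \<union> B \<longrightarrow> Z \<subseteq> A \<or> Z \<subseteq> B)"

definition irreducible_components :: "'a topology \<Rightarrow> 'a set \<Rightarrow> 'a set set" where
  "irreducible_components T S =
     {Z. Z \<subseteq> S \<and> irreducible_in T Z \<and> (\<forall>Y. Y \<subseteq> S \<and> irreducible_in T Y \<and> Z \<subseteq> Y \<longrightarrow> Y = Z)}"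

text \<open>The supremum is taken in the extended reals, so that the empty space has dimension
  \<^term>\<open>-\<infinity> :: ereal\<close> and not the dimension of a point. Consequently the empty set has
  codimension \<^term>\<open>\<infinity> :: ereal\<close> below.\<close>

definition krull_dim :: "'a topology \<Rightarrow> ereal" where
  "krull_dim T = Sup {ereal (real k) | k. \<exists>Z :: nat \<Rightarrow> 'a set.
     (\<forall>i\<le>k. closedin T (Z i) \<and> irreducible_in T (Z i)) \<and> (\<forall>i<k. Z i \<subset> Z (Suc i))}"


section \<open>Complex projective space\<close>

text \<open>The point of projective space with homogeneous coordinates \<open>p \<noteq> 0\<close> is the class of \<open>p\<close>
  modulo nonzero scalars.\<close>

definition proj_point :: "complex ^ 'i \<Rightarrow> (complex ^ 'i) set" where
  "proj_point p = {c *s p | c. c \<noteq> 0}"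

definition proj_locus :: "(complex ^ 'i \<Rightarrow> bool) \<Rightarrow> (complex ^ 'i) set set" where
  "proj_locus Q = {proj_point p | p. p \<noteq> 0 \<and> Q p}"

definition proj_zeros :: "('i::finite, complex) mpoly set \<Rightarrow> (complex ^ 'i) set set" where
  "proj_zeros F = proj_locus (\<lambda>p. \<forall>f\<in>F. poly_eval f p = 0)"

lemma proj_point_eqD:
  assumes "proj_point p = proj_point q"
  obtains c where "c \<noteq> 0" "p = c *s q"
proof -
  have "p \<in> proj_point p"
    unfolding proj_point_def by (rule CollectI, rule exI[of _ 1]) simp
  then show ?thesis
    using assms that by (auto simp: proj_point_def)
qed

lemma proj_point_in_zeros_iff:
  assumes F: "\<forall>f\<in>F. homogeneous_poly f" and p: "p \<noteq> 0"
  shows "proj_point p \<in> proj_zeros F \<longleftrightarrow> (\<forall>f\<in>F. poly_eval f p = 0)"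
proof
  assume "proj_point p \<in> proj_zeros F"
  then obtain q where q: "proj_point p = proj_point q" "\<forall>f\<in>F. poly_eval f q = 0"
    by (auto simp: proj_zeros_def proj_locus_def)
  then obtain c where c: "p = c *s q"
    using proj_point_eqD by metis
  show "\<forall>f\<in>F. poly_eval f p = 0"
  proof
    fix f assume "f \<in> F"
    then obtain d where "\<And>c x. poly_eval f (c *s x) = c ^ d * poly_eval f x"
      using F homogeneous_poly_scale by metis
    then show "poly_eval f p = 0"
      using c q \<open>f \<in> F\<close> by simp
  qed
next
  assume "\<forall>f\<in>F. poly_eval f p = 0"
  then show "proj_point p \<in> proj_zeros F"
    using p by (auto simp: proj_zeros_def proj_locus_def)
qed

definition zariski_open :: "(complex ^ 'i::finite) set set \<Rightarrow> bool" where
  "zariski_open U \<longleftrightarrow> (\<exists>F :: ('i, complex) mpoly set. (\<forall>f\<in>F. homogeneous_poly f) \<and>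
     U = proj_locus (\<lambda>_. True) - proj_zeros F)"

lemma istopology_zariski_open:
  "istopology (zariski_open :: (complex ^ 'i::finite) set set \<Rightarrow> bool)"
  unfolding istopology_def
proof (intro conjI allI impI)
  fix S T :: "(complex ^ 'i) set set"
  assume "zariski_open S" "zariski_open T"
  then obtain F G :: "('i, complex) mpoly set"
    where F: "\<forall>f\<in>F. homogeneous_poly f" "S = proj_locus (\<lambda>_. True) - proj_zeros F"
      and G: "\<forall>f\<in>G. homogeneous_poly f" "T = proj_locus (\<lambda>_. True) - proj_zeros G"
    unfolding zariski_open_def by blast
  define H where "H = {f * g | f g. f \<in> F \<and> g \<in> G}"
  have H: "\<forall>f\<in>H. homogeneous_poly f"
    using F G by (auto simp: H_def intro: homogeneous_poly_mult)
  have mem: "proj_point p \<in> proj_zeros H \<longleftrightarrow> proj_point p \<in> proj_zeros F \<union> proj_zeros G"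
    if "p \<noteq> 0" for p :: "complex ^ 'i"
  proof -
    have "proj_point p \<in> proj_zeros H \<longleftrightarrow>
        (\<forall>f\<in>F. \<forall>g\<in>G. poly_eval (f * g) p = 0)"
      unfolding proj_point_in_zeros_iff[OF H that] unfolding H_def by blast
    also have "\<dots> \<longleftrightarrow> (\<forall>f\<in>F. poly_eval f p = 0) \<or> (\<forall>g\<in>G. poly_eval g p = 0)"
      unfolding poly_eval_mult mult_eq_0_iff by blast
    also have "\<dots> \<longleftrightarrow> proj_point p \<in> proj_zeros F \<union> proj_zeros G"
      using proj_point_in_zeros_iff[OF F(1) that] proj_point_in_zeros_iff[OF G(1) that]
      unfolding Un_iff by blast
    finally show ?thesis .
  qed
  have "S \<inter> T = proj_locus (\<lambda>_. True) - proj_zeros H"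
    unfolding F G proj_locus_def using mem by blast
  with H show "zariski_open (S \<inter> T)"
    unfolding zariski_open_def by blast
next
  fix \<K> :: "(complex ^ 'i) set set set"
  assume "\<forall>K\<in>\<K>. zariski_open K"
  then have "\<forall>K\<in>\<K>. \<exists>F :: ('i, complex) mpoly set. (\<forall>f\<in>F. homogeneous_poly f) \<and>
      K = proj_locus (\<lambda>_. True) - proj_zeros F"
    unfolding zariski_open_def .
  then obtain F :: "(complex ^ 'i) set set \<Rightarrow> ('i, complex) mpoly set"
    where F: "\<And>K. K \<in> \<K> \<Longrightarrow> \<forall>f\<in>F K. homogeneous_poly f"
      and K: "\<And>K. K \<in> \<K> \<Longrightarrow> K = proj_locus (\<lambda>_. True) - proj_zeros (F K)"
    by metis
  define H where "H = (\<Union>K\<in>\<K>. F K)"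
  have H: "\<forall>f\<in>H. homogeneous_poly f"
    using F by (auto simp: H_def)
  have mem: "proj_point p \<in> proj_zeros H \<longleftrightarrow> (\<forall>K\<in>\<K>. proj_point p \<in> proj_zeros (F K))"
    if "p \<noteq> 0" for p :: "complex ^ 'i"
  proof -
    have "(\<forall>K\<in>\<K>. proj_point p \<in> proj_zeros (F K)) \<longleftrightarrow>
        (\<forall>K\<in>\<K>. \<forall>f\<in>F K. poly_eval f p = 0)"
      using proj_point_in_zeros_iff[OF F that] by simp
    then show ?thesis
      unfolding proj_point_in_zeros_iff[OF H that] unfolding H_def by blast
  qed
  have sub: "\<Union>\<K> = (\<Union>K\<in>\<K>. proj_locus (\<lambda>_. True) - proj_zeros (F K))"
    using K by auto
  have "\<Union>\<K> = proj_locus (\<lambda>_. True) - proj_zeros H"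
    unfolding sub proj_locus_def using mem by blast
  with H show "zariski_open (\<Union>\<K>)"
    unfolding zariski_open_def by blast
qed

definition zariski :: "(complex ^ 'i::finite) set topology" where
  "zariski = topology zariski_open"

lemma openin_zariski: "openin zariski U \<longleftrightarrow> zariski_open U"
  by (simp add: zariski_def topology_inverse' istopology_zariski_open)

lemma topspace_zariski:
  "topspace (zariski :: (complex ^ 'i::finite) set topology) = proj_locus (\<lambda>_. True)"
proof
  show "topspace (zariski :: (complex ^ 'i) set topology) \<subseteq> proj_locus (\<lambda>_. True)"
    by (auto simp: topspace_def openin_zariski zariski_open_def)
  have "proj_zeros {1} = ({} :: (complex ^ 'i) set set)"
    by (simp add: proj_zeros_def proj_locus_def poly_eval_def monom_eval_def)
  then have "zariski_open (proj_locus (\<lambda>_. True) :: (complex ^ 'i) set set)"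
    unfolding zariski_open_def by (intro exI[of _ "{1}"]) (simp add: homogeneous_poly_def)
  then show "proj_locus (\<lambda>_. True) \<subseteq> topspace (zariski :: (complex ^ 'i) set topology)"
    by (metis openin_subset openin_zariski)
qed

lemma closedin_zariski:
  fixes S :: "(complex ^ 'i::finite) set set"
  shows "closedin zariski S \<longleftrightarrow>
    (\<exists>F :: ('i, complex) mpoly set. (\<forall>f\<in>F. homogeneous_poly f) \<and> S = proj_zeros F)"
proof -
  have sub: "proj_zeros F \<subseteq> proj_locus (\<lambda>_. True)" for F :: "('i, complex) mpoly set"
    by (auto simp: proj_zeros_def proj_locus_def)
  show ?thesis
    unfolding closedin_def topspace_zariski openin_zariski zariski_open_def
    using sub by (metis Diff_Diff_Int Diff_subset inf.absorb_iff2)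
qed

definition proj_dim :: "(complex ^ 'i::finite) set set \<Rightarrow> ereal" where
  "proj_dim S = krull_dim (subtopology zariski S)"

text \<open>The codimension of a closed subset of a projective variety, as the drop in dimension.
  The value is finite only if the smaller set is nonempty.\<close>

definition proj_codim :: "(complex ^ 'i::finite) set set \<Rightarrow> (complex ^ 'i) set set \<Rightarrow> ereal" where
  "proj_codim Y M = proj_dim M - proj_dim Y"


section \<open>Games and the Spohn variety\<close>

text \<open>Players are the elements of the finite type \<^typ>\<open>'n\<close>. The two choices are the elements
  \<open>1\<close> and \<open>2\<close> of the two-element numeral type \<^typ>\<open>2\<close>. The coordinate \<open>(i, j)\<close> of a game is the
  payoff of player \<open>i\<close> under the choices \<open>j\<close>.\<close>

type_synonym 'n profile = "'n \<Rightarrow> 2"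
type_synonym 'n game = "real ^ ('n \<times> 'n profile)"

definition spohn_matrix ::
  "'n::finite game \<Rightarrow> 'n \<Rightarrow> complex ^ 'n profile \<Rightarrow> complex ^ 2 ^ 2" where
  "spohn_matrix X i p = (\<chi> k c.
     if c = 1 then \<Sum>j | j i = k. p $ j
     else \<Sum>j | j i = k. of_real (X $ (i, j)) * p $ j)"

definition spohn_variety :: "'n::finite game \<Rightarrow> (complex ^ 'n profile) set set" where
  "spohn_variety X = proj_locus (\<lambda>p. \<forall>i. det (spohn_matrix X i p) = 0)"

definition special_hyperplanes :: "(complex ^ 'n::finite profile) set set" where
  "special_hyperplanes = proj_locus (\<lambda>p. (\<exists>j. p $ j = 0) \<or> (\<Sum>j\<in>UNIV. p $ j) = 0)"


section \<open>Graphs and conditional independence\<close>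

definition undirected_graph :: "'n set set \<Rightarrow> bool" where
  "undirected_graph E \<longleftrightarrow> (\<forall>e\<in>E. card e = 2)"

definition graph_path :: "'n set set \<Rightarrow> 'n list \<Rightarrow> bool" where
  "graph_path E vs \<longleftrightarrow> vs \<noteq> [] \<and> distinct vs \<and> successively (\<lambda>u v. {u, v} \<in> E) vs"

definition separates :: "'n set set \<Rightarrow> 'n set \<Rightarrow> 'n set \<Rightarrow> 'n set \<Rightarrow> bool" where
  "separates E C A B \<longleftrightarrow>
     (\<forall>vs. graph_path E vs \<and> hd vs \<in> A \<and> last vs \<in> B \<longrightarrow> set vs \<inter> C \<noteq> {})"

text \<open>A triple \<open>(A, B, C)\<close> stands for the statement that \<open>A\<close> is independent of \<open>B\<close> given \<open>C\<close>.\<close>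

type_synonym 'n ci_statement = "'n set \<times> 'n set \<times> 'n set"

definition global_markov :: "'n set set \<Rightarrow> 'n ci_statement set" where
  "global_markov E = {(A, B, C).
     A \<inter> B = {} \<and> A \<inter> C = {} \<and> B \<inter> C = {} \<and> separates E C A B}"

definition marginal :: "complex ^ 'n::finite profile \<Rightarrow>
    'n set \<Rightarrow> 'n profile \<Rightarrow> 'n set \<Rightarrow> 'n profile \<Rightarrow> 'n set \<Rightarrow> 'n profile \<Rightarrow> complex" where
  "marginal p A a B b C c =
     (\<Sum>j | (\<forall>v\<in>A. j v = a v) \<and> (\<forall>v\<in>B. j v = b v) \<and> (\<forall>v\<in>C. j v = c v). p $ j)"

definition satisfies_ci :: "complex ^ 'n::finite profile \<Rightarrow> 'n ci_statement \<Rightarrow> bool" where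
  "satisfies_ci p = (\<lambda>(A, B, C).
     \<forall>a \<in> A \<rightarrow>\<^sub>E UNIV. \<forall>a' \<in> A \<rightarrow>\<^sub>E UNIV. \<forall>b \<in> B \<rightarrow>\<^sub>E UNIV. \<forall>b' \<in> B \<rightarrow>\<^sub>E UNIV. \<forall>c \<in> C \<rightarrow>\<^sub>E UNIV.
       marginal p A a B b C c * marginal p A a' B b' C c
       - marginal p A a B b' C c * marginal p A a' B b C c = 0)"

definition ci_model :: "'n::finite ci_statement set \<Rightarrow> (complex ^ 'n profile) set set" where
  "ci_model \<C> = \<Union> {Z \<in> irreducible_components zariski (proj_locus (\<lambda>p. \<forall>s\<in>\<C>. satisfies_ci p s)).
     \<not> Z \<subseteq> special_hyperplanes}"

definition spohn_ci_variety ::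
  "'n::finite game \<Rightarrow> 'n ci_statement set \<Rightarrow> (complex ^ 'n profile) set set" where
  "spohn_ci_variety X \<C> = zariski closure_of ((spohn_variety X \<inter> ci_model \<C>) - special_hyperplanes)"

end

theory Submission
  imports Defs "HOL-Complex_Analysis.Conformal_Mappings"
begin

text \<open>
  Write \<open>N\<close> for the number of payoffs of a game and \<open>d\<close> for the number of nonempty cliques of the
  graph. The model has dimension \<open>d\<close>, and for generic \<open>X\<close> the equilibrium equations cut it down to
  dimension \<open>d - n\<close>.

  \<^emph>\<open>The model is a torus.\<close> Each separation statement follows from one in which the three sets exhaust
  the players, and such a statement is a system of binomials in the coordinates. So a point
  with nonzero coordinates satisfies all of them exactly when it factors over cliques, also over the
  complex numbers, where marginals may vanish (\<open>Hammersley_Clifford\<close>). Up to scaling, the points of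
  the model off the special hyperplanes are therefore parametrised by one nonzero potential per
  nonempty clique, and the model is the closure of this irreducible set (\<open>ci_model_eq\<close>).

  \<^emph>\<open>The incidence variety is rational.\<close> Off the hyperplane of total sum zero, the \<open>i\<close>-th determinant
  vanishes iff some \<open>\<lambda>\<^sub>i\<close> satisfies \<open>(\<Sum>j | j i = k. (X (i, j) - \<lambda>\<^sub>i) * p j) = 0\<close> for both choices
  \<open>k\<close>. These are two equations that can be solved for two payoffs of player \<open>i\<close>, and the solutions
  are polynomials in the potentials, in \<open>\<lambda>\<^sub>i\<close> and in the remaining payoffs. So pairs of a game and an
  equilibrium point are the values of a polynomial map in \<open>d + n + (N - 2 * n) = d - n + N\<close> parameters.

  \<^emph>\<open>Upper bound.\<close> By counting monomials, the \<open>N\<close> payoffs and any \<open>d - n + 1\<close> coordinates of \<open>p\<close> are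
  algebraically dependent on the incidence variety. If \<open>X\<close> avoids the zeros of a coefficient of the
  relation, then these coordinates are dependent on the equilibrium points of \<open>X\<close>
  (\<open>generic_coordinates_dependent\<close>). A set on which any \<open>k + 1\<close> coordinates are dependent, normalised
  to have one coordinate equal to 1, carries at most \<open>K * (D + 1) ^ k\<close> linearly independent forms of
  degree \<open>D\<close>, whereas a chain of length \<open>r\<close> of irreducible closed sets forces growth of order \<open>r\<close>
  (\<open>proj_dim_le\<close>).

  \<^emph>\<open>Lower bound.\<close> The incidence parametrisation, together with the potentials of the cliques with at
  least two players, is a polynomial map from affine space to itself. A polynomial self-map with a
  regular point has a regular point over each point of a nonempty Zariski open set
  (\<open>generic_regular_preimage\<close>), because it becomes proper there. At a regular point the
  map has a holomorphic local inverse, so the equilibrium points of \<open>X\<close> contain the image of a ball of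
  dimension \<open>d - n\<close>. The closures of the images of its coordinate slices form a chain of irreducible
  sets, by the identity theorem (\<open>proj_dim_ge\<close>). The regular point comes from a game in which
  the choice of player \<open>i\<close> is governed by another player \<open>\<sigma> i\<close>; this is where there must be at least
  two players.
\<close>

section \<open>Polynomial functions on complex vector spaces\<close>

text \<open>The algebra generated by a set of functions on an arbitrary domain. Leaving the generators free allows
  relations to be counted in terms of a chosen small set of parameters; the coordinates of a vector
  space give the usual polynomial functions.\<close>

inductive_set fun_alg :: "('a \<Rightarrow> complex) set \<Rightarrow> ('a \<Rightarrow> complex) set" for B where
  const: "(\<lambda>_. c) \<in> fun_alg B"
| gen: "b \<in> B \<Longrightarrow> b \<in> fun_alg B"
| add: "f \<in> fun_alg B \<Longrightarrow> g \<in> fun_alg B \<Longrightarrow> (\<lambda>x. f x + g x) \<in> fun_alg B"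
| mult: "f \<in> fun_alg B \<Longrightarrow> g \<in> fun_alg B \<Longrightarrow> (\<lambda>x. f x * g x) \<in> fun_alg B"

lemma fun_alg_sum: "(\<And>i. i \<in> I \<Longrightarrow> f i \<in> fun_alg B) \<Longrightarrow> (\<lambda>x. \<Sum>i\<in>I. f i x) \<in> fun_alg B"
  by (induction I rule: infinite_finite_induct) (auto intro: fun_alg.intros)

lemma fun_alg_prod: "(\<And>i. i \<in> I \<Longrightarrow> f i \<in> fun_alg B) \<Longrightarrow> (\<lambda>x. \<Prod>i\<in>I. f i x) \<in> fun_alg B"
  by (induction I rule: infinite_finite_induct) (auto intro: fun_alg.intros)

lemma fun_alg_power: "f \<in> fun_alg B \<Longrightarrow> (\<lambda>x. f x ^ n) \<in> fun_alg B"
  by (induction n) (auto intro: fun_alg.intros)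

lemma fun_alg_diff:
  assumes "f \<in> fun_alg B" "g \<in> fun_alg B"
  shows "(\<lambda>x. f x - g x) \<in> fun_alg B"
  using fun_alg.add[OF assms(1) fun_alg.mult[OF fun_alg.const[of "-1"] assms(2)]] by simp

lemma fun_alg_if:
  "(P \<Longrightarrow> f \<in> fun_alg B) \<Longrightarrow> (\<not> P \<Longrightarrow> g \<in> fun_alg B) \<Longrightarrow> (\<lambda>x. if P then f x else g x) \<in> fun_alg B"
  by (cases P) auto

lemmas fun_alg_intros = fun_alg.const fun_alg.add fun_alg.mult fun_alg_sum fun_alg_prod
  fun_alg_power fun_alg_diff

lemma fun_alg_compose:
  assumes "f \<in> fun_alg B" "\<And>b. b \<in> B \<Longrightarrow> (\<lambda>x. b (g x)) \<in> fun_alg B'"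
  shows "(\<lambda>x. f (g x)) \<in> fun_alg B'"
  using assms(1) by induction (auto intro: fun_alg.intros assms(2))

abbreviation polyfun :: "(complex ^ 'v \<Rightarrow> complex) \<Rightarrow> bool" where
  "polyfun f \<equiv> f \<in> fun_alg (range (\<lambda>i x. x $ i))"

lemma polyfun_nth: "polyfun (\<lambda>x. x $ i)"
  by (rule fun_alg.gen) auto

lemma polyfun_compose:
  assumes "polyfun f" "\<And>i. (\<lambda>x. g x $ i) \<in> fun_alg B"
  shows "(\<lambda>x. f (g x)) \<in> fun_alg B"
  by (rule fun_alg_compose[OF assms(1)]) (use assms(2) in auto)

lemma polyfun_eq_poly_eval:
  fixes f :: "complex ^ 'v::finite \<Rightarrow> complex"
  assumes "polyfun f"
  obtains q where "f = poly_eval q"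
proof -
  have "\<exists>q. f = poly_eval q"
    using assms
  proof induction
    case (const c)
    then show ?case
      by (intro exI[of _ "Poly_Mapping.single 0 c"]) (auto simp: poly_eval_single monom_eval_def)
  next
    case (gen b)
    then obtain i where "b = (\<lambda>x. x $ i)" by auto
    then show ?case
      by (intro exI[of _ "Poly_Mapping.single (Poly_Mapping.single i 1) 1"])
        (auto simp: poly_eval_single monom_eval_def)
  next
    case (add f g)
    then obtain p q where "f = poly_eval p" "g = poly_eval q" by blast
    then show ?case
      by (intro exI[of _ "p + q"]) (auto simp: poly_eval_add)
  next
    case (mult f g)
    then obtain p q where "f = poly_eval p" "g = poly_eval q" by blast
    then show ?case
      by (intro exI[of _ "p * q"]) (auto simp: poly_eval_mult)
  qed
  then show ?thesis using that by blast
qed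

lemma polyfun_poly_eval: "polyfun (poly_eval q)" for q :: "('v::finite, complex) mpoly"
  unfolding poly_eval_def monom_eval_def by (intro fun_alg_intros polyfun_nth)

text \<open>Most properties of polynomials in several variables below are reduced to one variable by
  restriction to the complex line through two points.\<close>

lemma polyfun_on_line:
  assumes "polyfun f"
  obtains q where "\<And>s. f (a + s *s b) = poly q s"
proof -
  have "\<exists>q. \<forall>s. f (a + s *s b) = poly q s"
    using assms
  proof induction
    case (const c)
    show ?case by (intro exI[of _ "[:c:]"]) auto
  next
    case (gen f)
    then obtain i where "f = (\<lambda>x. x $ i)" by auto
    then show ?case by (intro exI[of _ "[:a $ i, b $ i:]"]) auto
  next
    case (add f g)
    then obtain p q where "\<forall>s. f (a + s *s b) = poly p s" "\<forall>s. g (a + s *s b) = poly q s"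
      by blast
    then show ?case
      by (intro exI[of _ "p + q"]) auto
  next
    case (mult f g)
    then obtain p q where "\<forall>s. f (a + s *s b) = poly p s" "\<forall>s. g (a + s *s b) = poly q s"
      by blast
    then show ?case
      by (intro exI[of _ "p * q"]) auto
  qed
  then show ?thesis using that by blast
qed

lemma polyfun_mult_eq_0:
  assumes "polyfun f" "polyfun g" and 0: "\<And>x. f x * g x = 0" and "f a \<noteq> 0"
  shows "g b = 0"
proof -
  obtain p where p: "\<And>s. f (a + s *s (b - a)) = poly p s"
    using polyfun_on_line[OF assms(1)] by blast
  obtain q where q: "\<And>s. g (a + s *s (b - a)) = poly q s"
    using polyfun_on_line[OF assms(2)] by blast
  have "poly (p * q) s = 0" for s
    using 0 p[of s] q[of s] by (metis poly_mult)
  then have "p * q = 0" using poly_all_0_iff_0 by blast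
  moreover have "p \<noteq> 0" using p[of 0] assms(4) by auto
  ultimately have "q = 0" by auto
  then show ?thesis using q[of 1] by auto
qed

lemma polyfun_prod_nonzero:
  assumes "finite I" "\<And>i. i \<in> I \<Longrightarrow> polyfun (f i)" "\<And>i. i \<in> I \<Longrightarrow> \<exists>x. f i x \<noteq> 0"
  shows "\<exists>x. (\<Prod>i\<in>I. f i x) \<noteq> 0"
  using assms
proof (induction I)
  case (insert i I)
  have "\<exists>a. f i a \<noteq> 0" "\<exists>b. (\<Prod>i\<in>I. f i b) \<noteq> 0"
    using insert.IH insert.prems by simp_all
  then obtain a b where "f i a \<noteq> 0" "(\<Prod>i\<in>I. f i b) \<noteq> 0" by blast
  moreover have "polyfun (f i)" "polyfun (\<lambda>x. \<Prod>i\<in>I. f i x)"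
    using insert by (auto intro!: fun_alg_intros)
  ultimately have "\<exists>x. f i x * (\<Prod>i\<in>I. f i x) \<noteq> 0"
    using polyfun_mult_eq_0 by blast
  then show ?case using insert by simp
qed auto

text \<open>Real points are Zariski dense: the line from the real part of \<open>z\<close> in the direction of its imaginary
  part passes through \<open>z\<close> at the parameter \<open>\<i>\<close>, and its real parameters give real points.\<close>

lemma polyfun_zero_of_real:
  fixes f :: "complex ^ 'v::finite \<Rightarrow> complex"
  assumes "polyfun f" "\<And>x :: real ^ 'v. f (\<chi> i. of_real (x $ i)) = 0"
  shows "f z = 0"
proof -
  define a b where "a = (\<chi> i. complex_of_real (Re (z $ i)))"
    and "b = (\<chi> i. complex_of_real (Im (z $ i)))"
  obtain q where q: "\<And>s. f (a + s *s b) = poly q s"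
    using polyfun_on_line[OF assms(1)] by blast
  have "poly q (of_real s) = 0" for s :: real
  proof -
    have "a + of_real s *s b = (\<chi> i. of_real ((\<chi> i. Re (z $ i) + s * Im (z $ i)) $ i))"
      by (simp add: a_def b_def vec_eq_iff)
    then show ?thesis using q[of "of_real s"] assms(2) by metis
  qed
  then have "range complex_of_real \<subseteq> {s. poly q s = 0}" by auto
  then have "infinite {s. poly q s = 0}"
    using finite_subset infinite_UNIV_char_0 finite_imageD inj_of_real by blast
  then have "q = 0" using poly_roots_finite by blast
  moreover have "a + \<i> *s b = z"
    by (simp add: a_def b_def vec_eq_iff complex_eq_iff)
  ultimately show ?thesis using q[of \<i>] by simp
qed

lemma polyfun_continuous: "polyfun f \<Longrightarrow> continuous_on S f" for f :: "complex ^ 'v::finite \<Rightarrow> complex"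
  by (induction rule: fun_alg.induct) (auto intro!: continuous_intros)

lemma polyfun_zero_open:
  fixes f :: "complex ^ 'v::finite \<Rightarrow> complex"
  assumes "polyfun f" "open S" "a \<in> S" "\<And>x. x \<in> S \<Longrightarrow> f x = 0"
  shows "f b = 0"
proof -
  obtain q where q: "\<And>s. f (a + s *s (b - a)) = poly q s"
    using polyfun_on_line[OF assms(1)] by blast
  have "continuous_on UNIV (\<lambda>s. a + s *s (b - a))"
    unfolding vector_scalar_mult_def by (intro continuous_intros)
  then have "open ((\<lambda>s. a + s *s (b - a)) -` S)"
    using assms(2) open_vimage by blast
  moreover have "0 \<in> (\<lambda>s. a + s *s (b - a)) -` S" using assms by auto
  ultimately have "infinite ((\<lambda>s. a + s *s (b - a)) -` S)"
    using finite_imp_not_open by blast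
  moreover have "(\<lambda>s. a + s *s (b - a)) -` S \<subseteq> {s. poly q s = 0}"
    using assms(4) by (auto simp flip: q)
  ultimately have "q = 0" using poly_roots_finite finite_subset by metis
  then show ?thesis using q[of 1] by simp
qed

text \<open>Two points of the set are joined inside it by a complex line minus finitely many points. Over the
  reals this fails, so the continuity argument for preimages below needs complex scalars.\<close>

lemma connected_polyfun_nonzero:
  fixes f :: "complex ^ 'v::finite \<Rightarrow> complex"
  assumes "polyfun f"
  shows "connected {x. f x \<noteq> 0}"
proof (rule iffD2[OF connected_iff_connected_component], unfold connected_component_def, intro ballI)
  fix a b assume ab: "a \<in> {x. f x \<noteq> 0}" "b \<in> {x. f x \<noteq> 0}"
  obtain q where q: "\<And>s. f (a + s *s (b - a)) = poly q s"
    using polyfun_on_line[OF assms(1)] by blast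
  let ?L = "\<lambda>s. a + s *s (b - a)" and ?S = "UNIV - {s. poly q s = 0}"
  have "q \<noteq> 0" using q[of 0] ab by auto
  then have "connected ?S"
    by (intro connected_open_delete_finite poly_roots_finite) auto
  moreover have "continuous_on ?S ?L"
    unfolding vector_scalar_mult_def by (intro continuous_intros)
  ultimately have "connected (?L ` ?S)" by (intro connected_continuous_image)
  moreover have "?L 0 \<in> ?L ` ?S" "?L 1 \<in> ?L ` ?S"
    using ab q[of 0] q[of 1] by (intro imageI; simp)+
  then have "a \<in> ?L ` ?S" "b \<in> ?L ` ?S" by simp_all
  moreover have "?L ` ?S \<subseteq> {x. f x \<noteq> 0}"
    using q by force
  ultimately show "\<exists>T. connected T \<and> T \<subseteq> {x. f x \<noteq> 0} \<and> a \<in> T \<and> b \<in> T"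
    by (intro exI[of _ "?L ` ?S"] conjI)
qed

lemma polyfun_has_derivative:
  fixes f :: "complex ^ 'v::finite \<Rightarrow> complex"
  assumes "polyfun f"
  obtains g where "\<And>k. polyfun (g k)"
    "\<And>x. (f has_derivative (\<lambda>h. \<Sum>k\<in>UNIV. g k x * h $ k)) (at x)"
proof -
  have "\<exists>g. (\<forall>k. polyfun (g k)) \<and> (\<forall>x. (f has_derivative (\<lambda>h. \<Sum>k\<in>UNIV. g k x * h $ k)) (at x))"
    using assms
  proof induction
    case (const c)
    show ?case by (intro exI[of _ "\<lambda>_ _. 0"]) (auto intro!: fun_alg_intros derivative_eq_intros)
  next
    case (gen f)
    then obtain i where f: "f = (\<lambda>x. x $ i)" by auto
    have "(f has_derivative (\<lambda>h. \<Sum>k\<in>UNIV. (if k = i then 1 else 0) * h $ k)) (at x)" for x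
      unfolding f by (auto simp: if_distrib[of "\<lambda>c. c * _"] sum.delta cong: if_cong
        intro!: bounded_linear_imp_has_derivative bounded_linear_vec_nth)
    then show ?case
      by (intro exI[of _ "\<lambda>k _. if k = i then 1 else 0"]) (auto intro!: fun_alg_intros)
  next
    case (add f g)
    then obtain f' g' where *: "\<forall>k. polyfun (f' k)" "\<forall>k. polyfun (g' k)"
      "\<forall>x. (f has_derivative (\<lambda>h. \<Sum>k\<in>UNIV. f' k x * h $ k)) (at x)"
      "\<forall>x. (g has_derivative (\<lambda>h. \<Sum>k\<in>UNIV. g' k x * h $ k)) (at x)" by blast
    show ?case
    proof (intro exI[of _ "\<lambda>k x. f' k x + g' k x"] conjI allI)
      show "((\<lambda>x. f x + g x) has_derivative (\<lambda>h. \<Sum>k\<in>UNIV. (f' k x + g' k x) * h $ k)) (at x)" for x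
        using has_derivative_add[OF *(3)[rule_format, of x] *(4)[rule_format, of x]]
        by (simp add: algebra_simps sum.distrib)
    qed (use * in \<open>auto intro!: fun_alg_intros\<close>)
  next
    case (mult f g)
    then obtain f' g' where *: "\<forall>k. polyfun (f' k)" "\<forall>k. polyfun (g' k)"
      "\<forall>x. (f has_derivative (\<lambda>h. \<Sum>k\<in>UNIV. f' k x * h $ k)) (at x)"
      "\<forall>x. (g has_derivative (\<lambda>h. \<Sum>k\<in>UNIV. g' k x * h $ k)) (at x)" by blast
    show ?case
    proof (intro exI[of _ "\<lambda>k x. f x * g' k x + f' k x * g x"] conjI allI)
      show "((\<lambda>x. f x * g x) has_derivative (\<lambda>h. \<Sum>k\<in>UNIV. (f x * g' k x + f' k x * g x) * h $ k)) (at x)" for x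
        using has_derivative_mult[OF *(3)[rule_format, of x] *(4)[rule_format, of x]]
        by (simp add: algebra_simps sum.distrib sum_distrib_left)
    qed (use * mult.hyps in \<open>auto intro!: fun_alg_intros\<close>)
  qed
  then show ?thesis using that by blast
qed

text \<open>Genericity is about real games, so the zero set of a complex polynomial has to be described by real
  equations: the real and the imaginary part of its coefficients.\<close>

lemma generic_polyfun:
  fixes Q :: "complex ^ 'v::finite \<Rightarrow> complex"
  assumes "polyfun Q" "Q z \<noteq> 0"
  shows "generic (\<lambda>X :: real ^ 'v. Q (\<chi> i. of_real (X $ i)) \<noteq> 0)"
proof -
  obtain q where q: "Q = poly_eval q" using polyfun_eq_poly_eval[OF assms(1)] by blast
  define r where "r = (Poly_Mapping.map Re q :: ('v, real) mpoly)"
  define s where "s = (Poly_Mapping.map Im q :: ('v, real) mpoly)"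
  have ev: "poly_eval (Poly_Mapping.map F q) X = (\<Sum>m\<in>Poly_Mapping.keys q. F (Poly_Mapping.lookup q m) * monom_eval m X)"
    if "F 0 = 0" for F :: "complex \<Rightarrow> real" and X :: "real ^ 'v"
  proof -
    have "Poly_Mapping.keys (Poly_Mapping.map F q) \<subseteq> Poly_Mapping.keys q"
      using that by (auto simp: in_keys_iff Poly_Mapping.map.rep_eq when_def)
    then show ?thesis
      unfolding poly_eval_def
      by (intro sum.mono_neutral_cong_left) (auto simp: in_keys_iff Poly_Mapping.map.rep_eq when_def that)
  qed
  have mon: "monom_eval m (\<chi> i. complex_of_real (X $ i)) = of_real (monom_eval m X)" for m and X :: "real ^ 'v"
    by (simp add: monom_eval_def)
  have "Q (\<chi> i. of_real (X $ i)) = Complex (poly_eval r X) (poly_eval s X)" for X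
    by (simp add: complex_eq_iff q r_def s_def ev) (simp add: poly_eval_def mon)
  then have eq: "Q (\<chi> i. of_real (X $ i)) = 0 \<longleftrightarrow> poly_eval r X = 0 \<and> poly_eval s X = 0" for X
    by (simp add: complex_eq_iff)
  have "affine_zariski_closed {X :: real ^ 'v. Q (\<chi> i. of_real (X $ i)) = 0}"
    unfolding affine_zariski_closed_def eq by (intro exI[of _ "{r, s}"]) auto
  moreover have "{X :: real ^ 'v. Q (\<chi> i. of_real (X $ i)) = 0} \<noteq> UNIV"
    using polyfun_zero_of_real[OF assms(1)] assms(2) by blast
  ultimately show ?thesis
    unfolding generic_def by blast
qed

section \<open>Algebraic relations from counting monomials\<close>

lemma exists_nontrivial_solution:
  fixes M :: "'a \<Rightarrow> 'b \<Rightarrow> 'k::field"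
  assumes "finite B" "finite A" "card B < card A"
  shows "\<exists>c. (\<exists>a\<in>A. c a \<noteq> 0) \<and> (\<forall>b\<in>B. (\<Sum>a\<in>A. c a * M a b) = 0)"
  using assms
proof (induction B arbitrary: A M rule: finite_induct)
  case empty
  then obtain a where "a \<in> A" by fastforce
  then show ?case by (intro exI[of _ "\<lambda>_. 1"]) auto
next
  case (insert b B)
  show ?case
  proof (cases "\<forall>a\<in>A. M a b = 0")
    case True
    have "card B < card A" using insert by simp
    then obtain c where "\<exists>a\<in>A. c a \<noteq> 0" "\<forall>b\<in>B. (\<Sum>a\<in>A. c a * M a b) = 0"
      using insert.IH[OF insert.prems(1)] by blast
    with True show ?thesis by (intro exI[of _ c]) auto
  next
    case False
    then obtain a0 where a0: "a0 \<in> A" "M a0 b \<noteq> 0" by auto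
    define M1 where "M1 = (\<lambda>a b'. M a b' - M a b / M a0 b * M a0 b')"
    have "card B < card (A - {a0})" using insert a0 by simp
    then obtain c where c: "\<exists>a\<in>A - {a0}. c a \<noteq> 0"
      "\<forall>b'\<in>B. (\<Sum>a\<in>A - {a0}. c a * M1 a b') = 0"
      using insert.IH[of "A - {a0}" M1] insert.prems(1) by auto
    define t where "t = - (\<Sum>a\<in>A - {a0}. c a * M a b / M a0 b)"
    define d where "d = c(a0 := t)"
    have sum: "(\<Sum>a\<in>A. d a * M a b') = t * M a0 b' + (\<Sum>a\<in>A - {a0}. c a * M a b')" for b'
      using a0 insert.prems(1) by (simp add: sum.remove d_def)
    have "(\<Sum>a\<in>A. d a * M a b') = 0" if "b' \<in> insert b B" for b'
    proof (cases "b' = b")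
      case True
      have "(\<Sum>a\<in>A - {a0}. c a * M a b / M a0 b) * M a0 b = (\<Sum>a\<in>A - {a0}. c a * M a b)"
        using a0(2) by (simp add: sum_distrib_right)
      then show ?thesis unfolding sum t_def True by simp
    next
      case False
      with that c(2) have "(\<Sum>a\<in>A - {a0}. c a * M1 a b') = 0" by auto
      then have "(\<Sum>a\<in>A - {a0}. c a * M a b') = (\<Sum>a\<in>A - {a0}. c a * M a b / M a0 b) * M a0 b'"
        unfolding M1_def by (simp add: algebra_simps sum_subtractf sum_distrib_left)
      then show ?thesis unfolding sum t_def by simp
    qed
    moreover have "\<exists>a\<in>A. d a \<noteq> 0" using c(1) by (auto simp: d_def)
    ultimately show ?thesis by (intro exI[of _ d]) auto
  qed
qed

abbreviation exponents :: "'b set \<Rightarrow> nat \<Rightarrow> ('b \<Rightarrow> nat) set" where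
  "exponents I D \<equiv> PiE I (\<lambda>_. {..D})"

text \<open>Polynomials in the generators \<open>B\<close> of degree at most \<open>e\<close> in each of them.\<close>

definition box_span :: "('a \<Rightarrow> complex) set \<Rightarrow> nat \<Rightarrow> ('a \<Rightarrow> complex) set" where
  "box_span B e = {f. \<exists>c. \<forall>x. f x = (\<Sum>\<beta>\<in>exponents B e. c \<beta> * (\<Prod>b\<in>B. b x ^ \<beta> b))}"

lemma box_span_monomial:
  assumes "finite B" "\<And>b. b \<in> B \<Longrightarrow> \<beta> b \<le> e"
  shows "(\<lambda>x. c * (\<Prod>b\<in>B. b x ^ \<beta> b)) \<in> box_span B e"
proof -
  let ?r = "restrict \<beta> B"
  have "(\<Sum>\<gamma>\<in>exponents B e. (if \<gamma> = ?r then c else 0) * (\<Prod>b\<in>B. b x ^ \<gamma> b))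
      = c * (\<Prod>b\<in>B. b x ^ ?r b)" for x
    using assms by (subst sum.mono_neutral_right[of _ "{?r}"]) (auto intro!: finite_PiE)
  moreover have "(\<Prod>b\<in>B. b x ^ ?r b) = (\<Prod>b\<in>B. b x ^ \<beta> b)" for x
    by (rule prod.cong) auto
  ultimately show ?thesis
    unfolding box_span_def by (intro CollectI exI[of _ "\<lambda>\<gamma>. if \<gamma> = ?r then c else 0"]) simp
qed

lemma box_span_add:
  assumes "f \<in> box_span B e" "g \<in> box_span B e"
  shows "(\<lambda>x. f x + g x) \<in> box_span B e"
proof -
  from assms obtain c d where
    "\<forall>x. f x = (\<Sum>\<beta>\<in>exponents B e. c \<beta> * (\<Prod>b\<in>B. b x ^ \<beta> b))"
    "\<forall>x. g x = (\<Sum>\<beta>\<in>exponents B e. d \<beta> * (\<Prod>b\<in>B. b x ^ \<beta> b))"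
    unfolding box_span_def by blast
  then show ?thesis
    unfolding box_span_def
    by (intro CollectI exI[of _ "\<lambda>\<beta>. c \<beta> + d \<beta>"]) (simp add: algebra_simps sum.distrib)
qed

lemma box_span_sum:
  "(\<And>i. i \<in> I \<Longrightarrow> f i \<in> box_span B e) \<Longrightarrow> (\<lambda>x. \<Sum>i\<in>I. f i x) \<in> box_span B e"
proof (induction I rule: infinite_finite_induct)
  case (insert i I)
  then show ?case using box_span_add[of "f i"] by simp
qed (simp_all add: box_span_def exI[of _ "\<lambda>_. 0"])

lemma box_span_mult:
  assumes "finite B" "f \<in> box_span B e" "g \<in> box_span B e'"
  shows "(\<lambda>x. f x * g x) \<in> box_span B (e + e')"
proof -
  from assms obtain c d where
    c: "\<And>x. f x = (\<Sum>\<beta>\<in>exponents B e. c \<beta> * (\<Prod>b\<in>B. b x ^ \<beta> b))"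
    and d: "\<And>x. g x = (\<Sum>\<beta>\<in>exponents B e'. d \<beta> * (\<Prod>b\<in>B. b x ^ \<beta> b))"
    unfolding box_span_def by blast
  have "(\<lambda>x. \<Sum>\<beta>\<in>exponents B e. \<Sum>\<gamma>\<in>exponents B e'.
      (c \<beta> * d \<gamma>) * (\<Prod>b\<in>B. b x ^ (\<beta> b + \<gamma> b))) \<in> box_span B (e + e')"
    by (intro box_span_sum box_span_monomial assms) (auto intro!: add_mono dest!: PiE_mem)
  also have "(\<lambda>x. \<Sum>\<beta>\<in>exponents B e. \<Sum>\<gamma>\<in>exponents B e'.
      (c \<beta> * d \<gamma>) * (\<Prod>b\<in>B. b x ^ (\<beta> b + \<gamma> b))) = (\<lambda>x. f x * g x)"
    by (simp add: c d sum_product power_add prod.distrib mult_ac)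
  finally show ?thesis .
qed

lemma box_span_mono:
  assumes "finite B" "f \<in> box_span B e" "e \<le> e'"
  shows "f \<in> box_span B e'"
proof -
  have "(\<lambda>x. 1 * (\<Prod>b\<in>B. b x ^ 0)) \<in> box_span B (e' - e)"
    using assms(1) by (intro box_span_monomial) auto
  from box_span_mult[OF assms(1,2) this] show ?thesis using assms(3) by simp
qed

lemma box_span_prod:
  assumes "finite B" "finite I" "\<And>i. i \<in> I \<Longrightarrow> f i \<in> box_span B (e i)"
  shows "(\<lambda>x. \<Prod>i\<in>I. f i x) \<in> box_span B (\<Sum>i\<in>I. e i)"
  using assms(2,3)
proof (induction I)
  case empty
  then show ?case using box_span_monomial[OF assms(1), of "\<lambda>_. 0" 0 1] by simp
next
  case (insert i I)
  then show ?case using box_span_mult[OF assms(1), of "f i"] by simp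
qed

lemma box_span_power:
  assumes "finite B" "f \<in> box_span B e"
  shows "(\<lambda>x. f x ^ n) \<in> box_span B (e * n)"
  using box_span_prod[OF assms(1), of "{..<n}" "\<lambda>_. f" "\<lambda>_. e"] assms(2) by (simp add: mult.commute)

lemma fun_alg_box_span:
  assumes "finite B" "f \<in> fun_alg B"
  shows "\<exists>e. f \<in> box_span B e"
  using assms(2)
proof induction
  case (const c)
  then show ?case using box_span_monomial[OF assms(1), of "\<lambda>_. 0" 0 c] by auto
next
  case (gen b)
  have "(\<Prod>b'\<in>B. b' x ^ (if b' = b then 1 else 0)) = b x" for x
    using gen assms(1) by (simp add: if_distrib[of "\<lambda>n. _ ^ n"] prod.delta cong: if_cong)
  moreover have "(\<lambda>x. 1 * (\<Prod>b'\<in>B. b' x ^ (if b' = b then 1 else 0))) \<in> box_span B 1"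
    by (rule box_span_monomial[OF assms(1)]) simp
  ultimately show ?case by auto
next
  case (add f g)
  then obtain e e' where "f \<in> box_span B e" "g \<in> box_span B e'" by blast
  then have "f \<in> box_span B (e + e')" "g \<in> box_span B (e + e')"
    using box_span_mono assms(1) by (metis le_add1, metis le_add2)
  then show ?case using box_span_add by blast
next
  case (mult f g)
  then show ?case using box_span_mult[OF assms(1)] by blast
qed

text \<open>The monomials in \<open>u\<close> with exponents up to \<open>D\<close> number \<open>(D + 1) ^ card I\<close> but lie in a space of
  dimension \<open>O (D ^ card B)\<close>. Linear algebra then gives a relation with constant coefficients.\<close>

theorem algebraic_relation:
  fixes u :: "'c \<Rightarrow> 'a \<Rightarrow> complex"
  assumes "finite B" "finite I" "card B < card I" and u: "\<And>i. i \<in> I \<Longrightarrow> u i \<in> fun_alg B"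
  shows "\<exists>D c. (\<exists>\<alpha>\<in>exponents I D. c \<alpha> \<noteq> 0) \<and>
    (\<forall>x. (\<Sum>\<alpha>\<in>exponents I D. c \<alpha> * (\<Prod>i\<in>I. u i x ^ \<alpha> i)) = 0)"
proof -
  have "\<forall>i\<in>I. \<exists>e. u i \<in> box_span B e"
    using fun_alg_box_span[OF assms(1) u] by blast
  then obtain e where e: "\<And>i. i \<in> I \<Longrightarrow> u i \<in> box_span B (e i)" by metis
  define E where "E = (\<Sum>i\<in>I. e i)"
  (* Large enough for (E * D + 1) ^ card B <= ((E + 1) * (D + 1)) ^ card B
     = D * (D + 1) ^ card B to be less than (D + 1) ^ (card B + 1). *)
  define D where "D = (E + 1) ^ card B"
  have "\<exists>c. \<forall>x. (\<Prod>i\<in>I. u i x ^ \<alpha> i) =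
      (\<Sum>\<beta>\<in>exponents B (E * D). c \<beta> * (\<Prod>b\<in>B. b x ^ \<beta> b))"
    if "\<alpha> \<in> exponents I D" for \<alpha>
  proof -
    have "(\<lambda>x. \<Prod>i\<in>I. u i x ^ \<alpha> i) \<in> box_span B (\<Sum>i\<in>I. e i * \<alpha> i)"
      by (intro box_span_prod box_span_power assms e)
    moreover have "(\<Sum>i\<in>I. e i * \<alpha> i) \<le> E * D"
      unfolding E_def sum_distrib_right using that by (intro sum_mono mult_left_mono) (auto dest: PiE_mem)
    ultimately have "(\<lambda>x. \<Prod>i\<in>I. u i x ^ \<alpha> i) \<in> box_span B (E * D)"
      using box_span_mono[OF assms(1)] by blast
    then show ?thesis unfolding box_span_def by simp
  qed
  then have "\<forall>\<alpha>\<in>exponents I D. \<exists>c. \<forall>x. (\<Prod>i\<in>I. u i x ^ \<alpha> i) =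
      (\<Sum>\<beta>\<in>exponents B (E * D). c \<beta> * (\<Prod>b\<in>B. b x ^ \<beta> b))"
    by blast
  from bchoice[OF this] obtain M where M: "\<And>\<alpha> x. \<alpha> \<in> exponents I D \<Longrightarrow> (\<Prod>i\<in>I. u i x ^ \<alpha> i) =
      (\<Sum>\<beta>\<in>exponents B (E * D). M \<alpha> \<beta> * (\<Prod>b\<in>B. b x ^ \<beta> b))"
    by blast
  have "card (exponents B (E * D)) = (E * D + 1) ^ card B"
    using assms(1) by (simp add: card_PiE)
  also have "\<dots> \<le> ((E + 1) * (D + 1)) ^ card B"
    by (intro power_mono) auto
  also have "\<dots> = D * (D + 1) ^ card B"
    unfolding power_mult_distrib D_def ..
  also have "\<dots> < (D + 1) ^ Suc (card B)" by simp
  also have "\<dots> \<le> (D + 1) ^ card I" using assms(3) by (intro power_increasing) auto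
  also have "\<dots> = card (exponents I D)" using assms(2) by (simp add: card_PiE)
  finally have "card (exponents B (E * D)) < card (exponents I D)" .
  then obtain c where c: "\<exists>\<alpha>\<in>exponents I D. c \<alpha> \<noteq> 0"
    "\<forall>\<beta>\<in>exponents B (E * D). (\<Sum>\<alpha>\<in>exponents I D. c \<alpha> * M \<alpha> \<beta>) = 0"
    using exists_nontrivial_solution[of "exponents B (E * D)" "exponents I D" M] assms(1,2)
    by (auto intro: finite_PiE)
  have "(\<Sum>\<alpha>\<in>exponents I D. c \<alpha> * (\<Prod>i\<in>I. u i x ^ \<alpha> i)) = 0" for x
  proof -
    have "(\<Sum>\<alpha>\<in>exponents I D. c \<alpha> * (\<Prod>i\<in>I. u i x ^ \<alpha> i)) =
        (\<Sum>\<alpha>\<in>exponents I D. \<Sum>\<beta>\<in>exponents B (E * D). c \<alpha> * (M \<alpha> \<beta> * (\<Prod>b\<in>B. b x ^ \<beta> b)))"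
      by (simp add: M sum_distrib_left)
    also have "\<dots> = (\<Sum>\<beta>\<in>exponents B (E * D).
        (\<Sum>\<alpha>\<in>exponents I D. c \<alpha> * M \<alpha> \<beta>) * (\<Prod>b\<in>B. b x ^ \<beta> b))"
      by (subst sum.swap) (simp add: sum_distrib_right mult.assoc)
    also have "\<dots> = 0" using c(2) by simp
    finally show ?thesis .
  qed
  with c(1) show ?thesis by blast
qed

text \<open>Exponent vectors with entries up to \<open>D\<close> are determined by their value in base \<open>D + 1\<close>. This linear
  weight replaces a monomial order.\<close>

lemma inj_on_digits:
  fixes idx :: "'a \<Rightarrow> nat"
  assumes "finite I" "inj_on idx I"
  shows "inj_on (\<lambda>\<alpha>. \<Sum>a\<in>I. \<alpha> a * Suc D ^ idx a) (exponents I D)"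
proof (rule inj_onI, rule ccontr)
  fix \<alpha> \<beta> assume \<alpha>: "\<alpha> \<in> exponents I D" and \<beta>: "\<beta> \<in> exponents I D"
    and eq: "(\<Sum>a\<in>I. \<alpha> a * Suc D ^ idx a) = (\<Sum>a\<in>I. \<beta> a * Suc D ^ idx a)" and "\<alpha> \<noteq> \<beta>"
  define \<delta> where "\<delta> a = int (\<alpha> a) - int (\<beta> a)" for a
  define B where "B = int (Suc D)"
  define K where "K = {a \<in> I. \<delta> a \<noteq> 0}"
  (* At the lowest position m where the digits differ, the difference is divisible by the base. *)
  have "K \<noteq> {}"
    using \<alpha> \<beta> \<open>\<alpha> \<noteq> \<beta>\<close> by (auto simp: K_def \<delta>_def intro: PiE_ext)
  moreover have "finite K" using assms(1) by (auto simp: K_def)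
  ultimately obtain m where m: "m \<in> K" "\<And>a. a \<in> K \<Longrightarrow> idx m \<le> idx a"
    using arg_min_if_finite[of K idx] by (metis linorder_not_less)
  have mI: "m \<in> I" and "\<delta> m \<noteq> 0" using m(1) by (auto simp: K_def)
  have "(\<Sum>a\<in>I. \<delta> a * B ^ idx a) = int (\<Sum>a\<in>I. \<alpha> a * Suc D ^ idx a) - int (\<Sum>a\<in>I. \<beta> a * Suc D ^ idx a)"
    by (simp add: \<delta>_def B_def algebra_simps sum_subtractf)
  then have "(\<Sum>a\<in>I. \<delta> a * B ^ idx a) = 0" using eq by simp
  then have *: "\<delta> m * B ^ idx m = - (\<Sum>a\<in>I - {m}. \<delta> a * B ^ idx a)"
    using sum.remove[OF assms(1) mI, of "\<lambda>a. \<delta> a * B ^ idx a"] by simp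
  have "B ^ Suc (idx m) dvd \<delta> a * B ^ idx a" if "a \<in> I - {m}" for a
  proof (cases "\<delta> a = 0")
    case False
    then have "idx m \<le> idx a" using m(2) that by (auto simp: K_def)
    moreover have "idx m \<noteq> idx a" using assms(2) mI that by (auto dest: inj_onD)
    ultimately show ?thesis by (intro dvd_mult le_imp_power_dvd) auto
  qed auto
  then have "B ^ Suc (idx m) dvd \<delta> m * B ^ idx m"
    unfolding * by (auto intro: dvd_sum)
  then have "B dvd \<delta> m" by (simp add: B_def)
  moreover have "\<bar>\<delta> m\<bar> < B"
    using \<alpha> \<beta> mI by (auto simp: \<delta>_def B_def dest!: PiE_mem)
  ultimately show False
    using \<open>\<delta> m \<noteq> 0\<close> zdvd_imp_le by (metis dvd_abs_iff linorder_not_less zero_less_abs_iff)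
qed

lemma inj_to_nat_exists: "\<exists>idx :: 'a::finite \<Rightarrow> nat. inj idx"
  using finite_imp_inj_to_nat_seg[of "UNIV :: 'a set"] by auto

text \<open>Kronecker substitution: powers of one variable with exponents \<open>Suc D ^ idx a\<close> turn distinct monomials
  into distinct powers.\<close>

lemma monomials_independent:
  fixes c :: "('a::finite \<Rightarrow> nat) \<Rightarrow> complex"
  assumes "\<And>y :: complex ^ 'a. (\<Sum>\<alpha>\<in>exponents UNIV D. c \<alpha> * (\<Prod>a\<in>UNIV. y $ a ^ \<alpha> a)) = 0"
    and \<alpha>0: "\<alpha>0 \<in> exponents UNIV D"
  shows "c \<alpha>0 = 0"
proof -
  obtain idx :: "'a \<Rightarrow> nat" where idx: "inj idx" using inj_to_nat_exists by blast
  let ?W = "\<lambda>\<alpha>. \<Sum>a\<in>UNIV. \<alpha> a * Suc D ^ idx a" and ?P = "exponents UNIV D"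
  have inj: "inj_on ?W ?P" using inj_on_digits[OF _ idx] by auto
  define q where "q = (\<Sum>\<alpha>\<in>?P. monom (c \<alpha>) (?W \<alpha>))"
  have "poly q s = 0" for s
  proof -
    have "poly q s = (\<Sum>\<alpha>\<in>?P. c \<alpha> * (\<Prod>a\<in>UNIV. (\<chi> a. s ^ (Suc D ^ idx a)) $ a ^ \<alpha> a))"
      unfolding q_def by (simp add: poly_sum poly_monom power_sum mult.commute flip: power_mult)
    then show ?thesis using assms(1) by metis
  qed
  then have "q = 0" using poly_all_0_iff_0 by blast
  then have "0 = coeff q (?W \<alpha>0)" by simp
  also have "\<dots> = (\<Sum>\<alpha>\<in>?P. if \<alpha> = \<alpha>0 then c \<alpha> else 0)"
    unfolding q_def coeff_sum using inj \<alpha>0 by (intro sum.cong) (auto dest: inj_onD)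
  also have "\<dots> = c \<alpha>0" using \<alpha>0 by (simp add: sum.delta finite_PiE)
  finally show ?thesis by simp
qed

text \<open>The relation of \<open>algebraic_relation\<close> between the functions \<open>Y\<close> and \<open>u\<close>, arranged as a polynomial in \<open>u\<close>
  whose coefficients are polynomials in \<open>Y\<close>. It can be specialised at those values of \<open>Y\<close> where some
  coefficient survives.\<close>

theorem algebraic_relation_over_polynomials:
  fixes Y :: "'a::finite \<Rightarrow> 'z \<Rightarrow> complex" and u :: "'c \<Rightarrow> 'z \<Rightarrow> complex"
  assumes B: "finite B" and J: "finite J" and card: "card B < CARD('a) + card J"
    and Y: "\<And>a. Y a \<in> fun_alg B" and u: "\<And>j. j \<in> J \<Longrightarrow> u j \<in> fun_alg B"
  shows "\<exists>D (C :: ('c \<Rightarrow> nat) \<Rightarrow> complex ^ 'a \<Rightarrow> complex). (\<forall>\<alpha>. polyfun (C \<alpha>)) \<and>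
    (\<exists>\<alpha>\<in>exponents J D. \<exists>y. C \<alpha> y \<noteq> 0) \<and>
    (\<forall>x. (\<Sum>\<alpha>\<in>exponents J D. C \<alpha> (\<chi> a. Y a x) * (\<Prod>j\<in>J. u j x ^ \<alpha> j)) = 0)"
proof -
  define I where "I = (UNIV :: 'a set) <+> J"
  have "finite I" "card B < card I"
    using card J by (auto simp: I_def card_Plus)
  moreover have "case_sum Y u i \<in> fun_alg B" if "i \<in> I" for i
    using that Y u by (auto simp: I_def split: sum.splits)
  ultimately obtain D c where c: "\<exists>\<alpha>\<in>exponents I D. c \<alpha> \<noteq> 0"
    "\<And>x. (\<Sum>\<alpha>\<in>exponents I D. c \<alpha> * (\<Prod>i\<in>I. case_sum Y u i x ^ \<alpha> i)) = 0"
    using algebraic_relation[OF B, of I "case_sum Y u"] by blast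
  define g where "g \<beta> \<alpha> = restrict (case_sum \<beta> \<alpha>) I" for \<beta> :: "'a \<Rightarrow> nat" and \<alpha> :: "'c \<Rightarrow> nat"
  let ?PX = "exponents (UNIV :: 'a set) D" and ?PJ = "exponents J D"
  define C where "C \<alpha> y = (\<Sum>\<beta>\<in>?PX. c (g \<beta> \<alpha>) * (\<Prod>a\<in>UNIV. y $ a ^ \<beta> a))"
    for \<alpha> and y :: "complex ^ 'a"
  have bij: "bij_betw (\<lambda>(\<beta>, \<alpha>). g \<beta> \<alpha>) (?PX \<times> ?PJ) (exponents I D)"
    by (rule bij_betw_byWitness[where f' = "\<lambda>\<gamma>. (\<gamma> \<circ> Inl, restrict (\<gamma> \<circ> Inr) J)"])
      (auto simp: g_def I_def fun_eq_iff PiE_iff extensional_def Plus_def image_iff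
        split: sum.splits)
  have prodI: "(\<Prod>i\<in>I. case_sum Y u i x ^ g \<beta> \<alpha> i) =
      (\<Prod>a\<in>UNIV. Y a x ^ \<beta> a) * (\<Prod>j\<in>J. u j x ^ \<alpha> j)" for x \<beta> \<alpha>
  proof -
    have "(\<Prod>i\<in>I. case_sum Y u i x ^ g \<beta> \<alpha> i) = (\<Prod>i\<in>I. case_sum Y u i x ^ case_sum \<beta> \<alpha> i)"
      by (rule prod.cong) (auto simp: g_def)
    then show ?thesis using J by (simp add: I_def prod.Plus)
  qed
  have "(\<Sum>\<alpha>\<in>?PJ. C \<alpha> (\<chi> a. Y a x) * (\<Prod>j\<in>J. u j x ^ \<alpha> j)) = 0" for x
  proof -
    have "(\<Sum>\<alpha>\<in>?PJ. C \<alpha> (\<chi> a. Y a x) * (\<Prod>j\<in>J. u j x ^ \<alpha> j)) =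
        (\<Sum>\<alpha>\<in>?PJ. \<Sum>\<beta>\<in>?PX. c (g \<beta> \<alpha>) * (\<Prod>i\<in>I. case_sum Y u i x ^ g \<beta> \<alpha> i))"
      by (simp add: C_def prodI sum_distrib_right mult.assoc)
    also have "\<dots> = (\<Sum>(\<beta>, \<alpha>)\<in>?PX \<times> ?PJ. c (g \<beta> \<alpha>) * (\<Prod>i\<in>I. case_sum Y u i x ^ g \<beta> \<alpha> i))"
      by (subst sum.swap) (simp add: sum.cartesian_product)
    also have "\<dots> = (\<Sum>\<gamma>\<in>exponents I D. c \<gamma> * (\<Prod>i\<in>I. case_sum Y u i x ^ \<gamma> i))"
      using sum.reindex_bij_betw[OF bij, of "\<lambda>\<gamma>. c \<gamma> * (\<Prod>i\<in>I. case_sum Y u i x ^ \<gamma> i)"]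
      by (simp add: case_prod_unfold)
    finally show ?thesis using c(2) by simp
  qed
  moreover have "\<exists>\<alpha>\<in>?PJ. \<exists>y. C \<alpha> y \<noteq> 0"
  proof -
    from c(1) obtain \<gamma> where "\<gamma> \<in> exponents I D" "c \<gamma> \<noteq> 0" by blast
    moreover from this have "\<gamma> \<in> (\<lambda>(\<beta>, \<alpha>). g \<beta> \<alpha>) ` (?PX \<times> ?PJ)"
      using bij by (simp add: bij_betw_def)
    ultimately obtain \<beta> \<alpha> where *: "\<beta> \<in> ?PX" "\<alpha> \<in> ?PJ" "c (g \<beta> \<alpha>) \<noteq> 0"
      by auto
    then have "\<exists>y. C \<alpha> y \<noteq> 0"
      using monomials_independent[where D = D and c = "\<lambda>\<beta>. c (g \<beta> \<alpha>)"] unfolding C_def by blast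
    with * show ?thesis by blast
  qed
  moreover have "polyfun (C \<alpha>)" for \<alpha>
    unfolding C_def by (intro fun_alg_intros polyfun_nth)
  ultimately show ?thesis by blast
qed

section \<open>Polynomial self-maps: local inverses and generic preimages\<close>

text \<open>The values of the real derivative on the complex unit vectors determine it if it is complex linear.\<close>

definition jacobian_matrix :: "(complex ^ 'v \<Rightarrow> complex ^ 'v) \<Rightarrow> complex ^ 'v \<Rightarrow> complex ^ 'v ^ 'v" where
  "jacobian_matrix F x = (\<chi> i k. frechet_derivative F (at x) (axis k 1) $ i)"

lemma has_derivative_vec:
  fixes F :: "complex ^ 'v \<Rightarrow> complex ^ 'w"
  assumes "\<And>i. ((\<lambda>x. F x $ i) has_derivative (\<lambda>h. F' h $ i)) (at x)"
  shows "(F has_derivative F') (at x)"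
proof (subst has_derivative_componentwise_within, rule ballI)
  fix b :: "complex ^ 'w" assume "b \<in> Basis"
  then obtain i c where b: "b = axis i c" unfolding Basis_vec_def by auto
  show "((\<lambda>x. F x \<bullet> b) has_derivative (\<lambda>h. F' h \<bullet> b)) (at x)"
    unfolding b inner_axis using assms[of i] by (rule has_derivative_inner_left)
qed

lemma polymap_has_derivative:
  fixes F :: "complex ^ 'v \<Rightarrow> complex ^ 'v"
  assumes F: "\<And>i. polyfun (\<lambda>x. F x $ i)"
  shows polyfun_jacobian: "polyfun (\<lambda>x. jacobian_matrix F x $ i $ k)"
    and has_derivative_jacobian: "(F has_derivative (\<lambda>h. jacobian_matrix F x *v h)) (at x)"
proof -
  have "\<forall>i. \<exists>g. (\<forall>k. polyfun (g k)) \<and>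
      (\<forall>x. ((\<lambda>x. F x $ i) has_derivative (\<lambda>h. \<Sum>k\<in>UNIV. g k x * h $ k)) (at x))"
    using polyfun_has_derivative[OF F] by blast
  from choice[OF this] obtain g where g: "\<And>i k. polyfun (g i k)"
    "\<And>i x. ((\<lambda>x. F x $ i) has_derivative (\<lambda>h. \<Sum>k\<in>UNIV. g i k x * h $ k)) (at x)"
    by blast
  have der: "(F has_derivative (\<lambda>h. (\<chi> i k. g i k x) *v h)) (at x)" for x
    by (rule has_derivative_vec) (simp add: matrix_vector_mult_def g(2))
  have jac: "jacobian_matrix F x $ i $ k = g i k x" for x i k
    unfolding jacobian_matrix_def frechet_derivative_at[OF der, symmetric]
    by (simp add: matrix_vector_mult_def axis_def if_distrib[of "\<lambda>c. _ * c"] sum.delta cong: if_cong)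
  then show "polyfun (\<lambda>x. jacobian_matrix F x $ i $ k)"
    by (simp add: g(1))
  have "jacobian_matrix F x = (\<chi> i k. g i k x)" by (simp add: vec_eq_iff jac)
  then show "(F has_derivative (\<lambda>h. jacobian_matrix F x *v h)) (at x)"
    using der by simp
qed

lemma polyfun_det_jacobian:
  fixes F :: "complex ^ 'v \<Rightarrow> complex ^ 'v"
  assumes "\<And>i. polyfun (\<lambda>x. F x $ i)"
  shows "polyfun (\<lambda>x. det (jacobian_matrix F x))"
  unfolding det_def by (intro fun_alg_intros polyfun_jacobian assms)

lemma det_nonzero_iff:
  fixes A :: "complex ^ 'v ^ 'v"
  shows "det A \<noteq> 0 \<longleftrightarrow> (\<forall>h. A *v h = 0 \<longrightarrow> h = 0)"
  unfolding invertible_det_nz[symmetric] invertible_left_inverse matrix_left_invertible_ker ..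

lemma det_nonzero_inverse:
  fixes A :: "complex ^ 'v ^ 'v"
  assumes "det A \<noteq> 0"
  shows "\<exists>N. \<forall>h. A *v (N *v h) = h \<and> N *v (A *v h) = h"
proof -
  from assms obtain N where "A ** N = mat 1" "N ** A = mat 1"
    unfolding invertible_det_nz[symmetric] invertible_def by blast
  then show ?thesis by (intro exI[of _ N]) (simp add: matrix_vector_mul_assoc)
qed

lemma polymap_continuous:
  fixes F :: "complex ^ 'v \<Rightarrow> complex ^ 'w"
  assumes "\<And>i. polyfun (\<lambda>x. F x $ i)"
  shows "continuous_on S F"
proof -
  have "continuous_on S (\<lambda>x. \<chi> i. F x $ i)"
    by (intro continuous_on_vec_lambda polyfun_continuous assms)
  then show ?thesis by simp
qed

lemma regular_point_interior:
  fixes F :: "complex ^ 'v \<Rightarrow> complex ^ 'v"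
  assumes F: "\<And>i. polyfun (\<lambda>x. F x $ i)" and "det (jacobian_matrix F z) \<noteq> 0" "z \<in> interior T"
  shows "F z \<in> interior (F ` T)"
proof -
  obtain N where N: "\<And>h. jacobian_matrix F z *v (N *v h) = h"
    using det_nonzero_inverse[OF assms(2)] by auto
  show ?thesis
    by (rule sussmann_open_mapping[OF open_UNIV polymap_continuous[OF F] UNIV_I
          has_derivative_jacobian[OF F] matrix_vector_mul_bounded_linear[of N] _ subset_UNIV assms(3)])
       (auto simp: fun_eq_iff N)
qed

text \<open>The derivative of the local inverse is a complex matrix because it inverts one, so the inverse is
  holomorphic.\<close>

theorem holomorphic_local_inverse:
  fixes F :: "complex ^ 'v \<Rightarrow> complex ^ 'v"
  assumes F: "\<And>i. polyfun (\<lambda>x. F x $ i)" and det: "det (jacobian_matrix F z0) \<noteq> 0"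
  obtains V G where "open V" "F z0 \<in> V" "G (F z0) = z0" "continuous_on V G"
    "\<And>y. y \<in> V \<Longrightarrow> F (G y) = y"
    "\<And>y. y \<in> V \<Longrightarrow> \<exists>N. (G has_derivative (\<lambda>h. N *v h)) (at y)"
proof -
  define F' where "F' x = Blinfun (\<lambda>h. jacobian_matrix F x *v h)" for x
  have F'_apply: "blinfun_apply (F' x) = (\<lambda>h. jacobian_matrix F x *v h)" for x
    unfolding F'_def by (rule bounded_linear_Blinfun_apply) simp
  have cont: "continuous_on UNIV F'"
  proof (rule continuous_on_blinfun_componentwise)
    fix b :: "complex ^ 'v"
    have "continuous_on UNIV (\<lambda>x. \<chi> i. \<Sum>k\<in>UNIV. jacobian_matrix F x $ i $ k * b $ k)"
      by (intro continuous_on_vec_lambda continuous_intros polyfun_continuous polyfun_jacobian F)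
    then show "continuous_on UNIV (\<lambda>x. F' x b)"
      by (simp add: F'_apply matrix_vector_mult_def)
  qed
  obtain N where N: "\<And>h. N *v (jacobian_matrix F z0 *v h) = h"
    using det_nonzero_inverse[OF det] by auto
  define N' where "N' = Blinfun (\<lambda>h. N *v h)"
  have N'_apply: "blinfun_apply N' = (\<lambda>h. N *v h)"
    unfolding N'_def by (rule bounded_linear_Blinfun_apply) simp
  have inv: "N' o\<^sub>L F' z0 = id_blinfun"
    by (rule blinfun_eqI) (simp add: N'_apply F'_apply N)
  have der: "(F has_derivative blinfun_apply (F' x)) (at x)" for x
    unfolding F'_apply by (rule has_derivative_jacobian[OF F])
  obtain U' V G g' where *: "open V" "F z0 \<in> V" "z0 \<in> U'" "homeomorphism U' V F G"
    "\<And>y. y \<in> V \<Longrightarrow> (G has_derivative (g' y)) (at y)"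
    "\<And>y. y \<in> V \<Longrightarrow> g' y = inv (blinfun_apply (F' (G y)))"
    "\<And>y. y \<in> V \<Longrightarrow> bij (blinfun_apply (F' (G y)))"
    by (rule inverse_function_theorem[OF open_UNIV der cont UNIV_I inv]) (rule that)
  show ?thesis
  proof (rule that[of V G])
    show "open V" "F z0 \<in> V" by fact+
    show "G (F z0) = z0" "continuous_on V G" "\<And>y. y \<in> V \<Longrightarrow> F (G y) = y"
      using *(3,4) by (auto simp: homeomorphism_def)
    fix y assume y: "y \<in> V"
    have bij: "bij (\<lambda>h. jacobian_matrix F (G y) *v h)"
      using *(7)[OF y] by (simp add: F'_apply)
    then have "det (jacobian_matrix F (G y)) \<noteq> 0"
      unfolding det_nonzero_iff using matrix_vector_mult_0_right
      by (metis (no_types, lifting) bij_pointE)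
    then obtain M where M: "\<And>h. jacobian_matrix F (G y) *v (M *v h) = h" "\<And>h. M *v (jacobian_matrix F (G y) *v h) = h"
      using det_nonzero_inverse[of "jacobian_matrix F (G y)"] by auto
    have "g' y = (\<lambda>h. M *v h)"
      unfolding *(6)[OF y] F'_apply by (rule inv_equality) (simp_all add: M)
    then show "\<exists>N. (G has_derivative (\<lambda>h. N *v h)) (at y)"
      using *(5)[OF y] by auto
  qed
qed

text \<open>The image contains a nonempty open set, on which a polynomial that vanishes on the image vanishes.\<close>

lemma polymap_dominant:
  fixes F :: "complex ^ 'v \<Rightarrow> complex ^ 'v"
  assumes F: "\<And>i. polyfun (\<lambda>x. F x $ i)" and det: "det (jacobian_matrix F z0) \<noteq> 0"
    and Q: "polyfun Q" "\<And>z. Q (F z) = 0"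
  shows "Q y = 0"
proof (rule polyfun_zero_open[OF Q(1)])
  show "F z0 \<in> interior (F ` UNIV)"
    using regular_point_interior[OF F det] by simp
  show "Q x = 0" if "x \<in> interior (F ` UNIV)" for x
    using that Q(2) interior_subset by blast
qed simp

text \<open>In the source of \<open>F\<close> there are as many coordinates as components of \<open>F\<close>, so one further polynomial
  is algebraic over them.\<close>

lemma algebraic_over_polymap:
  fixes F :: "complex ^ 'v \<Rightarrow> complex ^ 'v"
  assumes F: "\<And>i. polyfun (\<lambda>x. F x $ i)" and u: "polyfun u"
  shows "\<exists>D (C :: nat \<Rightarrow> complex ^ 'v \<Rightarrow> complex). (\<forall>n. polyfun (C n)) \<and>
    (\<exists>n\<le>D. \<exists>y. C n y \<noteq> 0) \<and> (\<forall>x. (\<Sum>n\<le>D. C n (F x) * u x ^ n) = 0)"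
proof -
  let ?B = "range (\<lambda>(i :: 'v) (x :: complex ^ 'v). x $ i)"
  have "card ?B < CARD('v) + card {()}"
    using card_image_le[of "UNIV :: 'v set" "\<lambda>i (x :: complex ^ 'v). x $ i"] by simp
  from algebraic_relation_over_polynomials[OF _ _ this, of "\<lambda>a x. F x $ a" "\<lambda>_. u"] F u
  obtain D and C :: "(unit \<Rightarrow> nat) \<Rightarrow> complex ^ 'v \<Rightarrow> complex" where C: "\<And>\<alpha>. polyfun (C \<alpha>)"
    "\<exists>\<alpha>\<in>exponents {()} D. \<exists>y. C \<alpha> y \<noteq> 0"
    "\<And>x. (\<Sum>\<alpha>\<in>exponents {()} D. C \<alpha> (\<chi> a. F x $ a) * (\<Prod>j\<in>{()}. u x ^ \<alpha> j)) = 0"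
    by auto
  have bij: "bij_betw (\<lambda>n _. n) {..D} (exponents {()} D)"
    by (rule bij_betw_byWitness[where f' = "\<lambda>\<alpha>. \<alpha> ()"]) (auto simp: fun_eq_iff PiE_iff extensional_def)
  have "(\<Sum>n\<le>D. C (\<lambda>_. n) (F x) * u x ^ n) = 0" for x
    using C(3)[of x] sum.reindex_bij_betw[OF bij, of "\<lambda>\<alpha>. C \<alpha> (F x) * u x ^ \<alpha> ()"] by simp
  moreover have "\<exists>n\<le>D. \<exists>y. C (\<lambda>_. n) y \<noteq> 0"
  proof -
    from C(2) obtain \<alpha> y where "\<alpha> \<in> exponents {()} D" "C \<alpha> y \<noteq> 0" by blast
    moreover from this have "\<alpha> () \<le> D" by (auto dest: PiE_mem)
    moreover have "\<alpha> = (\<lambda>_. \<alpha> ())" by (simp add: fun_eq_iff)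
    ultimately show ?thesis by metis
  qed
  ultimately show ?thesis using C(1) by (intro exI[of _ D] exI[of _ "\<lambda>n. C (\<lambda>_. n)"]) blast
qed

text \<open>If the leading coefficients stay away from zero, then roots stay bounded. Applied to the coordinates of a
  preimage, this is what makes a polynomial map proper.\<close>

lemma root_bound:
  fixes c :: "nat \<Rightarrow> complex"
  assumes "(\<Sum>n\<le>b. c n * w ^ n) = 0" "c b \<noteq> 0"
  shows "norm w \<le> 1 + (\<Sum>n<b. norm (c n)) / norm (c b)"
proof (rule ccontr)
  assume "\<not> ?thesis"
  then have w: "1 + (\<Sum>n<b. norm (c n)) / norm (c b) < norm w" by simp
  have "0 \<le> (\<Sum>n<b. norm (c n)) / norm (c b)" by (intro divide_nonneg_nonneg sum_nonneg) auto
  then have w1: "1 < norm w" "(\<Sum>n<b. norm (c n)) / norm (c b) < norm w" using w by linarith+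
  have b: "b > 0" using assms by (cases b) auto
  have "c b * w ^ b = - (\<Sum>n<b. c n * w ^ n)"
    using assms(1) by (simp add: lessThan_Suc_atMost[symmetric] add_eq_0_iff)
  then have "norm (c b) * norm w ^ b = norm (\<Sum>n<b. c n * w ^ n)"
    by (metis norm_minus_cancel norm_mult norm_power)
  also have "\<dots> \<le> (\<Sum>n<b. norm (c n) * norm w ^ n)"
    by (rule order_trans[OF norm_sum]) (simp add: norm_mult norm_power)
  also have "\<dots> \<le> (\<Sum>n<b. norm (c n) * norm w ^ (b - 1))"
    using w1 by (intro sum_mono mult_left_mono power_increasing) auto
  also have "\<dots> = (\<Sum>n<b. norm (c n)) * norm w ^ (b - 1)" by (simp add: sum_distrib_right)
  also have "\<dots> < (norm (c b) * norm w) * norm w ^ (b - 1)"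
  proof (rule mult_strict_right_mono)
    show "(\<Sum>n<b. norm (c n)) < norm (c b) * norm w"
      using w1(2) assms(2) by (simp add: divide_less_eq mult.commute)
    show "0 < norm w ^ (b - 1)" using w1(1) by (intro zero_less_power) linarith
  qed
  also have "\<dots> = norm (c b) * norm w ^ b"
    using b by (cases b) auto
  finally show False by simp
qed

text \<open>Each coordinate of \<open>z\<close> is algebraic over \<open>F z\<close>. Where the leading coefficients of these equations do
  not vanish, preimages of a convergent sequence stay bounded, so the image of \<open>F\<close> is relatively
  closed there. Likewise \<open>g = det (jacobian_matrix F) * h\<close> satisfies an equation over \<open>F\<close>; where its constant
  coefficient does not vanish, neither does \<open>g\<close>, and the image is open. The set where none of these
  coefficients vanishes is connected, so it consists of image points.\<close>

theorem generic_regular_preimage: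
  fixes F :: "complex ^ 'v \<Rightarrow> complex ^ 'v"
  assumes F: "\<And>i. polyfun (\<lambda>x. F x $ i)" and det: "det (jacobian_matrix F z0) \<noteq> 0"
    and h: "polyfun h" "h z1 \<noteq> 0"
  shows "\<exists>R. polyfun R \<and> (\<exists>y. R y \<noteq> 0) \<and>
    (\<forall>y. R y \<noteq> 0 \<longrightarrow> (\<exists>z. F z = y \<and> det (jacobian_matrix F z) \<noteq> 0 \<and> h z \<noteq> 0))"
proof -
  note dominant = polymap_dominant[OF F det]
  define g where "g z = det (jacobian_matrix F z) * h z" for z
  have g: "polyfun g" "\<exists>z. g z \<noteq> 0"
    using polyfun_mult_eq_0[OF polyfun_det_jacobian[OF F] h(1) _ det] h(2)
    unfolding g_def by (auto intro!: fun_alg_intros polyfun_det_jacobian F h)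
  have "\<exists>S. polyfun S \<and> (\<exists>y. S y \<noteq> 0) \<and> (\<forall>z. S (F z) \<noteq> 0 \<longrightarrow> g z \<noteq> 0)"
  proof -
    obtain D and C :: "nat \<Rightarrow> complex ^ 'v \<Rightarrow> complex" where C: "\<And>n. polyfun (C n)"
      "\<exists>n\<le>D. \<exists>y. C n y \<noteq> 0" "\<And>x. (\<Sum>n\<le>D. C n (F x) * g x ^ n) = 0"
      using algebraic_over_polymap[OF F g(1)] by blast
    (* Dividing the equation of g by g ^ m leaves an equation with nonzero constant coefficient C m. *)
    define m where "m = (LEAST n. \<exists>y. C n y \<noteq> 0)"
    obtain n0 where n0: "n0 \<le> D" "\<exists>y. C n0 y \<noteq> 0" using C(2) by blast
    have m1: "\<exists>y. C m y \<noteq> 0" unfolding m_def by (rule LeastI[of _ n0]) (rule n0)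
    have m2: "C n y = 0" if "n < m" for n y
      using not_less_Least[OF that[unfolded m_def]] by simp
    have m3: "m \<le> D" using Least_le[of "\<lambda>n. \<exists>y. C n y \<noteq> 0", OF n0(2)] n0(1) unfolding m_def by linarith
    note m = m1 m2 m3
    define r where "r x = (\<Sum>n=m..D. C n (F x) * g x ^ (n - m))" for x
    have "g x ^ m * r x = 0" for x
    proof -
      have "g x ^ m * r x = (\<Sum>n=m..D. C n (F x) * g x ^ n)"
        unfolding r_def sum_distrib_left
        by (intro sum.cong) (auto simp: mult_ac simp flip: power_add)
      also have "\<dots> = (\<Sum>n\<le>D. C n (F x) * g x ^ n)"
        by (rule sum.mono_neutral_left) (auto simp: m(2))
      finally show ?thesis using C(3) by simp
    qed
    moreover obtain a where "g a \<noteq> 0" using g(2) by blast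
    moreover have "polyfun (\<lambda>x. C n (F x))" for n
      by (rule polyfun_compose[OF C(1) F])
    then have "polyfun r" unfolding r_def by (intro fun_alg_intros g)
    ultimately have r: "r x = 0" for x
      using polyfun_mult_eq_0[of "\<lambda>x. g x ^ m" r a x] g(1) by (auto intro!: fun_alg_power)
    have "g z \<noteq> 0" if "C m (F z) \<noteq> 0" for z
    proof
      assume "g z = 0"
      then have "r z = (\<Sum>n\<in>{m}. C n (F z) * g z ^ (n - m))"
        unfolding r_def using m(3) by (intro sum.mono_neutral_right) auto
      then show False using r[of z] that by simp
    qed
    then show ?thesis using m(1) C(1) by blast
  qed
  then obtain S where S: "polyfun S" "\<exists>y. S y \<noteq> 0" "\<And>z. S (F z) \<noteq> 0 \<Longrightarrow> g z \<noteq> 0" by blast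
  have "\<exists>L \<beta>. polyfun L \<and> (\<exists>y. L y \<noteq> 0) \<and> continuous_on {y. L y \<noteq> 0} \<beta> \<and>
      (\<forall>z. L (F z) \<noteq> 0 \<longrightarrow> norm (z $ k) \<le> \<beta> (F z))" for k
  proof -
    obtain D and C :: "nat \<Rightarrow> complex ^ 'v \<Rightarrow> complex" where C: "\<And>n. polyfun (C n)"
      "\<exists>n\<le>D. \<exists>y. C n y \<noteq> 0" "\<And>x. (\<Sum>n\<le>D. C n (F x) * (x $ k) ^ n) = 0"
      using algebraic_over_polymap[OF F polyfun_nth[of k]] by blast
    (* The relation may have lower degree than D: its leading coefficient is C b. *)
    define b where "b = Max {n. n \<le> D \<and> (\<exists>y. C n y \<noteq> 0)}"
    have "b \<in> {n. n \<le> D \<and> (\<exists>y. C n y \<noteq> 0)}"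
      unfolding b_def using C(2) by (intro Max_in) auto
    then have b: "b \<le> D" "\<exists>y. C b y \<noteq> 0" by auto
    have b': "C n y = 0" if "b < n" "n \<le> D" for n y
    proof (rule ccontr)
      assume "C n y \<noteq> 0"
      then have "n \<le> b" unfolding b_def using that by (intro Max_ge) auto
      with that show False by simp
    qed
    have sum: "(\<Sum>n\<le>b. C n (F x) * (x $ k) ^ n) = 0" for x
    proof -
      have "(\<Sum>n\<le>b. C n (F x) * (x $ k) ^ n) = (\<Sum>n\<le>D. C n (F x) * (x $ k) ^ n)"
        using b b' by (intro sum.mono_neutral_left) auto
      then show ?thesis using C(3) by simp
    qed
    show ?thesis
    proof (intro exI conjI allI impI)
      show "polyfun (C b)" by (rule C)
      show "C b (SOME y. C b y \<noteq> 0) \<noteq> 0" using b(2) by (rule someI_ex)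
      show "continuous_on {y. C b y \<noteq> 0} (\<lambda>y. 1 + (\<Sum>n<b. norm (C n y)) / norm (C b y))"
        by (intro continuous_intros polyfun_continuous C) auto
      show "norm (z $ k) \<le> 1 + (\<Sum>n<b. norm (C n (F z))) / norm (C b (F z))"
        if "C b (F z) \<noteq> 0" for z
        by (rule root_bound[OF sum that])
    qed
  qed
  then obtain L \<beta> where L: "\<And>k. polyfun (L k)" "\<And>k. \<exists>y. L k y \<noteq> 0"
    "\<And>k. continuous_on {y. L k y \<noteq> 0} (\<beta> k)"
    "\<And>k z. L k (F z) \<noteq> 0 \<Longrightarrow> norm (z $ k) \<le> \<beta> k (F z)"
    by metis
  define R where "R y = S y * (\<Prod>k\<in>UNIV. L k y)" for y
  have R: "polyfun R" unfolding R_def by (intro fun_alg_intros S L)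
  have "\<exists>y. (\<Prod>k\<in>UNIV. L k y) \<noteq> 0"
    by (rule polyfun_prod_nonzero) (auto intro: L)
  moreover have "polyfun (\<lambda>y. \<Prod>k\<in>UNIV. L k y)" by (intro fun_alg_intros L)
  ultimately have R0: "\<exists>y. R y \<noteq> 0"
    using polyfun_mult_eq_0[OF S(1), of "\<lambda>y. \<Prod>k\<in>UNIV. L k y"] S(2) unfolding R_def by blast
  define O' where "O' = {y. R y \<noteq> 0}"
  define A where "A = {y \<in> O'. \<exists>z. F z = y}"
  have "A \<noteq> {}"
    using dominant[OF R] R0 unfolding A_def O'_def by blast
  moreover have "openin (top_of_set O') A"
  proof -
    have "open O'" unfolding O'_def
      by (intro open_Collect_neq polyfun_continuous R continuous_on_const)
    have "open A"
    proof (rule openI)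
      fix y assume "y \<in> A"
      then obtain z where z: "F z = y" "R y \<noteq> 0" by (auto simp: A_def O'_def)
      then have "det (jacobian_matrix F z) \<noteq> 0"
        using S(3)[of z] by (auto simp: R_def g_def)
      then have "y \<in> interior (range F)"
        using regular_point_interior[OF F, of z UNIV] z by simp
      then have "y \<in> interior (range F) \<inter> O'" "open (interior (range F) \<inter> O')"
        using z \<open>open O'\<close> by (auto simp: O'_def)
      moreover have "interior (range F) \<inter> O' \<subseteq> A"
        using interior_subset[of "range F"] by (auto simp: A_def)
      ultimately show "\<exists>e>0. ball y e \<subseteq> A"
        by (meson open_contains_ball subset_trans)
    qed
    then show ?thesis by (auto simp: A_def intro: open_subset)
  qed
  moreover have "closedin (top_of_set O') A"
  proof -
    have "y \<in> A" if y: "y \<in> O'" and lim: "x \<longlonglongrightarrow> y" and x: "\<And>n. x n \<in> A" for x y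
    proof -
      have "\<forall>n. \<exists>z. F z = x n" using x by (auto simp: A_def)
      then obtain z where z: "\<And>n. F (z n) = x n" by metis
      have L0: "L k y' \<noteq> 0" if "y' \<in> O'" for k y' using that by (auto simp: O'_def R_def)
      have "bounded (range z)"
      proof -
        have "(\<lambda>n. \<beta> k (x n)) \<longlonglongrightarrow> \<beta> k y" for k
          using continuous_on_tendsto_compose[OF L(3) lim, of k] L0 x y by (auto simp: A_def)
        then have "(\<lambda>n. \<Sum>k\<in>UNIV. \<beta> k (x n)) \<longlonglongrightarrow> (\<Sum>k\<in>UNIV. \<beta> k y)"
          by (intro tendsto_sum)
        then have "Bseq (\<lambda>n. \<Sum>k\<in>UNIV. \<beta> k (x n))"
          by (intro convergent_imp_Bseq convergentI)
        then obtain K where K: "\<And>n. norm (\<Sum>k\<in>UNIV. \<beta> k (x n)) \<le> K"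
          unfolding Bseq_def by auto
        have "norm (z n) \<le> K" for n
        proof -
          have "norm (z n) \<le> (\<Sum>k\<in>UNIV. norm (z n $ k))" 
            unfolding norm_vec_def by (rule L2_set_le_sum) simp
          also have "\<dots> \<le> (\<Sum>k\<in>UNIV. \<beta> k (x n))"
            using L(4)[of _ "z n"] L0 x[of n] by (intro sum_mono) (auto simp: z A_def)
          also have "\<dots> \<le> K" using K[of n] by (simp add: abs_le_iff)
          finally show ?thesis .
        qed
        then show ?thesis by (auto simp: bounded_iff)
      qed
      then obtain l r where lr: "strict_mono (r :: nat \<Rightarrow> nat)" "(z \<circ> r) \<longlonglongrightarrow> l"
        using bounded_imp_convergent_subsequence by blast
      have "isCont F l"
        using polymap_continuous[OF F, of UNIV] by (simp add: continuous_on_eq_continuous_at)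
      then have "(\<lambda>n. F ((z \<circ> r) n)) \<longlonglongrightarrow> F l" using lr(2) isCont_tendsto_compose by blast
      moreover have "(\<lambda>n. F ((z \<circ> r) n)) \<longlonglongrightarrow> y"
        using LIMSEQ_subseq_LIMSEQ[OF lim lr(1)] by (simp add: z o_def)
      ultimately have "F l = y" using LIMSEQ_unique by blast
      then show ?thesis using y by (auto simp: A_def)
    qed
    then have "A = O' \<inter> closure A"
      using closure_subset[of A] by (fastforce simp: closure_sequential A_def)
    then show ?thesis by (metis closedin_closed_Int closed_closure)
  qed
  moreover have "connected O'"
    unfolding O'_def by (rule connected_polyfun_nonzero[OF R])
  ultimately have "A = O'" unfolding connected_clopen by blast
  have "\<exists>z. F z = y \<and> det (jacobian_matrix F z) \<noteq> 0 \<and> h z \<noteq> 0" if "R y \<noteq> 0" for y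
  proof -
    have "y \<in> A" using that \<open>A = O'\<close> by (simp add: O'_def)
    then obtain z where z: "F z = y" by (auto simp: A_def)
    then show ?thesis using S(3)[of z] that by (auto simp: R_def g_def)
  qed
  with R R0 show ?thesis by blast
qed

section \<open>Forms on projective sets and upper bounds for the dimension\<close>

text \<open>Zero is homogeneous of every degree.\<close>

definition homfun :: "nat \<Rightarrow> (complex ^ 'i::finite \<Rightarrow> complex) \<Rightarrow> bool" where
  "homfun d f \<longleftrightarrow> (\<exists>q. f = poly_eval q \<and> (\<forall>m\<in>Poly_Mapping.keys q. monom_deg m = d))"

lemma homfun_const: "homfun 0 (\<lambda>_. c)"
  unfolding homfun_def
  by (intro exI[of _ "Poly_Mapping.single 0 c"])
    (auto simp: poly_eval_single monom_eval_def monom_deg_def fun_eq_iff split: if_splits)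

lemma homfun_nth: "homfun 1 (\<lambda>x. x $ i)"
  unfolding homfun_def
  by (intro exI[of _ "Poly_Mapping.single (Poly_Mapping.single i 1) 1"])
    (auto simp: poly_eval_single monom_eval_def monom_deg_def fun_eq_iff)

lemma homfun_zero: "homfun d (\<lambda>_. 0)"
  unfolding homfun_def by (intro exI[of _ 0]) (auto simp: fun_eq_iff)

lemma homfun_add:
  assumes "homfun d f" "homfun d g"
  shows "homfun d (\<lambda>x. f x + g x)"
proof -
  from assms obtain p q where "f = poly_eval p" "\<forall>m\<in>Poly_Mapping.keys p. monom_deg m = d"
    "g = poly_eval q" "\<forall>m\<in>Poly_Mapping.keys q. monom_deg m = d"
    unfolding homfun_def by auto
  then show ?thesis
    unfolding homfun_def using keys_add[of p q]
    by (intro exI[of _ "p + q"]) (auto simp: poly_eval_add fun_eq_iff)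
qed

lemma homfun_mult:
  assumes "homfun d f" "homfun e g"
  shows "homfun (d + e) (\<lambda>x. f x * g x)"
proof -
  from assms obtain p q where *: "f = poly_eval p" "\<forall>m\<in>Poly_Mapping.keys p. monom_deg m = d"
    "g = poly_eval q" "\<forall>m\<in>Poly_Mapping.keys q. monom_deg m = e"
    unfolding homfun_def by auto
  then have "\<forall>m\<in>Poly_Mapping.keys (p * q). monom_deg m = d + e"
    using keys_mult[of p q] by (fastforce simp: monom_deg_add)
  with * show ?thesis
    unfolding homfun_def by (intro exI[of _ "p * q"]) (auto simp: poly_eval_mult fun_eq_iff)
qed

lemma homfun_cmult: "homfun d f \<Longrightarrow> homfun d (\<lambda>x. c * f x)"
  using homfun_mult[OF homfun_const] by fastforce

lemma homfun_sum: "(\<And>i. i \<in> I \<Longrightarrow> homfun d (f i)) \<Longrightarrow> homfun d (\<lambda>x. \<Sum>i\<in>I. f i x)"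
  by (induction I rule: infinite_finite_induct) (auto intro: homfun_zero homfun_add)

lemma homfun_prod:
  "finite I \<Longrightarrow> (\<And>i. i \<in> I \<Longrightarrow> homfun (d i) (f i)) \<Longrightarrow> homfun (\<Sum>i\<in>I. d i) (\<lambda>x. \<Prod>i\<in>I. f i x)"
  by (induction I rule: finite_induct) (auto intro: homfun_const homfun_mult)

lemma homfun_power: "homfun d f \<Longrightarrow> homfun (d * n) (\<lambda>x. f x ^ n)"
  using homfun_prod[of "{..<n}" "\<lambda>_. d" "\<lambda>_. f"] by (simp add: mult.commute)

lemma homfun_scale:
  assumes "homfun d f"
  shows "f (c *s x) = c ^ d * f x"
proof -
  from assms obtain q where q: "f = poly_eval q" "\<forall>m\<in>Poly_Mapping.keys q. monom_deg m = d"
    unfolding homfun_def by auto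
  then show ?thesis
    by (auto simp: poly_eval_def monom_eval_scale sum_distrib_left mult_ac intro!: sum.cong)
qed

lemma homfun_polyfun: "homfun d f \<Longrightarrow> polyfun f"
  unfolding homfun_def using polyfun_poly_eval by auto

lemma proj_point_scale:
  assumes "c \<noteq> 0"
  shows "proj_point (c *s p) = proj_point p"
proof
  show "proj_point (c *s p) \<subseteq> proj_point p"
  proof
    fix x assume "x \<in> proj_point (c *s p)"
    then obtain d where "d \<noteq> 0" "x = d *s (c *s p)" unfolding proj_point_def by blast
    then show "x \<in> proj_point p"
      unfolding proj_point_def using assms
      by (intro CollectI exI[of _ "d * c"]) (simp add: vector_smult_assoc)
  qed
  show "proj_point p \<subseteq> proj_point (c *s p)"
  proof
    fix x assume "x \<in> proj_point p"
    then obtain d where "d \<noteq> 0" "x = d *s p" unfolding proj_point_def by blast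
    then show "x \<in> proj_point (c *s p)"
      unfolding proj_point_def using assms
      by (intro CollectI exI[of _ "d / c"]) (simp add: vector_smult_assoc)
  qed
qed

lemma proj_locus_homfun:
  assumes "homfun d f"
  shows closedin_homfun: "closedin zariski (proj_locus (\<lambda>p. f p = 0))"
    and proj_point_in_homfun: "p \<noteq> 0 \<Longrightarrow> proj_point p \<in> proj_locus (\<lambda>p. f p = 0) \<longleftrightarrow> f p = 0"
proof -
  from assms obtain q where q: "f = poly_eval q" "\<forall>m\<in>Poly_Mapping.keys q. monom_deg m = d"
    unfolding homfun_def by auto
  have eq: "proj_locus (\<lambda>p. f p = 0) = proj_zeros {q}"
    by (simp add: proj_zeros_def q)
  have q': "\<forall>f\<in>{q}. homogeneous_poly f" using q by (auto simp: homogeneous_poly_def)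
  then show "closedin zariski (proj_locus (\<lambda>p. f p = 0))"
    unfolding closedin_zariski eq by blast
  show "p \<noteq> 0 \<Longrightarrow> proj_point p \<in> proj_locus (\<lambda>p. f p = 0) \<longleftrightarrow> f p = 0"
    unfolding eq using proj_point_in_zeros_iff[OF q'] by (simp add: q)
qed

text \<open>Points outside a closed set are detected by forms. This replaces ideals in the arguments about
  irreducible sets and strict inclusions.\<close>

lemma closedin_separation:
  assumes "closedin zariski S" "p \<noteq> 0" "proj_point p \<notin> S"
  shows "\<exists>d f. homfun d f \<and> f p \<noteq> 0 \<and> (\<forall>q. q \<noteq> 0 \<longrightarrow> proj_point q \<in> S \<longrightarrow> f q = 0)"
proof -
  obtain F where F: "\<forall>f\<in>F. homogeneous_poly f" "S = proj_zeros F"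
    using assms(1) unfolding closedin_zariski by blast
  then obtain f where f: "f \<in> F" "poly_eval f p \<noteq> 0"
    using assms(2,3) proj_point_in_zeros_iff[OF F(1) assms(2)] by auto
  moreover have "poly_eval f q = 0" if "q \<noteq> 0" "proj_point q \<in> S" for q
    using that F f proj_point_in_zeros_iff[OF F(1) that(1)] by auto
  ultimately show ?thesis
    using F(1) unfolding homfun_def homogeneous_poly_def by blast
qed

lemma topspace_zariski_iff: "x \<in> topspace zariski \<longleftrightarrow> (\<exists>p. p \<noteq> 0 \<and> x = proj_point p)"
  unfolding topspace_zariski proj_locus_def by auto

lemma homfun_zero_on_closure:
  assumes f: "homfun d f" and A: "\<And>a. a \<in> A \<Longrightarrow> f a = 0"
    and q: "q \<noteq> 0" "proj_point q \<in> zariski closure_of (proj_point ` A)"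
  shows "f q = 0"
proof -
  have "zariski closure_of (proj_point ` A) =
      zariski closure_of (topspace zariski \<inter> proj_point ` A)"
    by (rule closure_of_restrict)
  also have "\<dots> \<subseteq> proj_locus (\<lambda>p. f p = 0)"
  proof (intro closure_of_minimal closedin_homfun[OF f] subsetI)
    fix x assume "x \<in> topspace zariski \<inter> proj_point ` A"
    then obtain p a where p: "p \<noteq> 0" "x = proj_point p" "x = proj_point a" "a \<in> A"
      unfolding Int_iff topspace_zariski_iff by blast
    then obtain c where "p = c *s a" using proj_point_eqD by metis
    then have "f p = 0" using A[OF p(4)] homfun_scale[OF f] by simp
    then show "x \<in> proj_locus (\<lambda>p. f p = 0)" using p by (simp add: proj_point_in_homfun[OF f])
  qed
  finally show ?thesis using q proj_point_in_homfun[OF f] by blast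
qed

lemma irreducible_homfun_mult:
  assumes Z: "irreducible_in zariski Z" and f: "homfun d f" and g: "homfun e g"
    and fg: "\<And>p. p \<noteq> 0 \<Longrightarrow> proj_point p \<in> Z \<Longrightarrow> f p * g p = 0"
    and a: "a \<noteq> 0" "proj_point a \<in> Z" "f a \<noteq> 0"
    and b: "b \<noteq> 0" "proj_point b \<in> Z"
  shows "g b = 0"
proof -
  have "Z \<subseteq> proj_locus (\<lambda>p. f p = 0) \<union> proj_locus (\<lambda>p. g p = 0)"
  proof
    fix x assume x: "x \<in> Z"
    then obtain p where "p \<noteq> 0" "x = proj_point p"
      using Z unfolding irreducible_in_def topspace_zariski_iff[symmetric] by (auto simp: topspace_zariski_iff subset_iff)
    with fg[of p] x show "x \<in> proj_locus (\<lambda>p. f p = 0) \<union> proj_locus (\<lambda>p. g p = 0)"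
      using proj_point_in_homfun[OF f, of p] proj_point_in_homfun[OF g, of p] by auto
  qed
  then have "Z \<subseteq> proj_locus (\<lambda>p. f p = 0) \<or> Z \<subseteq> proj_locus (\<lambda>p. g p = 0)"
    using Z closedin_homfun[OF f] closedin_homfun[OF g] unfolding irreducible_in_def by blast
  then show ?thesis
    using a b proj_point_in_homfun[OF f] proj_point_in_homfun[OF g] by blast
qed

text \<open>A lower bound \<open>m\<close> for the Hilbert function of \<open>Z\<close> in degree \<open>D\<close>.\<close>

definition has_independent_forms :: "(complex ^ 'i::finite) set set \<Rightarrow> nat \<Rightarrow> nat \<Rightarrow> bool" where
  "has_independent_forms Z D m \<longleftrightarrow> (\<exists>b. (\<forall>i<m. homfun D (b i)) \<and>
     (\<forall>c. (\<forall>p. p \<noteq> 0 \<longrightarrow> proj_point p \<in> Z \<longrightarrow> (\<Sum>i<m. c i * b i p) = 0) \<longrightarrow> (\<forall>i<m. c i = 0)))"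

lemma sum_lessThan_add: "(\<Sum>i<m + n. f i) = (\<Sum>i<m. f i) + (\<Sum>i<n. f (m + i))"
  for f :: "nat \<Rightarrow> 'a::comm_monoid_add"
  by (induction n) (auto simp: add.assoc)

text \<open>Let a form \<open>f\<close> vanish on \<open>Z\<close> but not on the irreducible set \<open>Z'\<close>. Forms that are independent on \<open>Z\<close>
  and multiples of \<open>f\<close> by forms that are independent on \<open>Z'\<close> are independent together: restriction to
  \<open>Z\<close> kills the multiples, and \<open>f\<close> can be cancelled on \<open>Z'\<close>.\<close>

lemma has_independent_forms_step:
  assumes Z: "Z \<subseteq> Z'" "irreducible_in zariski Z'"
    and f: "homfun e f" "\<And>p. p \<noteq> 0 \<Longrightarrow> proj_point p \<in> Z \<Longrightarrow> f p = 0"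
    and a: "a \<noteq> 0" "proj_point a \<in> Z'" "f a \<noteq> 0"
    and 1: "has_independent_forms Z (D + e) m" and 2: "has_independent_forms Z' D n"
  shows "has_independent_forms Z' (D + e) (m + n)"
proof -
  from 1 obtain b where b: "\<And>i. i < m \<Longrightarrow> homfun (D + e) (b i)"
    "\<And>c. (\<forall>p. p \<noteq> 0 \<longrightarrow> proj_point p \<in> Z \<longrightarrow> (\<Sum>i<m. c i * b i p) = 0) \<Longrightarrow> \<forall>i<m. c i = 0"
    unfolding has_independent_forms_def by auto
  from 2 obtain b' where b': "\<And>i. i < n \<Longrightarrow> homfun D (b' i)"
    "\<And>c. (\<forall>p. p \<noteq> 0 \<longrightarrow> proj_point p \<in> Z' \<longrightarrow> (\<Sum>i<n. c i * b' i p) = 0) \<Longrightarrow> \<forall>i<n. c i = 0"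
    unfolding has_independent_forms_def by auto
  define B where "B i = (if i < m then b i else (\<lambda>p. b' (i - m) p * f p))" for i
  have "homfun (D + e) (B i)" if "i < m + n" for i
    using that b(1) homfun_mult[OF b'(1) f(1)] by (auto simp: B_def)
  moreover have "\<forall>i<m + n. c i = 0"
    if c: "\<forall>p. p \<noteq> 0 \<longrightarrow> proj_point p \<in> Z' \<longrightarrow> (\<Sum>i<m + n. c i * B i p) = 0" for c
  proof -
    have split: "(\<Sum>i<m + n. c i * B i p) = (\<Sum>i<m. c i * b i p) + f p * (\<Sum>i<n. c (m + i) * b' i p)" for p
      by (simp add: sum_lessThan_add B_def sum_distrib_left mult_ac)
    have "(\<Sum>i<m. c i * b i p) = 0" if "p \<noteq> 0" "proj_point p \<in> Z" for p
      using c split[of p] f(2)[OF that] that Z(1) by auto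
    then have cm: "\<forall>i<m. c i = 0" using b(2)[of c] by blast
    have g: "homfun D (\<lambda>p. \<Sum>i<n. c (m + i) * b' i p)"
      by (intro homfun_sum homfun_cmult b') auto
    have "f p * (\<Sum>i<n. c (m + i) * b' i p) = 0" if "p \<noteq> 0" "proj_point p \<in> Z'" for p
      using c split[of p] that cm by auto
    then have "(\<Sum>i<n. c (m + i) * b' i p) = 0" if "p \<noteq> 0" "proj_point p \<in> Z'" for p
      using irreducible_homfun_mult[OF Z(2) f(1) g _ a that] by blast
    then have "\<forall>i<n. c (m + i) = 0" using b'(2)[of "\<lambda>i. c (m + i)"] by blast
    with cm show ?thesis by (metis add_diff_inverse_nat nat_add_left_cancel_less)
  qed
  ultimately show ?thesis unfolding has_independent_forms_def by blast
qed

lemma has_independent_forms_1: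
  assumes "Z \<noteq> {}" "Z \<subseteq> topspace zariski"
  shows "has_independent_forms Z D 1"
proof -
  obtain p where p: "p \<noteq> 0" "proj_point p \<in> Z"
    using assms unfolding topspace_zariski by (auto simp: proj_locus_def)
  then obtain i where "p $ i \<noteq> 0" by (auto simp: vec_eq_iff)
  then show ?thesis
    unfolding has_independent_forms_def
    using homfun_power[OF homfun_nth[of i], of D] p
    by (intro exI[of _ "\<lambda>_ x. x $ i ^ D"]) auto
qed

text \<open>By induction along the chain and on \<open>D\<close>, where \<open>has_independent_forms_step\<close> provides Pascal's recursion.\<close>

lemma chain_has_independent_forms:
  fixes Z :: "nat \<Rightarrow> (complex ^ 'i::finite) set set"
  assumes Z: "\<And>i. i \<le> k \<Longrightarrow> closedin zariski (Z i)" "\<And>i. i \<le> k \<Longrightarrow> irreducible_in zariski (Z i)"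
    and strict: "\<And>i. i < k \<Longrightarrow> Z i \<subset> Z (Suc i)"
  shows "\<exists>e>0. \<forall>D. has_independent_forms (Z k) (e * D) ((D + k) choose k)"
proof -
  define P where "P i e f a \<longleftrightarrow> homfun e f \<and> (\<forall>q. q \<noteq> 0 \<longrightarrow> proj_point q \<in> Z i \<longrightarrow> f q = 0) \<and>
      a \<noteq> 0 \<and> proj_point a \<in> Z (Suc i) \<and> f a \<noteq> 0 \<and> e > 0" for i e f a
  have "\<exists>e f a. P i e f a" if i: "i < k" for i
  proof -
    obtain x where x: "x \<in> Z (Suc i)" "x \<notin> Z i" using strict[OF i] by blast
    then obtain a where a: "a \<noteq> 0" "x = proj_point a"
      using Z(2)[of "Suc i"] i unfolding irreducible_in_def topspace_zariski
      by (auto simp: proj_locus_def)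
    have "closedin zariski (Z i)" "proj_point a \<notin> Z i" using Z(1) i x a by auto
    then obtain e f where f: "homfun e f" "f a \<noteq> 0" "\<forall>q. q \<noteq> 0 \<longrightarrow> proj_point q \<in> Z i \<longrightarrow> f q = 0"
      using closedin_separation[of "Z i" a] a(1) by blast
    have "e > 0"
    proof (rule ccontr)
      assume "\<not> e > 0"
      then have const: "f (c *s q) = f q" for c q using homfun_scale[OF f(1), of c q] by simp
      have "Z i \<noteq> {}" "Z i \<subseteq> topspace zariski"
        using Z(2)[of i] i unfolding irreducible_in_def by auto
      then obtain q where q: "q \<noteq> 0" "proj_point q \<in> Z i"
        by (metis all_not_in_conv subset_iff topspace_zariski_iff)
      have "f a = f (0 *s a)" "f q = f (0 *s q)" using const by metis+
      then show False using f q by simp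
    qed
    with f a x show ?thesis unfolding P_def by blast
  qed
  then obtain e f a where "\<And>i. i < k \<Longrightarrow> P i (e i) (f i) (a i)" by metis
  then have f: "\<And>i. i < k \<Longrightarrow> homfun (e i) (f i)"
    "\<And>i q. i < k \<Longrightarrow> q \<noteq> 0 \<Longrightarrow> proj_point q \<in> Z i \<Longrightarrow> f i q = 0"
    and a: "\<And>i. i < k \<Longrightarrow> a i \<noteq> 0" "\<And>i. i < k \<Longrightarrow> proj_point (a i) \<in> Z (Suc i)"
      "\<And>i. i < k \<Longrightarrow> f i (a i) \<noteq> 0" "\<And>i. i < k \<Longrightarrow> e i > 0"
    unfolding P_def by auto
  (* Powers bring the separating forms to a common degree. *)
  define E where "E = (\<Prod>i<k. e i)"
  have E: "E > 0" unfolding E_def using a(4) by (intro prod_pos) auto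
  define g where "g i p = f i p ^ (E div e i)" for i p
  have g: "homfun E (g i)" "g i (a i) \<noteq> 0"
    "\<And>q. q \<noteq> 0 \<Longrightarrow> proj_point q \<in> Z i \<Longrightarrow> g i q = 0" if i: "i < k" for i
  proof -
    have dvd: "e i dvd E" unfolding E_def using i by (intro dvd_prodI) auto
    then have "e i * (E div e i) = E" by simp
    then show "homfun E (g i)" using homfun_power[OF f(1)[OF i], of "E div e i"] by (simp add: g_def[abs_def])
    show "g i (a i) \<noteq> 0" using a(3)[OF i] by (simp add: g_def)
    have "E div e i > 0" using dvd E a(4)[OF i] by (simp add: dvd_imp_le div_greater_zero_iff)
    then show "g i q = 0" if "q \<noteq> 0" "proj_point q \<in> Z i" for q
      using f(2)[OF i that] by (simp add: g_def)
  qed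
  have "has_independent_forms (Z r) (E * D) ((D + r) choose r)" if "r \<le> k" for r D
    using that
  proof (induction r arbitrary: D)
    case 0
    then show ?case using has_independent_forms_1[of "Z 0"] Z(2)[of 0] by (simp add: irreducible_in_def)
  next
    case (Suc r)
    show ?case
    proof (induction D)
      case 0
      then show ?case using has_independent_forms_1[of "Z (Suc r)"] Z(2)[of "Suc r"] Suc.prems
        by (simp add: irreducible_in_def)
    next
      case (Suc D)
      have r: "r < k" using \<open>Suc r \<le> k\<close> by simp
      have "has_independent_forms (Z (Suc r)) (E * D + E) ((Suc D + r choose r) + (D + Suc r choose Suc r))"
      proof (rule has_independent_forms_step[OF _ _ g(1)[OF r] g(3)[OF r] a(1,2)[OF r] g(2)[OF r]])
        show "Z r \<subseteq> Z (Suc r)" using strict[OF r] by blast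
        show "irreducible_in zariski (Z (Suc r))" using Z(2) r by simp
        show "has_independent_forms (Z r) (E * D + E) (Suc D + r choose r)"
          using Suc.prems \<open>\<And>D. r \<le> k \<Longrightarrow> has_independent_forms (Z r) (E * D) (D + r choose r)\<close>[of "Suc D"] r
          by (simp add: add.commute)
        show "has_independent_forms (Z (Suc r)) (E * D) (D + Suc r choose Suc r)" by fact
      qed
      then show ?case by (simp add: add.commute)
    qed
  qed
  then show ?thesis using E by blast
qed

lemma homfun_monomials:
  assumes "homfun D f"
  obtains M c where "finite M" "\<And>\<beta>. \<beta> \<in> M \<Longrightarrow> (\<forall>i. \<beta> i \<le> D)"
    "\<And>p. f p = (\<Sum>\<beta>\<in>M. c \<beta> * (\<Prod>i\<in>UNIV. p $ i ^ \<beta> i))"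
proof -
  from assms obtain q where q: "f = poly_eval q" "\<forall>m\<in>Poly_Mapping.keys q. monom_deg m = D"
    unfolding homfun_def by auto
  have inj: "inj_on Poly_Mapping.lookup (Poly_Mapping.keys q)"
    by (auto simp: inj_on_def lookup_inject)
  define c where "c \<beta> = Poly_Mapping.lookup q (THE m. Poly_Mapping.lookup m = \<beta>)" for \<beta>
  have c: "c (Poly_Mapping.lookup m) = Poly_Mapping.lookup q m" for m
    unfolding c_def by (simp add: lookup_inject)
  show ?thesis
  proof (rule that[of "Poly_Mapping.lookup ` Poly_Mapping.keys q" c])
    show "\<forall>i. \<beta> i \<le> D" if \<beta>: "\<beta> \<in> Poly_Mapping.lookup ` Poly_Mapping.keys q" for \<beta>
    proof
      fix i
      obtain m where m: "m \<in> Poly_Mapping.keys q" "\<beta> = Poly_Mapping.lookup m" using \<beta> by blast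
      show "\<beta> i \<le> D"
      proof (cases "i \<in> Poly_Mapping.keys m")
        case True
        then have "Poly_Mapping.lookup m i \<le> monom_deg m"
          unfolding monom_deg_def by (intro member_le_sum) auto
        then show ?thesis using m q(2) by simp
      next
        case False
        then show ?thesis using m by (simp add: in_keys_iff)
      qed
    qed
    show "f p = (\<Sum>\<beta>\<in>Poly_Mapping.lookup ` Poly_Mapping.keys q. c \<beta> * (\<Prod>i\<in>UNIV. p $ i ^ \<beta> i))" for p
      by (simp add: sum.reindex[OF inj] c q(1) poly_eval_def monom_eval_UNIV)
  qed simp
qed

text \<open>Algebraic dependence on \<open>A\<close> of the coordinates in \<open>J\<close>. The relation need not be homogeneous, because \<open>A\<close>
  will be a set of representatives with one coordinate equal to 1.\<close>

definition coordinates_dependent :: "'i set \<Rightarrow> (complex ^ 'i) set \<Rightarrow> bool" where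
  "coordinates_dependent J A \<longleftrightarrow> (\<exists>D c. (\<exists>\<alpha>\<in>exponents J D. c \<alpha> \<noteq> 0) \<and>
     (\<forall>p\<in>A. (\<Sum>\<alpha>\<in>exponents J D. c \<alpha> * (\<Prod>j\<in>J. p $ j ^ \<alpha> j)) = 0))"

text \<open>Choose at most \<open>k\<close> positions for the large entries; all others take at most \<open>e\<close> values.\<close>

lemma card_few_large:
  fixes e :: nat
  assumes "e > 0"
  shows "finite {\<tau> :: 'i::finite \<Rightarrow> nat. (\<forall>i. \<tau> i \<le> N) \<and> card {i. e \<le> \<tau> i} \<le> k}"
    and "card {\<tau> :: 'i::finite \<Rightarrow> nat. (\<forall>i. \<tau> i \<le> N) \<and> card {i. e \<le> \<tau> i} \<le> k}
      \<le> 2 ^ CARD('i) * e ^ CARD('i) * (N + 1) ^ k"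
proof -
  let ?T = "{\<tau> :: 'i \<Rightarrow> nat. (\<forall>i. \<tau> i \<le> N) \<and> card {i. e \<le> \<tau> i} \<le> k}"
  let ?P = "\<lambda>I :: 'i set. PiE UNIV (\<lambda>i. if i \<in> I then {..N} else {..<e})"
  let ?II = "{I :: 'i set. card I \<le> k}"
  have fin: "finite (\<Union>I\<in>?II. ?P I)"
    by (intro finite_UN_I finite_PiE) auto
  have sub: "?T \<subseteq> (\<Union>I\<in>?II. ?P I)"
  proof
    fix \<tau> assume "\<tau> \<in> ?T"
    then show "\<tau> \<in> (\<Union>I\<in>?II. ?P I)"
      by (intro UN_I[of "{i. e \<le> \<tau> i}"]) auto
  qed
  show "finite ?T" using finite_subset[OF sub fin] .
  have "card (?P I) \<le> e ^ CARD('i) * (N + 1) ^ k" if "I \<in> ?II" for I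
  proof -
    have "card (?P I) = (\<Prod>i\<in>UNIV. if i \<in> I then N + 1 else e)"
      by (subst card_PiE) (auto intro!: prod.cong)
    also have "\<dots> = (N + 1) ^ card I * e ^ card (- I)"
      by (simp add: prod.If_cases Compl_eq)
    also have "\<dots> \<le> (N + 1) ^ k * e ^ CARD('i)"
      using that assms by (intro mult_le_mono power_increasing card_mono) auto
    finally show ?thesis by (simp add: mult.commute)
  qed
  then have "(\<Sum>I\<in>?II. card (?P I)) \<le> card ?II * (e ^ CARD('i) * (N + 1) ^ k)"
    using sum_bounded_above[of ?II "\<lambda>I. card (?P I)"] by auto
  moreover have "card ?II \<le> 2 ^ CARD('i)"
    using card_mono[of "UNIV :: 'i set set" ?II] by (simp add: card_UNIV_set)
  ultimately have "(\<Sum>I\<in>?II. card (?P I)) \<le> 2 ^ CARD('i) * (e ^ CARD('i) * (N + 1) ^ k)"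
    by (meson le_trans mult_le_mono1)
  moreover have "card ?T \<le> (\<Sum>I\<in>?II. card (?P I))"
    using card_mono[OF fin sub] card_UN_le[of ?II ?P] by simp
  ultimately show "card ?T \<le> 2 ^ CARD('i) * e ^ CARD('i) * (N + 1) ^ k"
    by (simp add: mult.assoc)
qed

text \<open>Order exponent vectors by the weight \<open>wt\<close>, and let \<open>L J\<close> be the heaviest exponent in the relation of
  \<open>J\<close>. The relation rewrites every monomial divisible by that of \<open>L J\<close> in terms of lighter ones, so on \<open>A\<close> all forms
  are spanned by monomials divisible by none of the leading monomials. Such a monomial has at most \<open>k\<close>
  large exponents, and each exponent is at most the weight of the monomial that was rewritten, which is
  linear in the degree.\<close>

theorem forms_bound:
  fixes A :: "(complex ^ 'i::finite) set"
  assumes dep: "\<And>J. card J = Suc k \<Longrightarrow> coordinates_dependent J A"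
  shows "\<exists>K. \<forall>D. \<exists>T :: ('i \<Rightarrow> nat) set. finite T \<and> card T \<le> K * (D + 1) ^ k \<and>
    (\<forall>f. homfun D f \<longrightarrow> (\<exists>c. \<forall>p\<in>A. f p = (\<Sum>\<tau>\<in>T. c \<tau> * (\<Prod>i\<in>UNIV. p $ i ^ \<tau> i))))"
proof -
  let ?JJ = "{J :: 'i set. card J = Suc k}"
  define P where "P J D c \<longleftrightarrow> (\<exists>\<alpha>\<in>exponents J D. c \<alpha> \<noteq> 0) \<and>
     (\<forall>p\<in>A. (\<Sum>\<alpha>\<in>exponents J D. c \<alpha> * (\<Prod>j\<in>J. p $ j ^ \<alpha> j)) = 0)"
    for J :: "'i set" and D :: nat and c :: "('i \<Rightarrow> nat) \<Rightarrow> complex"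
  have "\<exists>D c. P J D c" if "card J = Suc k" for J
    using dep[OF that] unfolding coordinates_dependent_def P_def .
  then obtain d c where "\<And>J. card J = Suc k \<Longrightarrow> P J (d J) (c J)" by metis
  then have dc: "\<And>J. card J = Suc k \<Longrightarrow> (\<exists>\<alpha>\<in>exponents J (d J). c J \<alpha> \<noteq> 0)"
    "\<And>J p. card J = Suc k \<Longrightarrow> p \<in> A \<Longrightarrow>
      (\<Sum>\<alpha>\<in>exponents J (d J). c J \<alpha> * (\<Prod>j\<in>J. p $ j ^ \<alpha> j)) = 0"
    unfolding P_def by blast+
  define Dm where "Dm = (\<Sum>J\<in>?JJ. d J)"
  obtain idx :: "'i \<Rightarrow> nat" where idx: "inj idx" using inj_to_nat_exists by blast
  (* With base Dm + 1 no two exponents of one relation have the same weight. *)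
  define w where "w i = Suc Dm ^ idx i" for i
  define S where "S J = {\<alpha> \<in> exponents J (d J). c J \<alpha> \<noteq> 0}" for J
  define L where "L J = (SOME l. l \<in> S J \<and> (\<forall>\<alpha>\<in>S J. (\<Sum>i\<in>J. \<alpha> i * w i) \<le> (\<Sum>i\<in>J. l i * w i)))" for J
  have finS: "finite (S J)" for J 
    unfolding S_def by (rule finite_subset[of _ "exponents J (d J)"]) (auto intro!: finite_PiE)
  have S_sub: "S J \<subseteq> exponents J Dm" if "card J = Suc k" for J
  proof -
    have "d J \<le> Dm" unfolding Dm_def using that by (intro member_le_sum) auto
    then have "exponents J (d J) \<subseteq> exponents J Dm" by (intro PiE_mono) auto
    then show ?thesis unfolding S_def by blast
  qed
  have L: "L J \<in> S J" "\<And>\<alpha>. \<alpha> \<in> S J \<Longrightarrow> \<alpha> \<noteq> L J \<Longrightarrow> (\<Sum>i\<in>J. \<alpha> i * w i) < (\<Sum>i\<in>J. L J i * w i)"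
    if J: "card J = Suc k" for J
  proof -
    have "S J \<noteq> {}" using dc(1)[OF J] by (auto simp: S_def)
    then have "Max ((\<lambda>\<alpha>. \<Sum>i\<in>J. \<alpha> i * w i) ` S J) \<in> (\<lambda>\<alpha>. \<Sum>i\<in>J. \<alpha> i * w i) ` S J"
      using finS by (intro Max_in) auto
    then obtain l where "l \<in> S J" "Max ((\<lambda>\<alpha>. \<Sum>i\<in>J. \<alpha> i * w i) ` S J) = (\<Sum>i\<in>J. l i * w i)"
      by blast
    moreover have "\<forall>\<alpha>\<in>S J. (\<Sum>i\<in>J. \<alpha> i * w i) \<le> Max ((\<lambda>\<alpha>. \<Sum>i\<in>J. \<alpha> i * w i) ` S J)"
      using finS by (intro ballI Max_ge) auto
    ultimately have "l \<in> S J \<and> (\<forall>\<alpha>\<in>S J. (\<Sum>i\<in>J. \<alpha> i * w i) \<le> (\<Sum>i\<in>J. l i * w i))"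
      by simp
    then have *: "L J \<in> S J \<and> (\<forall>\<alpha>\<in>S J. (\<Sum>i\<in>J. \<alpha> i * w i) \<le> (\<Sum>i\<in>J. L J i * w i))"
      unfolding L_def
      by (rule someI[where P = "\<lambda>l. l \<in> S J \<and> (\<forall>\<alpha>\<in>S J. (\<Sum>i\<in>J. \<alpha> i * w i) \<le> (\<Sum>i\<in>J. l i * w i))"])
    show "L J \<in> S J" using * by blast
    show "(\<Sum>i\<in>J. \<alpha> i * w i) < (\<Sum>i\<in>J. L J i * w i)" if "\<alpha> \<in> S J" "\<alpha> \<noteq> L J" for \<alpha>
    proof -
      have "inj_on (\<lambda>\<alpha>. \<Sum>i\<in>J. \<alpha> i * w i) (exponents J Dm)"
        unfolding w_def by (intro inj_on_digits) (auto intro: inj_on_subset[OF idx])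
      then have "(\<Sum>i\<in>J. \<alpha> i * w i) \<noteq> (\<Sum>i\<in>J. L J i * w i)"
        using that * S_sub[OF J] unfolding inj_on_def by blast
      then show ?thesis using * that(1) by (meson order.not_eq_order_implies_strict)
    qed
  qed
  define wt where "wt \<beta> = (\<Sum>i\<in>UNIV. \<beta> i * w i)" for \<beta> :: "'i \<Rightarrow> nat"
  define mon where "mon \<beta> p = (\<Prod>i\<in>UNIV. p $ i ^ \<beta> i)" for \<beta> :: "'i \<Rightarrow> nat" and p :: "complex ^ 'i"
  have w1: "w i \<ge> 1" for i by (simp add: w_def)
  define T where "T N = {\<tau>. (\<forall>J. card J = Suc k \<longrightarrow> (\<exists>i\<in>J. \<tau> i < L J i)) \<and> wt \<tau> \<le> N}" for N
  have le_wt: "\<tau> i \<le> wt \<tau>" for \<tau> i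
  proof -
    have "\<tau> i * 1 \<le> \<tau> i * w i" using w1 by (intro mult_left_mono) auto
    also have "\<dots> \<le> wt \<tau>" unfolding wt_def by (rule member_le_sum) auto
    finally show ?thesis by simp
  qed
  have T_sub: "T N \<subseteq> {\<tau>. (\<forall>i. \<tau> i \<le> N) \<and> card {i. Suc Dm \<le> \<tau> i} \<le> k}" for N
  proof
    fix \<tau> assume \<tau>: "\<tau> \<in> T N"
    have "card {i. Suc Dm \<le> \<tau> i} \<le> k"
    proof (rule ccontr)
      assume "\<not> ?thesis"
      then obtain J where J: "J \<subseteq> {i. Suc Dm \<le> \<tau> i}" "card J = Suc k"
        by (metis not_less_eq_eq obtain_subset_with_card_n)
      then obtain i where i: "i \<in> J" "\<tau> i < L J i" using \<tau> by (auto simp: T_def)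
      have "L J i \<le> Dm" using L(1)[OF J(2)] S_sub[OF J(2)] i(1) by (auto dest: PiE_mem)
      then show False using i J by fastforce
    qed
    moreover have "\<tau> i \<le> N" for i using \<tau> le_wt[of \<tau> i] by (auto simp: T_def)
    ultimately show "\<tau> \<in> {\<tau>. (\<forall>i. \<tau> i \<le> N) \<and> card {i. Suc Dm \<le> \<tau> i} \<le> k}" by blast
  qed
  have T_card: "finite (T N)" "card (T N) \<le> 2 ^ CARD('i) * Suc Dm ^ CARD('i) * (N + 1) ^ k" for N
    by (rule finite_subset[OF T_sub card_few_large(1)], simp,
        rule order_trans[OF card_mono[OF card_few_large(1) T_sub] card_few_large(2)], simp_all)
  define sp where "sp N f \<longleftrightarrow> (\<exists>c. \<forall>p\<in>A. f p = (\<Sum>\<tau>\<in>T N. c \<tau> * mon \<tau> p))" for N f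
  have sp_sum: "sp N (\<lambda>p. \<Sum>x\<in>X. a x * g x p)" if "\<And>x. x \<in> X \<Longrightarrow> sp N (g x)"
    for N X and a :: "('i \<Rightarrow> nat) \<Rightarrow> complex" and g
  proof -
    have "\<forall>x\<in>X. \<exists>c. \<forall>p\<in>A. g x p = (\<Sum>\<tau>\<in>T N. c \<tau> * mon \<tau> p)" using that by (simp add: sp_def)
    from bchoice[OF this] obtain c where
      c: "\<And>x p. x \<in> X \<Longrightarrow> p \<in> A \<Longrightarrow> g x p = (\<Sum>\<tau>\<in>T N. c x \<tau> * mon \<tau> p)" by blast
    show ?thesis unfolding sp_def
    proof (intro exI[of _ "\<lambda>\<tau>. \<Sum>x\<in>X. a x * c x \<tau>"] ballI)
      fix p assume "p \<in> A"
      then have "(\<Sum>x\<in>X. a x * g x p) = (\<Sum>x\<in>X. \<Sum>\<tau>\<in>T N. a x * c x \<tau> * mon \<tau> p)"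
        by (simp add: c sum_distrib_left mult.assoc)
      also have "\<dots> = (\<Sum>\<tau>\<in>T N. (\<Sum>x\<in>X. a x * c x \<tau>) * mon \<tau> p)"
        by (subst sum.swap) (simp add: sum_distrib_right)
      finally show "(\<Sum>x\<in>X. a x * g x p) = (\<Sum>\<tau>\<in>T N. (\<Sum>x\<in>X. a x * c x \<tau>) * mon \<tau> p)" .
    qed
  qed
  have sp_mon: "sp N (mon \<beta>)" if "wt \<beta> \<le> N" for N \<beta>
    using that
  proof (induction "wt \<beta>" arbitrary: \<beta> rule: less_induct)
    case less
    show ?case
    proof (cases "\<beta> \<in> T N")
      case True
      have "mon \<beta> p = (\<Sum>\<tau>\<in>T N. (if \<tau> = \<beta> then 1 else 0) * mon \<tau> p)" for p
        using True T_card(1) by (simp add: if_distrib[of "\<lambda>x. x * _"] sum.delta cong: if_cong)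
      then show ?thesis
        unfolding sp_def by (intro exI[of _ "\<lambda>\<tau>. if \<tau> = \<beta> then 1 else 0"]) blast
    next
      case False
      then obtain J where J: "card J = Suc k" "\<And>i. i \<in> J \<Longrightarrow> L J i \<le> \<beta> i"
        using less.prems unfolding T_def by (auto simp: not_less)
      (* One rewriting step replaces the factor L J of beta by another exponent alpha of the relation. *)
      define ex where "ex \<alpha> i = (if i \<in> J then \<beta> i - L J i + \<alpha> i else \<beta> i)" for \<alpha> i
      define co where "co \<alpha> = - c J \<alpha> / c J (L J)" for \<alpha>
      have exL: "ex (L J) = \<beta>" using J(2) by (auto simp: ex_def fun_eq_iff)
      have split: "mon (ex \<alpha>) p = (\<Prod>j\<in>J. p $ j ^ \<alpha> j) * (\<Prod>i\<in>UNIV. p $ i ^ (if i \<in> J then \<beta> i - L J i else \<beta> i))"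
        for \<alpha> p
      proof -
        have "(\<Prod>j\<in>J. p $ j ^ \<alpha> j) = (\<Prod>i\<in>UNIV. p $ i ^ (if i \<in> J then \<alpha> i else 0))"
          by (rule prod.mono_neutral_cong_left) auto
        then show ?thesis unfolding mon_def ex_def
          by (simp add: prod.distrib[symmetric] power_add[symmetric] if_distrib cong: if_cong)
            (intro prod.cong; simp add: power_add)
      qed
      have red: "mon \<beta> p = (\<Sum>\<alpha>\<in>S J - {L J}. co \<alpha> * mon (ex \<alpha>) p)" if p: "p \<in> A" for p
      proof -
        have "(\<Sum>\<alpha>\<in>S J. c J \<alpha> * (\<Prod>j\<in>J. p $ j ^ \<alpha> j)) =
            (\<Sum>\<alpha>\<in>exponents J (d J). c J \<alpha> * (\<Prod>j\<in>J. p $ j ^ \<alpha> j))"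
          unfolding S_def by (rule sum.mono_neutral_left) (auto intro!: finite_PiE)
        then have "0 = (\<Sum>\<alpha>\<in>S J. c J \<alpha> * (\<Prod>j\<in>J. p $ j ^ \<alpha> j))"
          using dc(2)[OF J(1) p] by simp
        also have "\<dots> = c J (L J) * (\<Prod>j\<in>J. p $ j ^ L J j) + (\<Sum>\<alpha>\<in>S J - {L J}. c J \<alpha> * (\<Prod>j\<in>J. p $ j ^ \<alpha> j))"
          by (rule sum.remove[OF finS L(1)[OF J(1)]])
        finally have "c J (L J) * (\<Prod>j\<in>J. p $ j ^ L J j) = - (\<Sum>\<alpha>\<in>S J - {L J}. c J \<alpha> * (\<Prod>j\<in>J. p $ j ^ \<alpha> j))"
          by (simp add: add_eq_0_iff2)
        moreover have "c J (L J) \<noteq> 0" using L(1)[OF J(1)] by (simp add: S_def)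
        ultimately have "(\<Prod>j\<in>J. p $ j ^ L J j) = - (\<Sum>\<alpha>\<in>S J - {L J}. c J \<alpha> * (\<Prod>j\<in>J. p $ j ^ \<alpha> j)) / c J (L J)"
          by (simp add: field_simps)
        also have "\<dots> = (\<Sum>\<alpha>\<in>S J - {L J}. co \<alpha> * (\<Prod>j\<in>J. p $ j ^ \<alpha> j))"
          by (simp add: co_def sum_divide_distrib sum_negf)
        finally have "mon (ex (L J)) p = (\<Sum>\<alpha>\<in>S J - {L J}. co \<alpha> * mon (ex \<alpha>) p)"
          unfolding split by (simp add: sum_distrib_right mult.assoc)
        then show ?thesis by (simp add: exL)
      qed
      have "sp N (mon (ex \<alpha>))" if \<alpha>: "\<alpha> \<in> S J - {L J}" for \<alpha>
      proof -
        have wt_ex: "wt (ex \<alpha>) = (\<Sum>i\<in>J. \<alpha> i * w i) + (\<Sum>i\<in>UNIV. (if i \<in> J then \<beta> i - L J i else \<beta> i) * w i)" for \<alpha>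
        proof -
          have "(\<Sum>i\<in>J. \<alpha> i * w i) = (\<Sum>i\<in>UNIV. (if i \<in> J then \<alpha> i else 0) * w i)"
            by (rule sum.mono_neutral_cong_left) auto
          then show ?thesis
            unfolding wt_def ex_def by (simp add: sum.distrib[symmetric] algebra_simps if_distrib cong: if_cong)
              (intro sum.cong; simp add: algebra_simps)
        qed
        have "wt (ex \<alpha>) < wt (ex (L J))"
          unfolding wt_ex using L(2)[OF J(1)] \<alpha> by auto
        then have "wt (ex \<alpha>) < wt \<beta>" by (simp add: exL)
        then show ?thesis using less by (meson le_trans less_imp_le_nat)
      qed
      then have "sp N (\<lambda>p. \<Sum>\<alpha>\<in>S J - {L J}. co \<alpha> * mon (ex \<alpha>) p)"
        by (intro sp_sum) auto
      then show ?thesis unfolding sp_def using red by auto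
    qed
  qed
  define W where "W = (\<Sum>i\<in>UNIV. w i)"
  define K where "K = 2 ^ CARD('i) * Suc Dm ^ CARD('i) * (W + 1) ^ k"
  show ?thesis
  proof (intro exI[of _ K] allI)
    fix D
    have "(W * D + 1) ^ k \<le> ((W + 1) * (D + 1)) ^ k" by (intro power_mono) auto
    then have "card (T (W * D)) \<le> 2 ^ CARD('i) * Suc Dm ^ CARD('i) * ((W + 1) * (D + 1)) ^ k"
      using T_card(2)[of "W * D"] by (meson le_trans mult_le_mono2)
    also have "\<dots> = K * (D + 1) ^ k" by (simp only: K_def power_mult_distrib mult.assoc)
    finally have card: "card (T (W * D)) \<le> K * (D + 1) ^ k" .
    have "\<exists>c. \<forall>p\<in>A. f p = (\<Sum>\<tau>\<in>T (W * D). c \<tau> * (\<Prod>i\<in>UNIV. p $ i ^ \<tau> i))" if "homfun D f" for f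
    proof -
      obtain M a where M: "\<And>\<beta>. \<beta> \<in> M \<Longrightarrow> (\<forall>i. \<beta> i \<le> D)"
        "\<And>p. f p = (\<Sum>\<beta>\<in>M. a \<beta> * (\<Prod>i\<in>UNIV. p $ i ^ \<beta> i))"
        by (rule homfun_monomials[OF \<open>homfun D f\<close>]) (rule that)
      have "wt \<beta> \<le> W * D" if "\<beta> \<in> M" for \<beta>
        unfolding wt_def W_def sum_distrib_right
        using M(1)[OF that] by (intro sum_mono) (simp add: mult.commute)
      then have "sp (W * D) (\<lambda>p. \<Sum>\<beta>\<in>M. a \<beta> * mon \<beta> p)"
        by (intro sp_sum sp_mon)
      then show ?thesis unfolding sp_def mon_def M(2) .
    qed
    with card T_card(1) show "\<exists>T. finite T \<and> card T \<le> K * (D + 1) ^ k \<and>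
      (\<forall>f. homfun D f \<longrightarrow> (\<exists>c. \<forall>p\<in>A. f p = (\<Sum>\<tau>\<in>T. c \<tau> * (\<Prod>i\<in>UNIV. p $ i ^ \<tau> i))))" by blast
  qed
qed

lemma power_le_fact_binomial: "(D + 1) ^ r \<le> fact r * ((D + r) choose r)"
proof (induction r)
  case (Suc r)
  have "(D + 1) ^ Suc r \<le> (D + 1) * (fact r * ((D + r) choose r))"
    unfolding power_Suc by (rule mult_left_mono[OF Suc]) simp
  also have "\<dots> \<le> fact r * (Suc (D + r) * ((D + r) choose r))"
    by (simp add: algebra_simps)
  also have "\<dots> = fact (Suc r) * ((D + Suc r) choose Suc r)"
    by (simp only: Suc_times_binomial[symmetric] fact_Suc add_Suc_right of_nat_id mult_ac)
  finally show ?case .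
qed simp

lemma irreducible_in_subtopology:
  assumes S: "closedin T S" and Z: "Z \<subseteq> S"
  shows "irreducible_in (subtopology T S) Z \<longleftrightarrow> irreducible_in T Z"
proof
  assume irr: "irreducible_in (subtopology T S) Z"
  have "Z \<subseteq> B \<or> Z \<subseteq> C" if BC: "closedin T B \<and> closedin T C \<and> Z \<subseteq> B \<union> C" for B C
  proof -
    have "closedin (subtopology T S) (S \<inter> B)" "closedin (subtopology T S) (S \<inter> C)"
      using BC by (auto simp: closedin_subtopology)
    moreover have "Z \<subseteq> S \<inter> B \<union> S \<inter> C" using BC Z by auto
    ultimately have "Z \<subseteq> S \<inter> B \<or> Z \<subseteq> S \<inter> C"
      using irr unfolding irreducible_in_def by blast
    then show ?thesis by blast
  qed
  then show "irreducible_in T Z" using irr by (auto simp: irreducible_in_def)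
next
  assume irr: "irreducible_in T Z"
  then show "irreducible_in (subtopology T S) Z"
    using Z S closedin_subset[OF S] by (auto simp: irreducible_in_def closedin_closed_subtopology)
qed

text \<open>A chain of length \<open>k + 1\<close> gives \<open>(D + k + 1) choose (k + 1)\<close> independent forms in degree \<open>e * D\<close>, a
  polynomial of degree \<open>k + 1\<close> in \<open>D\<close>, which for large \<open>D\<close> exceeds the bound \<open>K * (e * D + 1) ^ k\<close> of
  \<open>forms_bound\<close>.\<close>

theorem proj_dim_le:
  fixes A :: "(complex ^ 'i::finite) set"
  assumes dep: "\<And>J. card J = Suc k \<Longrightarrow> coordinates_dependent J A"
    and S: "S = zariski closure_of (proj_point ` A)"
  shows "proj_dim S \<le> ereal (real k)"
proof -
  have closed: "closedin zariski S" unfolding S by simp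
  have "r \<le> k" if chain: "\<forall>i\<le>r. closedin (subtopology zariski S) (Z i) \<and> irreducible_in (subtopology zariski S) (Z i)"
    "\<forall>i<r. Z i \<subset> Z (Suc i)" for r and Z :: "nat \<Rightarrow> (complex ^ 'i) set set"
  proof (rule ccontr)
    assume "\<not> r \<le> k"
    then have r: "Suc k \<le> r" by simp
    have Zc: "closedin zariski (Z i)" "Z i \<subseteq> S" if "i \<le> Suc k" for i
      using chain(1) that r closed by (auto simp: closedin_closed_subtopology)
    have Zi: "irreducible_in zariski (Z i)" if i: "i \<le> Suc k" for i
      using chain(1) r i irreducible_in_subtopology[OF closed Zc(2)[OF i]] by auto
    have "Z i \<subset> Z (Suc i)" if "i < Suc k" for i using chain(2) that r by auto
    then obtain e where e: "e > 0" "\<And>D. has_independent_forms (Z (Suc k)) (e * D) ((D + Suc k) choose Suc k)"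
      using chain_has_independent_forms[of "Suc k" Z] Zc(1) Zi by blast
    have "\<exists>K. \<forall>D. \<exists>T :: ('i \<Rightarrow> nat) set. finite T \<and> card T \<le> K * (D + 1) ^ k \<and>
        (\<forall>f. homfun D f \<longrightarrow> (\<exists>c. \<forall>p\<in>A. f p = (\<Sum>\<tau>\<in>T. c \<tau> * (\<Prod>i\<in>UNIV. p $ i ^ \<tau> i))))"
      by (rule forms_bound) (rule dep)
    then obtain K where K: "\<And>D. \<exists>T :: ('i \<Rightarrow> nat) set. finite T \<and> card T \<le> K * (D + 1) ^ k \<and>
        (\<forall>f. homfun D f \<longrightarrow> (\<exists>c. \<forall>p\<in>A. f p = (\<Sum>\<tau>\<in>T. c \<tau> * (\<Prod>i\<in>UNIV. p $ i ^ \<tau> i))))"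
      by blast
    have le: "(D + Suc k) choose Suc k \<le> K * (e * D + 1) ^ k" for D
    proof (rule ccontr)
      let ?m = "(D + Suc k) choose Suc k"
      assume neg: "\<not> ?thesis"
      from K[of "e * D"] obtain T :: "('i \<Rightarrow> nat) set" where T: "finite T" "card T \<le> K * (e * D + 1) ^ k"
        "\<And>f. homfun (e * D) f \<Longrightarrow> (\<exists>c. \<forall>p\<in>A. f p = (\<Sum>\<tau>\<in>T. c \<tau> * (\<Prod>i\<in>UNIV. p $ i ^ \<tau> i)))" by blast
      from e(2)[of D] obtain b where b: "\<And>i. i < ?m \<Longrightarrow> homfun (e * D) (b i)"
        "\<And>c. (\<forall>p. p \<noteq> 0 \<longrightarrow> proj_point p \<in> Z (Suc k) \<longrightarrow> (\<Sum>i<?m. c i * b i p) = 0) \<Longrightarrow> (\<forall>i<?m. c i = 0)"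
        unfolding has_independent_forms_def by auto
      have "\<forall>i\<in>{..<?m}. \<exists>c. \<forall>p\<in>A. b i p = (\<Sum>\<tau>\<in>T. c \<tau> * (\<Prod>i\<in>UNIV. p $ i ^ \<tau> i))"
        using T(3) b(1) by auto
      from bchoice[OF this] obtain M where M: "\<And>i p. i < ?m \<Longrightarrow> p \<in> A \<Longrightarrow>
          b i p = (\<Sum>\<tau>\<in>T. M i \<tau> * (\<Prod>i\<in>UNIV. p $ i ^ \<tau> i))" by auto
      have "card T < card {..<?m}" using neg T(2) by simp
      then obtain c where c: "\<exists>i\<in>{..<?m}. c i \<noteq> 0" "\<forall>\<tau>\<in>T. (\<Sum>i\<in>{..<?m}. c i * M i \<tau>) = 0"
        using exists_nontrivial_solution[OF T(1), of "{..<?m}" M] by auto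
      have A: "(\<Sum>i<?m. c i * b i p) = 0" if "p \<in> A" for p
      proof -
        have "(\<Sum>i<?m. c i * b i p) = (\<Sum>i<?m. \<Sum>\<tau>\<in>T. c i * M i \<tau> * (\<Prod>i\<in>UNIV. p $ i ^ \<tau> i))"
          by (intro sum.cong) (auto simp: M that sum_distrib_left mult.assoc)
        also have "\<dots> = (\<Sum>\<tau>\<in>T. (\<Sum>i<?m. c i * M i \<tau>) * (\<Prod>i\<in>UNIV. p $ i ^ \<tau> i))"
          by (subst sum.swap) (simp add: sum_distrib_right)
        also have "\<dots> = 0" using c(2) by simp
        finally show ?thesis .
      qed
      have hom: "homfun (e * D) (\<lambda>p. \<Sum>i<?m. c i * b i p)"
        by (intro homfun_sum homfun_cmult b) auto
      have "(\<Sum>i<?m. c i * b i p) = 0" if p: "p \<noteq> 0" "proj_point p \<in> Z (Suc k)" for p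
      proof (rule homfun_zero_on_closure[OF hom A p(1)])
        show "proj_point p \<in> zariski closure_of (proj_point ` A)"
          using Zc(2)[of "Suc k"] p(2) unfolding S by auto
      qed
      then show False using b(2)[of c] c(1) by auto
    qed
    define D where "D = fact (Suc k) * (K * e ^ k)"
    have "(D + 1) ^ Suc k \<le> fact (Suc k) * ((D + Suc k) choose Suc k)" by (rule power_le_fact_binomial)
    also have "\<dots> \<le> fact (Suc k) * (K * (e * D + 1) ^ k)" using le by (intro mult_left_mono) auto
    also have "\<dots> \<le> fact (Suc k) * (K * (e * (D + 1)) ^ k)"
      using e(1) by (intro mult_left_mono power_mono) auto
    also have "\<dots> = D * (D + 1) ^ k" by (simp only: D_def power_mult_distrib mult.assoc)
    finally show False by simp
  qed
  then show ?thesis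
    unfolding proj_dim_def krull_dim_def by (intro Sup_least) auto
qed

section \<open>Holomorphic images and lower bounds for the dimension\<close>

lemma polyfun_holomorphic:
  assumes "polyfun f" "\<And>i. (\<lambda>z. g z $ i) holomorphic_on S"
  shows "(\<lambda>z. f (g z)) holomorphic_on S"
  using assms(1) by induction (auto intro!: holomorphic_intros assms(2))

lemma has_field_derivative_on_line:
  fixes G :: "complex ^ 'v \<Rightarrow> complex ^ 'w"
  assumes "(G has_derivative (\<lambda>h. N *v h)) (at (a + z *s w))"
  shows "((\<lambda>z. G (a + z *s w) $ i) has_field_derivative (N *v w) $ i) (at z)"
proof -
  have "linear (\<lambda>z. z *s w)"
    by (rule linearI) (auto simp: vec_eq_iff algebra_simps)
  then have "bounded_linear (\<lambda>z. z *s w)"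
    by (simp add: linear_conv_bounded_linear)
  then have "((\<lambda>z. a + z *s w) has_derivative (\<lambda>z. 0 + z *s w)) (at z)"
    by (intro has_derivative_add has_derivative_const bounded_linear_imp_has_derivative)
  from has_derivative_compose[OF this assms]
  have "((\<lambda>z. G (a + z *s w)) has_derivative (\<lambda>z. N *v (z *s w))) (at z)" by simp
  from bounded_linear.has_derivative[OF bounded_linear_vec_nth this, of i]
  have "((\<lambda>z. G (a + z *s w) $ i) has_derivative (\<lambda>z. (N *v w) $ i * z)) (at z)"
    by (simp add: matrix_vector_mult_def sum_distrib_left mult_ac)
  then show ?thesis
    by (rule has_derivative_imp_has_field_derivative) simp
qed

lemma holomorphic_on_line:
  fixes G :: "complex ^ 'v \<Rightarrow> complex ^ 'w"
  assumes "\<And>y. y \<in> V \<Longrightarrow> \<exists>N. (G has_derivative (\<lambda>h. N *v h)) (at y)"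
  shows "(\<lambda>z. G (a + z *s w) $ i) holomorphic_on {z. a + z *s w \<in> V}"
proof (rule holomorphic_onI)
  fix z assume "z \<in> {z. a + z *s w \<in> V}"
  then obtain N where "(G has_derivative (\<lambda>h. N *v h)) (at (a + z *s w))" using assms by blast
  from has_field_derivative_on_line[OF this]
  show "(\<lambda>z. G (a + z *s w) $ i) field_differentiable at z within {z. a + z *s w \<in> V}"
    using field_differentiable_at_within field_differentiable_def by blast
qed

lemma irreducible_in_closure:
  assumes "irreducible_in T Z"
  shows "irreducible_in T (T closure_of Z)"
  using assms closure_of_minimal[of Z] closure_of_subset[of Z T] closure_of_subset_topspace[of T Z]
  unfolding irreducible_in_def by (metis closedin_Un subset_empty subset_trans)

text \<open>If two forms separate points \<open>a\<close> and \<open>b\<close> from two closed sets that cover the image, then their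
  pullbacks to the complex line through \<open>a\<close> and \<open>b\<close> have product zero, although neither of them is zero. This
  contradicts the identity theorem.\<close>

lemma irreducible_in_holomorphic_image:
  fixes \<gamma> :: "complex ^ 'v \<Rightarrow> complex ^ 'i"
  assumes V: "open V" "convex V"
    and hol: "\<And>a w i. (\<lambda>z. \<gamma> (a + z *s w) $ i) holomorphic_on {z. a + z *s w \<in> V}"
    and Y: "Y \<subseteq> V" "Y \<noteq> {}"
      "\<And>a b z. a \<in> Y \<Longrightarrow> b \<in> Y \<Longrightarrow> a + z *s (b - a) \<in> V \<Longrightarrow> a + z *s (b - a) \<in> Y"
    and nz: "\<And>y. y \<in> Y \<Longrightarrow> \<gamma> y \<noteq> 0"
  shows "irreducible_in zariski ((\<lambda>y. proj_point (\<gamma> y)) ` Y)"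
  unfolding irreducible_in_def
proof (intro conjI allI impI)
  show "(\<lambda>y. proj_point (\<gamma> y)) ` Y \<subseteq> topspace zariski"
    using nz unfolding topspace_zariski_iff subset_iff by blast
  show "(\<lambda>y. proj_point (\<gamma> y)) ` Y \<noteq> {}" using Y(2) by simp
  fix B C assume BC: "closedin zariski B \<and> closedin zariski C \<and> (\<lambda>y. proj_point (\<gamma> y)) ` Y \<subseteq> B \<union> C"
  show "(\<lambda>y. proj_point (\<gamma> y)) ` Y \<subseteq> B \<or> (\<lambda>y. proj_point (\<gamma> y)) ` Y \<subseteq> C"
  proof (rule ccontr)
    assume "\<not> ?thesis"
    then obtain a b where ab: "a \<in> Y" "b \<in> Y" "proj_point (\<gamma> a) \<notin> B" "proj_point (\<gamma> b) \<notin> C" by auto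
    obtain d f where f: "homfun d f" "f (\<gamma> a) \<noteq> 0" "\<forall>q. q \<noteq> 0 \<longrightarrow> proj_point q \<in> B \<longrightarrow> f q = 0"
      using closedin_separation[of B "\<gamma> a"] BC nz[OF ab(1)] ab(3) by blast
    obtain e g where g: "homfun e g" "g (\<gamma> b) \<noteq> 0" "\<forall>q. q \<noteq> 0 \<longrightarrow> proj_point q \<in> C \<longrightarrow> g q = 0"
      using closedin_separation[of C "\<gamma> b"] BC nz[OF ab(2)] ab(4) by blast
    define l where "l z = a + z *s (b - a)" for z
    define \<Omega> where "\<Omega> = {z. l z \<in> V}"
    have l01: "l 0 = a" "l 1 = b" by (simp_all add: l_def)
    have hf: "(\<lambda>z. f (\<gamma> (l z))) holomorphic_on \<Omega>" and hg: "(\<lambda>z. g (\<gamma> (l z))) holomorphic_on \<Omega>"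
      unfolding l_def \<Omega>_def
      by (rule polyfun_holomorphic[OF homfun_polyfun[OF f(1)] hol],
          rule polyfun_holomorphic[OF homfun_polyfun[OF g(1)] hol])
    have cl: "continuous_on UNIV l"
      unfolding l_def vector_scalar_mult_def by (intro continuous_intros)
    have "open \<Omega>"
      using open_vimage[OF V(1) cl] by (simp add: \<Omega>_def vimage_def)
    have "convex \<Omega>"
    proof (rule convexI)
      fix x y and u v :: real
      assume xy: "x \<in> \<Omega>" "y \<in> \<Omega>" and uv: "0 \<le> u" "0 \<le> v" "u + v = 1"
      have u: "u = 1 - v" using uv by simp
      have "l (u *\<^sub>R x + v *\<^sub>R y) = u *\<^sub>R l x + v *\<^sub>R l y"
        unfolding u vec_eq_iff by (simp add: l_def) (simp add: scaleR_conv_of_real algebra_simps)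
      then show "u *\<^sub>R x + v *\<^sub>R y \<in> \<Omega>"
        using xy uv V(2) unfolding \<Omega>_def convex_def by auto
    qed
    have "0 \<in> \<Omega>" "1 \<in> \<Omega>" using ab Y(1) l01 by (auto simp: \<Omega>_def)
    define U where "U = \<Omega> \<inter> (\<lambda>z. f (\<gamma> (l z))) -` (- {0})"
    have "open U"
      unfolding U_def
      by (intro continuous_open_preimage holomorphic_on_imp_continuous_on hf \<open>open \<Omega>\<close>)
        (simp add: open_Compl)
    moreover have "0 \<in> U" using \<open>0 \<in> \<Omega>\<close> f(2) l01 by (simp add: U_def)
    then have "U \<noteq> {}" by blast
    moreover have "g (\<gamma> (l z)) = 0" if "z \<in> U" for z
    proof -
      have "l z \<in> Y" using Y(3)[OF ab(1,2), of z] that by (simp add: l_def \<Omega>_def U_def)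
      then have "\<gamma> (l z) \<noteq> 0" "proj_point (\<gamma> (l z)) \<in> B \<union> C" using nz BC by auto
      moreover have "f (\<gamma> (l z)) \<noteq> 0" using that by (simp add: U_def)
      ultimately show ?thesis using f(3) g(3) by blast
    qed
    moreover have "U \<subseteq> \<Omega>" by (simp add: U_def)
    ultimately have "g (\<gamma> (l 1)) = 0"
      using analytic_continuation_open[OF _ \<open>open \<Omega>\<close> _ convex_connected[OF \<open>convex \<Omega>\<close>] _ hg
          holomorphic_on_const[of 0] _ \<open>1 \<in> \<Omega>\<close>] by blast
    then show False using g(2) l01 by simp
  qed
qed

text \<open>The slices \<open>Y r\<close> of \<open>V\<close>, in which the first \<open>r\<close> coordinates of \<open>ks\<close> are free, give an increasing chain
  of irreducible closures. It is strict because each of these coordinates is a quotient of forms of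
  equal degree on the image: it is constant on one closure and takes another value on the next.\<close>

theorem proj_dim_ge:
  fixes \<gamma> :: "complex ^ 'v \<Rightarrow> complex ^ 'i"
  assumes V: "open V" "convex V" "y0 \<in> V"
    and hol: "\<And>a w i. (\<lambda>z. \<gamma> (a + z *s w) $ i) holomorphic_on {z. a + z *s w \<in> V}"
    and S: "closedin zariski S" and "distinct ks"
    and mem: "\<And>y. y \<in> V \<Longrightarrow> (\<And>v. v \<notin> set ks \<Longrightarrow> y $ v = y0 $ v) \<Longrightarrow>
      \<gamma> y \<noteq> 0 \<and> proj_point (\<gamma> y) \<in> S"
    and sep: "\<And>v. v \<in> set ks \<Longrightarrow> \<exists>d f g. homfun d f \<and> homfun d g \<and>
      (\<forall>y\<in>V. (\<forall>v. v \<notin> set ks \<longrightarrow> y $ v = y0 $ v) \<longrightarrow> g (\<gamma> y) \<noteq> 0 \<and> f (\<gamma> y) = y $ v * g (\<gamma> y))"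
  shows "ereal (real (length ks)) \<le> proj_dim S"
proof -
  define Y where "Y r = {y \<in> V. \<forall>v. v \<notin> set (take r ks) \<longrightarrow> y $ v = y0 $ v}" for r
  define I where "I r = (\<lambda>y. proj_point (\<gamma> y)) ` Y r" for r
  define Z where "Z r = zariski closure_of I r" for r
  have Y_mem: "\<gamma> y \<noteq> 0" "proj_point (\<gamma> y) \<in> S" if "y \<in> Y r" for y r
    using mem[of y] that set_take_subset[of r ks] by (auto simp: Y_def)
  have Z_sub: "Z r \<subseteq> S" for r
    unfolding Z_def using Y_mem by (intro closure_of_minimal S) (auto simp: I_def)
  have irr: "irreducible_in zariski (I r)" for r
    unfolding I_def
  proof (rule irreducible_in_holomorphic_image[OF V(1,2) hol])
    show "Y r \<subseteq> V" "Y r \<noteq> {}" using V(3) by (auto simp: Y_def)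
    show "a + z *s (b - a) \<in> Y r" if "a \<in> Y r" "b \<in> Y r" "a + z *s (b - a) \<in> V" for a b z
      using that by (auto simp: Y_def)
    show "\<gamma> y \<noteq> 0" if "y \<in> Y r" for y using Y_mem that by blast
  qed
  have I_sub: "I r \<subseteq> Z r" for r
    unfolding Z_def using irr[of r] by (intro closure_of_subset) (auto simp: irreducible_in_def)
  have "Z r \<subset> Z (Suc r)" if r: "r < length ks" for r
  proof
    have "Y r \<subseteq> Y (Suc r)" using set_take_subset_set_take[of r "Suc r" ks] by (auto simp: Y_def)
    then show "Z r \<subseteq> Z (Suc r)" unfolding Z_def I_def by (intro closure_of_mono image_mono)
    define v where "v = ks ! r"
    have v: "v \<in> set ks" "v \<notin> set (take r ks)" "v \<in> set (take (Suc r) ks)"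
      using r \<open>distinct ks\<close> by (auto simp: v_def take_Suc_conv_app_nth in_set_conv_nth nth_eq_iff_index_eq)
    obtain d f g where fg: "homfun d f" "homfun d g"
      "\<And>y r. y \<in> Y r \<Longrightarrow> g (\<gamma> y) \<noteq> 0 \<and> f (\<gamma> y) = y $ v * g (\<gamma> y)"
    proof -
      from sep[OF v(1)] obtain d f g where *: "homfun d f" "homfun d g"
        "\<forall>y\<in>V. (\<forall>v. v \<notin> set ks \<longrightarrow> y $ v = y0 $ v) \<longrightarrow> g (\<gamma> y) \<noteq> 0 \<and> f (\<gamma> y) = y $ v * g (\<gamma> y)" by blast
      have "g (\<gamma> y) \<noteq> 0 \<and> f (\<gamma> y) = y $ v * g (\<gamma> y)" if "y \<in> Y r" for y r
        using *(3) that set_take_subset[of r ks] by (auto simp: Y_def)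
      then show thesis using *(1,2) that by blast
    qed
    (* Vanishes where the v-th coordinate f / g has its value at the centre. *)
    define h where "h p = f p + (- (y0 $ v)) * g p" for p
    have h: "homfun d h" unfolding h_def[abs_def] by (intro homfun_add homfun_cmult fg)
    have hY: "h (\<gamma> y) = (y $ v - y0 $ v) * g (\<gamma> y)" if "y \<in> Y r" for y r
      using fg(3)[OF that] by (simp add: h_def algebra_simps)
    obtain \<epsilon> where \<epsilon>: "\<epsilon> > 0" "ball y0 \<epsilon> \<subseteq> V" using V open_contains_ball by blast
    define y where "y = y0 + axis v (of_real (\<epsilon> / 2) :: complex)"
    have "norm (axis v (of_real (\<epsilon> / 2) :: complex)) \<le> (\<Sum>k\<in>UNIV. norm (axis v (of_real (\<epsilon> / 2) :: complex) $ k))"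
      unfolding norm_vec_def by (rule L2_set_le_sum) simp
    also have "\<dots> = norm (of_real (\<epsilon> / 2) :: complex)"
      by (simp add: axis_def if_distrib[of norm] sum.delta cong: if_cong)
    also have "\<dots> < \<epsilon>" using \<epsilon>(1) by simp
    finally have "norm (axis v (of_real (\<epsilon> / 2) :: complex)) < \<epsilon>" .
    then have "y \<in> V" using \<epsilon>(2) by (auto simp: y_def dist_norm)
    then have y: "y \<in> Y (Suc r)" using v(3) by (auto simp: Y_def y_def axis_def)
    have "y $ v - y0 $ v \<noteq> 0" using \<epsilon>(1) by (simp add: y_def axis_def)
    then have hy: "h (\<gamma> y) \<noteq> 0" using hY[OF y] fg(3)[OF y] by simp
    have "proj_point (\<gamma> y) \<notin> Z r"
    proof
      assume "proj_point (\<gamma> y) \<in> Z r"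
      have "h (\<gamma> y) = 0"
      proof (rule homfun_zero_on_closure[OF h])
        show "\<gamma> y \<noteq> 0" using Y_mem y by blast
        show "proj_point (\<gamma> y) \<in> zariski closure_of (proj_point ` \<gamma> ` Y r)"
          using \<open>proj_point (\<gamma> y) \<in> Z r\<close> by (simp add: Z_def I_def image_image)
        show "h a = 0" if "a \<in> \<gamma> ` Y r" for a
          using that hY[of _ r] v(2) by (auto simp: Y_def)
      qed
      with hy show False by blast
    qed
    moreover have "proj_point (\<gamma> y) \<in> Z (Suc r)" using y I_sub[of "Suc r"] by (auto simp: I_def)
    ultimately show "Z r \<noteq> Z (Suc r)" by blast
  qed
  moreover have "closedin (subtopology zariski S) (Z r)" "irreducible_in (subtopology zariski S) (Z r)" for r
    using Z_sub[of r] S irreducible_in_closure[OF irr[of r]] irreducible_in_subtopology[OF S Z_sub[of r]]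
    by (auto simp: Z_def closedin_closed_subtopology)
  ultimately show ?thesis
    unfolding proj_dim_def krull_dim_def by (intro Sup_upper) blast
qed

section \<open>Clique factorisation and the conditional independence model\<close>

text \<open>Profiles are identified with the sets of players who choose \<open>2\<close>, with inverse \<open>prof\<close>.\<close>

definition supp :: "'n profile \<Rightarrow> 'n set" where
  "supp j = {i. j i = 2}"

definition prof :: "'n set \<Rightarrow> 'n profile" where
  "prof S = (\<lambda>i. if i \<in> S then 2 else 1)"

lemma not_1_iff_2: "(x :: 2) \<noteq> 1 \<longleftrightarrow> x = 2"
  using exhaust_2[of x] by auto

lemma supp_prof [simp]: "supp (prof S) = S"
  by (auto simp: supp_def prof_def)

lemma prof_supp [simp]: "prof (supp j) = j"
  using not_1_iff_2 by (auto simp: supp_def prof_def fun_eq_iff)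

definition cliques :: "'n set set \<Rightarrow> 'n set set" where
  "cliques E = {K. K \<noteq> {} \<and> (\<forall>u\<in>K. \<forall>v\<in>K. u \<noteq> v \<longrightarrow> {u, v} \<in> E)}"

text \<open>One potential for each clique, which acts on the profiles where the whole clique chooses \<open>2\<close>. In this
  form the potentials are determined by the point, and the coordinate at \<open>prof {}\<close> is normalised to 1.\<close>

definition clique_product :: "'n::finite set set \<Rightarrow> complex ^ 'n set \<Rightarrow> complex ^ 'n profile" where
  "clique_product E \<phi> = (\<chi> j. \<Prod>K\<in>{K \<in> cliques E. K \<subseteq> supp j}. \<phi> $ K)"

lemma clique_product_prof:
  "clique_product E \<phi> $ prof S = (\<Prod>K\<in>{K \<in> cliques E. K \<subseteq> S}. \<phi> $ K)"
  by (simp add: clique_product_def)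

lemma clique_product_empty [simp]: "clique_product E \<phi> $ prof {} = 1"
proof -
  have "{K \<in> cliques E. K \<subseteq> {}} = {}" by (auto simp: cliques_def)
  then show ?thesis unfolding clique_product_prof by (simp only: prod.empty)
qed

lemma clique_product_neq_0 [simp]: "clique_product E \<phi> \<noteq> 0"
  using clique_product_empty[of E \<phi>] by (metis zero_index zero_neq_one)

lemma clique_product_nonzero: "(\<And>K. \<phi> $ K \<noteq> 0) \<Longrightarrow> clique_product E \<phi> $ j \<noteq> 0"
  by (simp add: clique_product_def)

lemma clique_product_if:
  "clique_product E \<phi> $ j = (\<Prod>K\<in>cliques E. if K \<subseteq> supp j then \<phi> $ K else 1)"
  by (simp add: clique_product_def prod.If_cases Int_def)

lemma polyfun_clique_product: "polyfun (\<lambda>\<phi>. clique_product E \<phi> $ j)"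
  unfolding clique_product_def by (simp, intro fun_alg_intros polyfun_nth)

text \<open>The set \<open>A'\<close> of players reachable from \<open>A\<close> without meeting \<open>C\<close>. A statement with three sets
  that need not exhaust the players is thereby reduced to the partition into \<open>A'\<close>, \<open>C\<close> and the rest.\<close>

lemma separated_extension:
  assumes sep: "separates E C A B" and "A \<inter> C = {}"
  obtains A' where "A \<subseteq> A'" "A' \<inter> B = {}" "A' \<inter> C = {}"
    "\<And>x y. x \<in> A' \<Longrightarrow> y \<notin> A' \<Longrightarrow> y \<notin> C \<Longrightarrow> {x, y} \<notin> E"
proof
  define A' where "A' = {last vs | vs. graph_path E vs \<and> hd vs \<in> A \<and> set vs \<inter> C = {}}"
  show "A \<subseteq> A'"
  proof
    fix a assume "a \<in> A"
    then show "a \<in> A'" unfolding A'_def using assms(2)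
      by (intro CollectI exI[of _ "[a]"]) (auto simp: graph_path_def)
  qed
  show "A' \<inter> B = {}" using sep by (auto simp: A'_def separates_def)
  show "A' \<inter> C = {}"
  proof -
    have "last vs \<notin> C" if "graph_path E vs" "set vs \<inter> C = {}" for vs
      using that last_in_set[of vs] by (auto simp: graph_path_def disjoint_iff)
    then show ?thesis by (auto simp: A'_def)
  qed
  fix x y assume x: "x \<in> A'" and y: "y \<notin> A'" "y \<notin> C"
  show "{x, y} \<notin> E"
  proof
    assume xy: "{x, y} \<in> E"
    obtain vs where vs: "graph_path E vs" "hd vs \<in> A" "set vs \<inter> C = {}" "x = last vs"
      using x by (auto simp: A'_def)
    show False
    proof (cases "y \<in> set vs")
      case True
      then obtain ws zs where ws: "vs = (ws @ [y]) @ zs" by (auto simp: in_set_conv_decomp)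
      then have "graph_path E (ws @ [y])"
        using vs(1) unfolding graph_path_def by (simp add: successively_append_iff)
      moreover have "hd (ws @ [y]) \<in> A" using vs(2) ws by (cases ws) auto
      moreover have "set (ws @ [y]) \<inter> C = {}" using vs(3) ws by auto
      ultimately have "y \<in> A'" unfolding A'_def by (intro CollectI exI[of _ "ws @ [y]"]) auto
      then show False using y by blast
    next
      case False
      have "graph_path E (vs @ [y])"
        using vs(1,4) xy False unfolding graph_path_def by (auto simp: successively_append_iff)
      moreover have "hd (vs @ [y]) \<in> A" using vs(1,2) by (auto simp: graph_path_def)
      moreover have "set (vs @ [y]) \<inter> C = {}" using vs(3) y(2) by auto
      ultimately have "y \<in> A'" unfolding A'_def by (intro CollectI exI[of _ "vs @ [y]"]) auto
      then show False using y by blast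
    qed
  qed
qed

text \<open>No clique meets both \<open>A'\<close> and the complement of \<open>A' \<union> C\<close>. Hence exchanging the parts outside
  \<open>A'\<close> of two profiles that agree on \<open>C\<close> preserves the product of their coordinates, and it turns the
  terms of one product of marginals into those of the other.\<close>

lemma clique_product_satisfies_ci:
  assumes "s \<in> global_markov E"
  shows "satisfies_ci (clique_product E \<phi>) s"
proof -
  obtain A B C where s: "s = (A, B, C)" by (cases s)
  have disj: "A \<inter> B = {}" "A \<inter> C = {}" "B \<inter> C = {}" and sep: "separates E C A B"
    using assms by (auto simp: s global_markov_def)
  obtain A' where A': "A \<subseteq> A'" "A' \<inter> B = {}" "A' \<inter> C = {}"
    "\<And>x y. x \<in> A' \<Longrightarrow> y \<notin> A' \<Longrightarrow> y \<notin> C \<Longrightarrow> {x, y} \<notin> E"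
    by (rule separated_extension[OF sep disj(2)]) (rule that)
  let ?p = "clique_product E \<phi>"
  define S where "S a b c = {j. (\<forall>v\<in>A. j v = a v) \<and> (\<forall>v\<in>B. j v = b v) \<and> (\<forall>v\<in>C. j v = c v)}"
    for a b c :: "'a profile"
  define sw where "sw jj = ((\<lambda>v. if v \<in> A' then fst jj v else snd jj v), (\<lambda>v. if v \<in> A' then snd jj v else fst jj v))"
    for jj :: "'a profile \<times> 'a profile"
  have swap: "?p $ fst (sw jj) * ?p $ snd (sw jj) = ?p $ fst jj * ?p $ snd jj"
    if agree: "\<And>v. v \<in> C \<Longrightarrow> fst jj v = snd jj v" for jj
    unfolding clique_product_if prod.distrib[symmetric]
  proof (rule prod.cong)
    fix K assume K: "K \<in> cliques E"
    show "(if K \<subseteq> supp (fst (sw jj)) then \<phi> $ K else 1) * (if K \<subseteq> supp (snd (sw jj)) then \<phi> $ K else 1) =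
        (if K \<subseteq> supp (fst jj) then \<phi> $ K else 1) * (if K \<subseteq> supp (snd jj) then \<phi> $ K else 1)"
    proof (cases "K \<inter> A' = {}")
      case True
      then have "K \<subseteq> supp (fst (sw jj)) \<longleftrightarrow> K \<subseteq> supp (snd jj)"
        "K \<subseteq> supp (snd (sw jj)) \<longleftrightarrow> K \<subseteq> supp (fst jj)"
        by (auto simp: supp_def sw_def subset_iff disjoint_iff)
      then show ?thesis by simp
    next
      case False
      then obtain x where x: "x \<in> K" "x \<in> A'" by blast
      have "fst (sw jj) v = fst jj v" "snd (sw jj) v = snd jj v" if "v \<in> K" for v
      proof -
        have "v \<in> A' \<or> v \<in> C"
        proof (rule ccontr)
          assume *: "\<not> (v \<in> A' \<or> v \<in> C)"
          then have "x \<noteq> v" using x(2) by auto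
          then have "{x, v} \<in> E" using K x(1) that by (simp add: cliques_def)
          then show False using A'(4)[OF x(2), of v] * by simp
        qed
        then show "fst (sw jj) v = fst jj v" "snd (sw jj) v = snd jj v"
          using agree[of v] by (auto simp: sw_def)
      qed
      then have "K \<subseteq> supp (fst (sw jj)) \<longleftrightarrow> K \<subseteq> supp (fst jj)"
        "K \<subseteq> supp (snd (sw jj)) \<longleftrightarrow> K \<subseteq> supp (snd jj)"
        by (auto simp: supp_def subset_iff)
      then show ?thesis by simp
    qed
  qed simp
  have "marginal ?p A a B b C c * marginal ?p A a' B b' C c =
      marginal ?p A a B b' C c * marginal ?p A a' B b C c" for a a' b b' c
  proof -
    have prod: "marginal ?p A a B b C c * marginal ?p A a' B b' C c =
        (\<Sum>jj\<in>S a b c \<times> S a' b' c. ?p $ fst jj * ?p $ snd jj)" for a a' b b'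
      unfolding marginal_def S_def sum_product by (simp add: sum.cartesian_product case_prod_unfold)
    have mem: "sw jj \<in> S a b' c \<times> S a' b c" if "jj \<in> S a b c \<times> S a' b' c" for jj a b a' b'
      using that A'(1-3) by (auto simp: S_def sw_def disjoint_iff)
    have inv: "sw (sw jj) = jj" for jj by (auto simp: sw_def fun_eq_iff prod_eq_iff)
    show ?thesis
      unfolding prod
    proof (rule sum.reindex_bij_witness[of _ sw sw])
      fix jj assume jj: "jj \<in> S a b c \<times> S a' b' c"
      show "sw (sw jj) = jj" by (rule inv)
      show "sw jj \<in> S a b' c \<times> S a' b c" by (rule mem[OF jj])
      have "fst jj v = snd jj v" if "v \<in> C" for v using jj that by (auto simp: S_def)
      then show "?p $ fst (sw jj) * ?p $ snd (sw jj) = ?p $ fst jj * ?p $ snd jj" by (rule swap)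
    next
      fix jj assume jj: "jj \<in> S a b' c \<times> S a' b c"
      show "sw (sw jj) = jj" by (rule inv)
      show "sw jj \<in> S a b c \<times> S a' b' c" by (rule mem[OF jj])
    qed
  qed
  then show ?thesis by (simp add: satisfies_ci_def s)
qed

lemma pairwise_markov:
  assumes "u \<noteq> v" "{u, v} \<notin> E"
  shows "({u}, {v}, UNIV - {u, v}) \<in> global_markov E"
proof -
  have "set vs \<inter> (UNIV - {u, v}) \<noteq> {}" if vs: "graph_path E vs" "hd vs = u" "last vs = v" for vs
  proof
    assume "set vs \<inter> (UNIV - {u, v}) = {}"
    then have sub: "set vs \<subseteq> {u, v}" by auto
    obtain x xs where x: "vs = x # xs" using vs(1) by (cases vs) (auto simp: graph_path_def)
    then obtain y ys where y: "xs = y # ys" using vs assms(1) by (cases xs) auto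
    have "x = u" "y = v" using x y vs sub by (auto simp: graph_path_def)
    then show False using vs(1) x y assms(2) by (auto simp: graph_path_def)
  qed
  then show ?thesis using assms(1) by (auto simp: global_markov_def separates_def)
qed

lemma satisfies_ciD:
  assumes "satisfies_ci p (A, B, C)" "a \<in> A \<rightarrow>\<^sub>E UNIV" "a' \<in> A \<rightarrow>\<^sub>E UNIV"
    "b \<in> B \<rightarrow>\<^sub>E UNIV" "b' \<in> B \<rightarrow>\<^sub>E UNIV" "c \<in> C \<rightarrow>\<^sub>E UNIV"
  shows "marginal p A a B b C c * marginal p A a' B b' C c -
    marginal p A a B b' C c * marginal p A a' B b C c = 0"
  using assms unfolding satisfies_ci_def prod.case by blast

text \<open>The global statement for two nonadjacent players given all others involves no summation.\<close>

lemma pairwise_relation: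
  fixes p :: "complex ^ 'n::finite profile"
  assumes ci: "\<forall>s\<in>global_markov E. satisfies_ci p s"
    and uv: "u \<noteq> v" "{u, v} \<notin> E" "u \<in> S" "v \<in> S"
  shows "p $ prof S * p $ prof (S - {u, v}) = p $ prof (S - {v}) * p $ prof (S - {u})"
proof -
  let ?C = "UNIV - {u, v}"
  define f where "f A x = restrict (\<lambda>_. x) A" for A :: "'n set" and x :: 2
  define c where "c = restrict (prof S) ?C"
  have eq: "marginal p {u} (f {u} x) {v} (f {v} y) ?C c =
      p $ prof (S - (if x = 2 then {} else {u}) - (if y = 2 then {} else {v}))"
    if "x = 1 \<or> x = 2" "y = 1 \<or> y = 2" for x y
  proof -
    let ?P = "prof (S - (if x = 2 then {} else {u}) - (if y = 2 then {} else {v}))"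
    have P: "?P u = x" "?P v = y" "\<And>w. w \<in> ?C \<Longrightarrow> ?P w = prof S w"
      using uv that by (auto simp: prof_def)
    have iff: "((\<forall>w\<in>{u}. j w = f {u} x w) \<and> (\<forall>w\<in>{v}. j w = f {v} y w) \<and> (\<forall>w\<in>?C. j w = c w)) \<longleftrightarrow> j = ?P" for j
    proof
      assume *: "(\<forall>w\<in>{u}. j w = f {u} x w) \<and> (\<forall>w\<in>{v}. j w = f {v} y w) \<and> (\<forall>w\<in>?C. j w = c w)"
      show "j = ?P"
      proof
        fix w
        consider "w = u" | "w = v" | "w \<in> ?C" by blast
        then show "j w = ?P w"
        proof cases
          case 1
          then show ?thesis using * P(1) by (simp add: f_def)
        next
          case 2
          then show ?thesis using * P(2) by (simp add: f_def)
        next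
          case 3
          then show ?thesis using * P(3)[of w] by (simp add: c_def)
        qed
      qed
    next
      assume "j = ?P"
      then show "(\<forall>w\<in>{u}. j w = f {u} x w) \<and> (\<forall>w\<in>{v}. j w = f {v} y w) \<and> (\<forall>w\<in>?C. j w = c w)"
        using P unfolding f_def c_def by simp
    qed
    have "{j. (\<forall>w\<in>{u}. j w = f {u} x w) \<and> (\<forall>w\<in>{v}. j w = f {v} y w) \<and> (\<forall>w\<in>?C. j w = c w)} = {?P}"
      unfolding iff by (rule singleton_conv)
    then show ?thesis by (simp add: marginal_def)
  qed
  have fm: "f {w} x \<in> {w} \<rightarrow>\<^sub>E UNIV" and cm: "c \<in> ?C \<rightarrow>\<^sub>E UNIV" for w x
    by (auto simp: f_def c_def)
  have "marginal p {u} (f {u} 2) {v} (f {v} 2) ?C c * marginal p {u} (f {u} 1) {v} (f {v} 1) ?C c -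
      marginal p {u} (f {u} 2) {v} (f {v} 1) ?C c * marginal p {u} (f {u} 1) {v} (f {v} 2) ?C c = 0"
    by (rule satisfies_ciD[OF bspec[OF ci pairwise_markov[OF uv(1,2)]] fm fm fm fm cm])
  moreover have "S - {u} - {v} = S - {u, v}" by blast
  ultimately show ?thesis by (simp add: eq)
qed

text \<open>Choose the potentials by size of the clique so that the coordinates at cliques agree. At any other set
  the pairwise relation of two nonadjacent members determines the coordinate from smaller sets, and it
  holds on both sides. Only nonzero coordinates are divided by, so the argument is valid over the complex
  numbers.\<close>

theorem Hammersley_Clifford:
  fixes p :: "complex ^ 'n::finite profile"
  assumes ci: "\<forall>s\<in>global_markov E. satisfies_ci p s"
    and nz: "\<And>j. p $ j \<noteq> 0" and p0: "p $ prof {} = 1"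
  obtains \<phi> where "\<And>K. \<phi> $ K \<noteq> 0" "p = clique_product E \<phi>"
proof -
  have "\<exists>\<phi> :: complex ^ 'n set. (\<forall>K. \<phi> $ K \<noteq> 0) \<and>
      (\<forall>K\<in>cliques E. card K \<le> m \<longrightarrow> clique_product E \<phi> $ prof K = p $ prof K)" for m
  proof (induction m)
    case 0
    then show ?case by (intro exI[of _ "\<chi> K. 1"]) (auto simp: cliques_def)
  next
    case (Suc m)
    then obtain \<phi> :: "complex ^ 'n set" where \<phi>: "\<And>K. \<phi> $ K \<noteq> 0"
      "\<And>K. K \<in> cliques E \<Longrightarrow> card K \<le> m \<Longrightarrow> clique_product E \<phi> $ prof K = p $ prof K" by blast
    define \<psi> where "\<psi> = (\<chi> K. if card K = Suc m then p $ prof K / (\<Prod>L\<in>{L \<in> cliques E. L \<subset> K}. \<phi> $ L)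
      else \<phi> $ K)"
    have \<psi>_nz: "\<psi> $ K \<noteq> 0" for K using \<phi>(1) nz by (simp add: \<psi>_def)
    have lower: "\<psi> $ L = \<phi> $ L" if "card L \<le> m" for L using that by (simp add: \<psi>_def)
    have "clique_product E \<psi> $ prof K = p $ prof K" if K: "K \<in> cliques E" "card K \<le> Suc m" for K
    proof (cases "card K \<le> m")
      case True
      have "clique_product E \<psi> $ prof K = clique_product E \<phi> $ prof K"
        unfolding clique_product_prof using True
        by (intro prod.cong lower) (auto intro: le_trans[OF card_mono])
      then show ?thesis using \<phi>(2) K True by simp
    next
      case False
      then have card: "card K = Suc m" using K by simp
      have "{L \<in> cliques E. L \<subseteq> K} = insert K {L \<in> cliques E. L \<subset> K}" using K by auto
      then have "clique_product E \<psi> $ prof K = \<psi> $ K * (\<Prod>L\<in>{L \<in> cliques E. L \<subset> K}. \<psi> $ L)"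
        by (simp add: clique_product_prof)
      also have "(\<Prod>L\<in>{L \<in> cliques E. L \<subset> K}. \<psi> $ L) = (\<Prod>L\<in>{L \<in> cliques E. L \<subset> K}. \<phi> $ L)"
      proof (intro prod.cong lower refl)
        fix L assume "L \<in> {L \<in> cliques E. L \<subset> K}"
        then have "card L < card K" by (intro psubset_card_mono) auto
        then show "card L \<le> m" using card by simp
      qed
      finally show ?thesis using \<phi>(1) card by (simp add: \<psi>_def)
    qed
    with \<psi>_nz show ?case by blast
  qed
  from this[of "CARD('n)"] obtain \<phi> :: "complex ^ 'n set" where \<phi>: "\<And>K. \<phi> $ K \<noteq> 0"
    "\<And>K. K \<in> cliques E \<Longrightarrow> clique_product E \<phi> $ prof K = p $ prof K"
    using card_mono[OF finite[of UNIV] subset_UNIV] by blast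
  let ?q = "clique_product E \<phi>"
  have ciq: "\<forall>s\<in>global_markov E. satisfies_ci ?q s" using clique_product_satisfies_ci by blast
  have "?q $ prof S = p $ prof S" for S
  proof (induction "card S" arbitrary: S rule: less_induct)
    case less
    show ?case
    proof (cases "S = {} \<or> S \<in> cliques E")
      case True
      then show ?thesis using \<phi>(2) p0 by auto
    next
      case False
      then obtain u v where uv: "u \<noteq> v" "{u, v} \<notin> E" "u \<in> S" "v \<in> S" by (auto simp: cliques_def)
      have IH: "?q $ prof (S - T) = p $ prof (S - T)" if "T \<subseteq> {u, v}" "T \<noteq> {}" for T
        using that uv by (intro less psubset_card_mono) auto
      have "?q $ prof S * p $ prof (S - {u, v}) = p $ prof (S - {v}) * p $ prof (S - {u})"
        using pairwise_relation[OF ciq uv] by (simp add: IH)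
      also have "\<dots> = p $ prof S * p $ prof (S - {u, v})"
        using pairwise_relation[OF ci uv] by simp
      finally show ?thesis using nz by simp
    qed
  qed
  then have "p = ?q" unfolding vec_eq_iff by (metis prof_supp)
  with \<phi>(1) show ?thesis using that by blast
qed

text \<open>Representatives of the points of the model off the special hyperplanes, see
  \<open>ci_model_minus_special\<close>.\<close>

definition torus_points :: "'n::finite set set \<Rightarrow> (complex ^ 'n profile) set" where
  "torus_points E = {clique_product E \<phi> | \<phi>. (\<forall>K. \<phi> $ K \<noteq> 0) \<and> (\<Sum>j\<in>UNIV. clique_product E \<phi> $ j) \<noteq> 0}"

lemma satisfies_ci_scale:
  assumes "satisfies_ci p s"
  shows "satisfies_ci (c *s p) s"
proof -
  obtain A B C where s: "s = (A, B, C)" by (cases s)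
  have "marginal (c *s p) A a B b C d = c * marginal p A a B b C d" for a b d
    by (simp add: marginal_def sum_distrib_left)
  then have "marginal (c *s p) A a B b C d * marginal (c *s p) A a' B b' C d -
      marginal (c *s p) A a B b' C d * marginal (c *s p) A a' B b C d =
      c\<^sup>2 * (marginal p A a B b C d * marginal p A a' B b' C d -
      marginal p A a B b' C d * marginal p A a' B b C d)" for a b a' b' d
    by (simp add: power2_eq_square algebra_simps)
  note eq = this
  show ?thesis
    using assms unfolding s satisfies_ci_def prod.case eq by simp
qed

lemma special_hyperplanes_iff:
  assumes "p \<noteq> 0"
  shows "proj_point p \<in> special_hyperplanes \<longleftrightarrow> (\<exists>j. p $ j = 0) \<or> (\<Sum>j\<in>UNIV. p $ j) = 0"
proof
  assume "proj_point p \<in> special_hyperplanes"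
  then obtain q where q: "proj_point p = proj_point q" "(\<exists>j. q $ j = 0) \<or> (\<Sum>j\<in>UNIV. q $ j) = 0"
    by (auto simp: special_hyperplanes_def proj_locus_def)
  then obtain c where "p = c *s q" using proj_point_eqD by metis
  then show "(\<exists>j. p $ j = 0) \<or> (\<Sum>j\<in>UNIV. p $ j) = 0"
    using q(2) by (auto simp flip: sum_distrib_left)
qed (use assms in \<open>auto simp: special_hyperplanes_def proj_locus_def\<close>)

lemma closedin_special_hyperplanes:
  "closedin zariski (special_hyperplanes :: (complex ^ 'n::finite profile) set set)"
proof -
  have "homfun ((\<Sum>j\<in>(UNIV :: 'n profile set). 1) + 1)
      (\<lambda>p :: complex ^ 'n profile. (\<Prod>j\<in>UNIV. p $ j) * (\<Sum>j\<in>UNIV. p $ j))"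
    by (intro homfun_mult homfun_prod homfun_sum homfun_nth) simp
  from closedin_homfun[OF this] show ?thesis
    by (simp add: special_hyperplanes_def)
qed

lemma ci_locus_minus_special:
  "proj_locus (\<lambda>p. \<forall>s\<in>global_markov E. satisfies_ci p s) - special_hyperplanes
    = proj_point ` torus_points E" (is "?L - _ = _")
proof
  show "?L - special_hyperplanes \<subseteq> proj_point ` torus_points E"
  proof
    fix x assume x: "x \<in> ?L - special_hyperplanes"
    then obtain p where p: "x = proj_point p" "p \<noteq> 0" "\<forall>s\<in>global_markov E. satisfies_ci p s"
      by (auto simp: proj_locus_def)
    then have nz: "p $ j \<noteq> 0" "(\<Sum>j\<in>UNIV. p $ j) \<noteq> 0" for j
      using x special_hyperplanes_iff[OF p(2)] by auto
    define q where "q = (1 / p $ prof {}) *s p"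
    have q: "q $ j \<noteq> 0" "q $ prof {} = 1" "(\<Sum>j\<in>UNIV. q $ j) \<noteq> 0" for j
      using nz by (simp_all add: q_def flip: sum_divide_distrib)
    have ci: "\<forall>s\<in>global_markov E. satisfies_ci q s"
      using p(3) satisfies_ci_scale unfolding q_def by blast
    obtain \<phi> where "\<And>K. \<phi> $ K \<noteq> 0" "q = clique_product E \<phi>"
      by (rule Hammersley_Clifford[OF ci q(1,2)]) (rule that)
    then have "q \<in> torus_points E" using q(3) by (auto simp: torus_points_def)
    moreover have "x = proj_point q"
      unfolding p(1) q_def using nz by (simp add: proj_point_scale)
    ultimately show "x \<in> proj_point ` torus_points E" by blast
  qed
  show "proj_point ` torus_points E \<subseteq> ?L - special_hyperplanes"
  proof
    fix x assume "x \<in> proj_point ` torus_points E"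
    then obtain \<phi> where \<phi>: "x = proj_point (clique_product E \<phi>)" "\<And>K. \<phi> $ K \<noteq> 0"
      "(\<Sum>j\<in>UNIV. clique_product E \<phi> $ j) \<noteq> 0" by (auto simp: torus_points_def)
    have "x \<in> ?L"
      unfolding proj_locus_def \<phi>(1)
      by (intro CollectI exI[of _ "clique_product E \<phi>"]) (simp add: clique_product_satisfies_ci)
    moreover have "x \<notin> special_hyperplanes"
      unfolding \<phi>(1) using special_hyperplanes_iff[of "clique_product E \<phi>"] \<phi>(2,3)
      by (simp add: clique_product_nonzero)
    ultimately show "x \<in> ?L - special_hyperplanes" by blast
  qed
qed

lemma irreducible_in_torus: "irreducible_in zariski (proj_point ` torus_points (E :: 'n::finite set set))"
  unfolding irreducible_in_def
proof (intro conjI allI impI)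
  have nz: "a \<noteq> 0" if "a \<in> torus_points E" for a using that by (auto simp: torus_points_def)
  show "proj_point ` torus_points E \<subseteq> topspace zariski"
    using nz unfolding subset_iff topspace_zariski_iff by blast
  have one: "clique_product E (\<chi> K. 1) $ j = 1" for j by (simp add: clique_product_def)
  show "proj_point ` torus_points E \<noteq> {}"
    unfolding torus_points_def using one
    by (auto intro!: exI[of _ "\<chi> K. 1"])
  fix B C assume BC: "closedin zariski B \<and> closedin zariski C \<and> proj_point ` torus_points E \<subseteq> B \<union> C"
  show "proj_point ` torus_points E \<subseteq> B \<or> proj_point ` torus_points E \<subseteq> C"
  proof (rule ccontr)
    assume "\<not> ?thesis"
    then obtain a b where ab: "a \<in> torus_points E" "proj_point a \<notin> B"
      "b \<in> torus_points E" "proj_point b \<notin> C" by blast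
    obtain d f where f: "homfun d f" "f a \<noteq> 0" "\<forall>q. q \<noteq> 0 \<longrightarrow> proj_point q \<in> B \<longrightarrow> f q = 0"
      using closedin_separation[of B a] BC nz ab by blast
    obtain e g where g: "homfun e g" "g b \<noteq> 0" "\<forall>q. q \<noteq> 0 \<longrightarrow> proj_point q \<in> C \<longrightarrow> g q = 0"
      using closedin_separation[of C b] BC nz ab by blast
    define h where "h \<phi> = (\<Prod>K\<in>UNIV. \<phi> $ K) * (\<Sum>j\<in>UNIV. clique_product E \<phi> $ j)" for \<phi>
    have pf: "polyfun (\<lambda>\<phi>. f (clique_product E \<phi>))" "polyfun (\<lambda>\<phi>. g (clique_product E \<phi>))" "polyfun h"
      unfolding h_def[abs_def]
      by (rule polyfun_compose[OF homfun_polyfun[OF f(1)] polyfun_clique_product],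
          rule polyfun_compose[OF homfun_polyfun[OF g(1)] polyfun_clique_product],
          intro fun_alg_intros polyfun_clique_product polyfun_nth)
    obtain \<alpha> where \<alpha>: "a = clique_product E \<alpha>" "h \<alpha> \<noteq> 0" using ab(1) by (auto simp: torus_points_def h_def)
    obtain \<beta> where \<beta>: "b = clique_product E \<beta>" "h \<beta> \<noteq> 0" using ab(3) by (auto simp: torus_points_def h_def)
    have "f (clique_product E \<phi>) * (g (clique_product E \<phi>) * h \<phi>) = 0" for \<phi>
    proof (cases "h \<phi> = 0")
      case False
      then have "proj_point (clique_product E \<phi>) \<in> B \<union> C"
        using BC by (auto simp: torus_points_def h_def)
      then show ?thesis using f(3) g(3) by auto
    qed simp
    then have "g (clique_product E \<phi>) * h \<phi> = 0" for \<phi>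
      using polyfun_mult_eq_0[OF pf(1) fun_alg.mult[OF pf(2,3)]] f(2) \<alpha>(1) by blast
    then show False using \<beta> g(2) by (metis mult_eq_0_iff)
  qed
qed

lemma homfun_marginal: "homfun 1 (\<lambda>p. marginal p A a B b C c)"
  unfolding marginal_def by (intro homfun_sum homfun_nth)

text \<open>A component that is not inside the special hyperplanes is covered by them and the closure of the torus,
  hence lies in that closure, which is itself irreducible.\<close>

theorem ci_model_eq:
  "ci_model (global_markov E) = zariski closure_of (proj_point ` torus_points (E :: 'n::finite set set))"
proof -
  let ?W = "special_hyperplanes :: (complex ^ 'n profile) set set"
  let ?L = "proj_locus (\<lambda>p :: complex ^ 'n profile. \<forall>s\<in>global_markov E. satisfies_ci p s)"
  let ?U = "proj_point ` torus_points E" and ?M = "zariski closure_of (proj_point ` torus_points E)"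
  have M_irr: "irreducible_in zariski ?M"
    using irreducible_in_closure irreducible_in_torus by blast
  have U_top: "?U \<subseteq> topspace zariski" "?U \<noteq> {}" using irreducible_in_torus[of E] unfolding irreducible_in_def by blast+
  then have U_M: "?U \<subseteq> ?M" by (intro closure_of_subset)
  have U_W: "?U \<inter> ?W = {}" using ci_locus_minus_special[of E] by blast
  have M_L: "?M \<subseteq> ?L"
  proof
    fix x assume x: "x \<in> ?M"
    then have "x \<in> topspace zariski" using M_irr by (auto simp: irreducible_in_def)
    then obtain q where q: "q \<noteq> 0" "x = proj_point q" unfolding topspace_zariski_iff by blast
    have "satisfies_ci q s" if s: "s \<in> global_markov E" for s
    proof -
      obtain A B C where abc: "s = (A, B, C)" by (cases s)
      have "marginal q A a B b C c * marginal q A a' B b' C c +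
          - 1 * (marginal q A a B b' C c * marginal q A a' B b C c) = 0"
        if "a \<in> A \<rightarrow>\<^sub>E UNIV" "a' \<in> A \<rightarrow>\<^sub>E UNIV" "b \<in> B \<rightarrow>\<^sub>E UNIV" "b' \<in> B \<rightarrow>\<^sub>E UNIV" "c \<in> C \<rightarrow>\<^sub>E UNIV"
        for a a' b b' c
      proof (rule homfun_zero_on_closure[where q = q and A = "torus_points E"])
        show "homfun (1 + 1) (\<lambda>q. marginal q A a B b C c * marginal q A a' B b' C c +
          - 1 * (marginal q A a B b' C c * marginal q A a' B b C c))"
          by (intro homfun_add homfun_cmult homfun_mult homfun_marginal)
        show "proj_point q \<in> ?M" using x q by simp
        fix p assume "p \<in> torus_points E"
        then have "satisfies_ci p s" using clique_product_satisfies_ci[OF s] by (auto simp: torus_points_def)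
        then show "marginal p A a B b C c * marginal p A a' B b' C c +
          - 1 * (marginal p A a B b' C c * marginal p A a' B b C c) = 0"
          using that by (simp add: satisfies_ci_def abc)
      qed (rule q)
      then show ?thesis by (simp add: satisfies_ci_def abc)
    qed
    then show "x \<in> ?L" using q by (auto simp: proj_locus_def)
  qed
  have sub_M: "Y \<subseteq> ?M" if Y: "Y \<subseteq> ?L" "irreducible_in zariski Y" "\<not> Y \<subseteq> ?W" for Y
  proof -
    have "Y \<subseteq> ?W \<union> ?M" using Y(1) ci_locus_minus_special[of E] U_M by blast
    then have "Y \<subseteq> ?W \<or> Y \<subseteq> ?M"
      using Y(2) closedin_special_hyperplanes closedin_closure_of[of zariski ?U]
      unfolding irreducible_in_def by blast
    then show ?thesis using Y(3) by blast
  qed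
  have "\<not> ?M \<subseteq> ?W" using U_M U_W U_top(2) by blast
  then have M_comp: "?M \<in> irreducible_components zariski ?L"
    using sub_M M_L M_irr unfolding irreducible_components_def by blast
  have "Z = ?M" if "Z \<in> irreducible_components zariski ?L" "\<not> Z \<subseteq> ?W" for Z
    using that sub_M[of Z] M_L M_irr unfolding irreducible_components_def by blast
  then have "{Z \<in> irreducible_components zariski ?L. \<not> Z \<subseteq> ?W} = {?M}"
    using M_comp \<open>\<not> ?M \<subseteq> ?W\<close> by blast
  then show ?thesis by (simp add: ci_model_def)
qed

lemma ci_model_minus_special:
  "ci_model (global_markov E) - special_hyperplanes = proj_point ` torus_points (E :: 'n::finite set set)"
proof
  let ?L = "proj_locus (\<lambda>p :: complex ^ 'n profile. \<forall>s\<in>global_markov E. satisfies_ci p s)"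
  have "ci_model (global_markov E) \<subseteq> ?L"
    by (auto simp: ci_model_def irreducible_components_def)
  then show "ci_model (global_markov E) - special_hyperplanes \<subseteq> proj_point ` torus_points E"
    using ci_locus_minus_special[of E] by blast
  have "proj_point ` torus_points E \<subseteq> ci_model (global_markov E)"
    unfolding ci_model_eq using irreducible_in_torus[of E]
    by (intro closure_of_subset) (auto simp: irreducible_in_def)
  then show "proj_point ` torus_points E \<subseteq> ci_model (global_markov E) - special_hyperplanes"
    using ci_locus_minus_special[of E] by blast
qed

section \<open>Games, equilibrium points and their incidence variety\<close>

text \<open>The potentials are quotients of forms of equal degree in the coordinates, by solving
  \<open>clique_product_prof\<close> for the potential of the largest clique.\<close>

lemma clique_coordinate:
  assumes "K \<in> cliques (E :: 'n::finite set set)"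
  shows "\<exists>d f g. homfun d f \<and> homfun d g \<and> (\<forall>\<phi>. (\<forall>L. \<phi> $ L \<noteq> 0) \<longrightarrow>
    g (clique_product E \<phi>) \<noteq> 0 \<and> f (clique_product E \<phi>) = \<phi> $ K * g (clique_product E \<phi>))"
  using assms
proof (induction "card K" arbitrary: K rule: less_induct)
  case less
  let ?L = "{L \<in> cliques E. L \<subset> K}"
  define P where "P L d f g \<longleftrightarrow> homfun d f \<and> homfun d g \<and> (\<forall>\<phi>. (\<forall>L. \<phi> $ L \<noteq> 0) \<longrightarrow>
    g (clique_product E \<phi>) \<noteq> 0 \<and> f (clique_product E \<phi>) = \<phi> $ L * g (clique_product E \<phi>))" for L d f g
  have "\<exists>d f g. P L d f g" if "L \<in> ?L" for L
    unfolding P_def using that less by (intro less(1)) (auto intro: psubset_card_mono)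
  then obtain d f g where *: "\<And>L. L \<in> ?L \<Longrightarrow> P L (d L) (f L) (g L)" by metis
  define F where "F p = p $ prof K * (\<Prod>L\<in>?L. g L p)" for p
  define H where "H p = p $ prof {} * (\<Prod>L\<in>?L. f L p)" for p
  have "homfun (1 + (\<Sum>L\<in>?L. d L)) F" "homfun (1 + (\<Sum>L\<in>?L. d L)) H"
    unfolding F_def[abs_def] H_def[abs_def] using *
    by (intro homfun_mult homfun_prod homfun_nth; simp add: P_def)+
  moreover have "H (clique_product E \<phi>) \<noteq> 0 \<and> F (clique_product E \<phi>) = \<phi> $ K * H (clique_product E \<phi>)"
    if nz: "\<forall>L. \<phi> $ L \<noteq> 0" for \<phi>
  proof -
    have fg: "g L (clique_product E \<phi>) \<noteq> 0" "f L (clique_product E \<phi>) = \<phi> $ L * g L (clique_product E \<phi>)"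
      if "L \<in> ?L" for L using *[OF that] nz unfolding P_def by blast+
    have "{L \<in> cliques E. L \<subseteq> K} = insert K ?L" using less.prems by auto
    then have pK: "clique_product E \<phi> $ prof K = \<phi> $ K * (\<Prod>L\<in>?L. \<phi> $ L)"
      by (simp add: clique_product_prof)
    have prod: "(\<Prod>L\<in>?L. f L (clique_product E \<phi>)) =
        (\<Prod>L\<in>?L. \<phi> $ L) * (\<Prod>L\<in>?L. g L (clique_product E \<phi>))"
      unfolding prod.distrib[symmetric] by (intro prod.cong refl fg) auto
    have "H (clique_product E \<phi>) \<noteq> 0"
      unfolding H_def prod using fg(1) nz by simp
    then show ?thesis unfolding F_def H_def pK prod by simp
  qed
  ultimately show ?case by blast
qed

lemma singleton_clique: "{i} \<in> cliques E"
  by (simp add: cliques_def)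

text \<open>The polynomial whose nonvanishing singles out the potentials that give \<open>torus_points\<close>.\<close>

lemma polyfun_potentials_total:
  "polyfun (\<lambda>\<phi>. (\<Prod>K\<in>UNIV. \<phi> $ K) * (\<Sum>j\<in>UNIV. clique_product E \<phi> $ j))"
  by (intro fun_alg_intros polyfun_nth polyfun_clique_product)

lemma fun_alg_clique_product:
  assumes "\<And>K. K \<in> cliques E \<Longrightarrow> (\<lambda>x. \<phi> x $ K) \<in> fun_alg B"
  shows "(\<lambda>x. clique_product E (\<phi> x) $ j) \<in> fun_alg B"
  unfolding clique_product_def by (simp, intro fun_alg_prod assms) simp

text \<open>Both bounds use that the torus is parametrised by the potentials: there are as many parameters as
  cliques, and the potentials are quotients of forms.\<close>

theorem proj_dim_ci_model:
  "proj_dim (ci_model (global_markov (E :: 'n::finite set set))) = ereal (real (card (cliques E)))"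
proof (rule antisym)
  let ?d = "card (cliques E)"
  show "proj_dim (ci_model (global_markov E)) \<le> ereal (real ?d)"
  proof (rule proj_dim_le[OF _ ci_model_eq])
    fix J :: "'n profile set" assume J: "card J = Suc ?d"
    let ?B = "(\<lambda>K (\<phi> :: complex ^ 'n set). \<phi> $ K) ` cliques E"
    have "card ?B < card J" using J card_image_le[of "cliques E" "\<lambda>K (\<phi> :: complex ^ 'n set). \<phi> $ K"] by simp
    moreover have "(\<lambda>\<phi>. clique_product E \<phi> $ j) \<in> fun_alg ?B" for j
      by (intro fun_alg_clique_product) (auto intro: fun_alg.gen)
    ultimately have "\<exists>D c. (\<exists>\<alpha>\<in>exponents J D. c \<alpha> \<noteq> 0) \<and>
        (\<forall>\<phi>. (\<Sum>\<alpha>\<in>exponents J D. c \<alpha> * (\<Prod>j\<in>J. clique_product E \<phi> $ j ^ \<alpha> j)) = 0)"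
      by (intro algebraic_relation) auto
    then obtain D c where c: "\<exists>\<alpha>\<in>exponents J D. c \<alpha> \<noteq> 0"
      "\<And>\<phi>. (\<Sum>\<alpha>\<in>exponents J D. c \<alpha> * (\<Prod>j\<in>J. clique_product E \<phi> $ j ^ \<alpha> j)) = 0"
      by blast
    then show "coordinates_dependent J (torus_points E)"
      unfolding coordinates_dependent_def torus_points_def by blast
  qed
  let ?h = "\<lambda>\<phi>. (\<Prod>K\<in>UNIV. \<phi> $ K) * (\<Sum>j\<in>UNIV. clique_product E \<phi> $ j)"
  define one :: "complex ^ 'n set" where "one = (\<chi> K. 1)"
  have "clique_product E one $ j = 1" for j by (simp add: clique_product_def one_def)
  then have one: "?h one \<noteq> 0" by (simp add: one_def)
  have "open {\<phi>. ?h \<phi> \<noteq> 0}"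
    by (intro open_Collect_neq polyfun_continuous polyfun_potentials_total continuous_on_const)
  then obtain \<epsilon> where \<epsilon>: "\<epsilon> > 0" "ball one \<epsilon> \<subseteq> {\<phi>. ?h \<phi> \<noteq> 0}"
    using one open_contains_ball by blast
  obtain ks where ks: "set ks = cliques E" "distinct ks"
    using finite_distinct_list[of "cliques E"] by auto
  have "ereal (real (length ks)) \<le> proj_dim (ci_model (global_markov E))"
  proof (rule proj_dim_ge[where V = "ball one \<epsilon>" and \<gamma> = "clique_product E" and ?y0.0 = one])
    show "open (ball one \<epsilon>)" "convex (ball one \<epsilon>)" "one \<in> ball one \<epsilon>" using \<epsilon>(1) by auto
    show "(\<lambda>z. clique_product E (a + z *s w) $ i) holomorphic_on {z. a + z *s w \<in> ball one \<epsilon>}" for a w i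
      by (rule polyfun_holomorphic[OF polyfun_clique_product]) (auto intro!: holomorphic_intros)
    show "closedin zariski (ci_model (global_markov E))" unfolding ci_model_eq by simp
    show "distinct ks" by fact
    show "clique_product E \<phi> \<noteq> 0 \<and> proj_point (clique_product E \<phi>) \<in> ci_model (global_markov E)"
      if "\<phi> \<in> ball one \<epsilon>" for \<phi>
    proof -
      have "clique_product E \<phi> \<in> torus_points E" using that \<epsilon>(2) by (auto simp: torus_points_def)
      then have "proj_point (clique_product E \<phi>) \<in> ci_model (global_markov E)"
        using ci_model_minus_special[of E] by blast
      then show ?thesis by simp
    qed
    show "\<exists>d f g. homfun d f \<and> homfun d g \<and> (\<forall>\<phi>\<in>ball one \<epsilon>. (\<forall>v. v \<notin> set ks \<longrightarrow> \<phi> $ v = one $ v) \<longrightarrow>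
        g (clique_product E \<phi>) \<noteq> 0 \<and> f (clique_product E \<phi>) = \<phi> $ K * g (clique_product E \<phi>))"
      if "K \<in> set ks" for K
    proof -
      have nz: "\<forall>L. \<phi> $ L \<noteq> 0" if "\<phi> \<in> ball one \<epsilon>" for \<phi> using that \<epsilon>(2) by auto
      have "K \<in> cliques E" using that ks(1) by simp
      from clique_coordinate[OF this] obtain d f g where fg: "homfun d f" "homfun d g"
        "\<And>\<phi>. \<forall>L. \<phi> $ L \<noteq> 0 \<Longrightarrow>
          g (clique_product E \<phi>) \<noteq> 0 \<and> f (clique_product E \<phi>) = \<phi> $ K * g (clique_product E \<phi>)" by auto
      show ?thesis
        by (intro exI[of _ d] exI[of _ f] exI[of _ g] conjI ballI impI fg(1,2))
          (use fg(3)[OF nz] in blast)+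
    qed
  qed
  then show "ereal (real ?d) \<le> proj_dim (ci_model (global_markov E))"
    using ks distinct_card[of ks] by simp
qed

lemma derangement_exists:
  assumes "CARD('n::finite) \<ge> 2"
  obtains \<sigma> :: "'n::finite \<Rightarrow> 'n" where "surj \<sigma>" "\<And>i. \<sigma> i \<noteq> i"
proof -
  let ?n = "CARD('n)"
  obtain f :: "nat \<Rightarrow> 'n" where f: "bij_betw f {0..<?n} UNIV"
    using ex_bij_betw_nat_finite[of "UNIV :: 'n set"] by auto
  define g where "g = inv_into {0..<?n} f"
  have fg: "f (g x) = x" "g x < ?n" for x
    using f bij_betw_inv_into_right[OF f, of x] bij_betw_inv_into[OF f]
    by (auto simp: g_def bij_betw_def)
  have gf: "g (f k) = k" if "k < ?n" for k
    using bij_betw_inv_into_left[OF f, of k] that by (simp add: g_def)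
  (* A cyclic shift of all players. *)
  define \<sigma> where "\<sigma> x = f ((g x + 1) mod ?n)" for x
  have "\<sigma> x \<noteq> x" for x
  proof
    assume "\<sigma> x = x"
    then have "g x = (g x + 1) mod ?n" using gf[of "(g x + 1) mod ?n"] by (simp add: \<sigma>_def)
    then show False using fg(2)[of x] assms by (cases "g x + 1 = ?n") auto
  qed
  moreover have "\<exists>x. \<sigma> x = y" for y
  proof (cases "g y = 0")
    case True
    have "\<sigma> (f (?n - 1)) = f 0" using gf[of "?n - 1"] by (simp add: \<sigma>_def)
    also have "f 0 = y" using fg(1)[of y] True by simp
    finally show ?thesis by blast
  next
    case False
    then have "\<sigma> (f (g y - 1)) = f (g y)" using gf[of "g y - 1"] fg(2)[of y] by (simp add: \<sigma>_def)
    then show ?thesis using fg(1) by auto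
  qed
  moreover from this have "surj \<sigma>" unfolding surj_def by metis
  ultimately show ?thesis using that[of \<sigma>] by blast
qed

text \<open>Indices for both sides of the parametrised incidence variety: \<open>Inl K\<close> for potentials and
  \<open>Inr (i, j)\<close> for payoffs.\<close>

type_synonym 'n incidence_index = "'n set + 'n \<times> 'n profile"

definition potentials :: "complex ^ 'n incidence_index \<Rightarrow> complex ^ 'n::finite set" where
  "potentials z = (\<chi> K. z $ Inl K)"

text \<open>The coordinate at \<open>j\<close> divided by the coordinate at \<open>prof {i}\<close>, if player \<open>i\<close> chooses \<open>2\<close> in \<open>j\<close>. It
  is a polynomial in the potentials.\<close>

definition clique_ratio :: "'n::finite set set \<Rightarrow> complex ^ 'n set \<Rightarrow> 'n \<Rightarrow> 'n profile \<Rightarrow> complex" where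
  "clique_ratio E \<phi> i j = (\<Prod>K\<in>{K \<in> cliques E. K \<subseteq> supp j \<and> K \<noteq> {i}}. \<phi> $ K)"

text \<open>The payoff for which the equation \<open>(\<Sum>l | l i = k. (X (i, l) - \<lambda>\<^sub>i) * p l) = 0\<close> has been solved is the
  one at \<open>prof {}\<close> for \<open>k = 1\<close> and the one at \<open>prof {i}\<close> for \<open>k = 2\<close>; in the second case the
  equation is divided by the coordinate at \<open>prof {i}\<close>. The multiplier \<open>\<lambda>\<^sub>i\<close> is stored at
  \<open>Inr (i, prof {})\<close>.\<close>

definition incidence_payoff :: "'n::finite set set \<Rightarrow> complex ^ 'n incidence_index \<Rightarrow> 'n \<Rightarrow> 'n profile \<Rightarrow> complex" where
  "incidence_payoff E z i j =
    (if j = prof {} then z $ Inr (i, prof {}) - (\<Sum>l\<in>{l. l i = 1} - {prof {}}.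
        (z $ Inr (i, l) - z $ Inr (i, prof {})) * clique_product E (potentials z) $ l)
     else if j = prof {i} then z $ Inr (i, prof {}) - (\<Sum>l\<in>{l. l i = 2} - {prof {i}}.
        (z $ Inr (i, l) - z $ Inr (i, prof {})) * clique_ratio E (potentials z) i l)
     else z $ Inr (i, j))"

text \<open>Source and target are to have the same coordinates. In the source the slots \<open>Inr (i, prof {})\<close> hold the
  multipliers and the \<open>n\<close> slots \<open>Inr (i, prof {i})\<close> are free. In the target the potentials of single
  players must not be prescribed, so the \<open>n\<close> slots \<open>Inl {i}\<close> are free. The map copies the former to the
  latter.\<close>

definition incidence_map :: "'n::finite set set \<Rightarrow> complex ^ 'n incidence_index \<Rightarrow> complex ^ 'n incidence_index" where
  "incidence_map E z = (\<chi> v. case v of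
     Inl K \<Rightarrow> if \<exists>i. K = {i} then z $ Inr (the_elem K, prof K) else z $ Inl K
   | Inr (i, j) \<Rightarrow> incidence_payoff E z i j)"

lemma incidence_map_simps:
  "incidence_map E z $ Inr (i, j) = incidence_payoff E z i j"
  "incidence_map E z $ Inl {i} = z $ Inr (i, prof {i})"
  "(\<nexists>i. K = {i}) \<Longrightarrow> incidence_map E z $ Inl K = z $ Inl K"
  by (auto simp: incidence_map_def)

lemma prof_inject [simp]: "prof S = prof T \<longleftrightarrow> S = T"
  by (metis supp_prof)

lemma clique_product_ratio:
  assumes "j i = 2"
  shows "clique_product E \<phi> $ j = \<phi> $ {i} * clique_ratio E \<phi> i j"
proof -
  have "{K \<in> cliques E. K \<subseteq> supp j} = insert {i} {K \<in> cliques E. K \<subseteq> supp j \<and> K \<noteq> {i}}"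
    using assms singleton_clique[of i E] by (auto simp: supp_def)
  then show ?thesis by (simp add: clique_product_def clique_ratio_def)
qed

lemma clique_ratio_self [simp]: "clique_ratio E \<phi> i (prof {i}) = 1"
proof -
  have "{K \<in> cliques E. K \<subseteq> supp (prof {i}) \<and> K \<noteq> {i}} = {}"
    by (auto simp: cliques_def)
  then show ?thesis unfolding clique_ratio_def by (simp only: prod.empty)
qed

lemma incidence_payoff_indifference:
  fixes E :: "'n::finite set set" and z :: "complex ^ 'n incidence_index"
  defines "p \<equiv> clique_product E (potentials z)"
  shows "(\<Sum>j\<in>{j. j i = k}. (incidence_payoff E z i j - z $ Inr (i, prof {})) * p $ j) = 0"
proof -
  let ?m = "z $ Inr (i, prof {})"
  have k: "k = 1 \<or> k = 2" by (rule exhaust_2)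
  have prof: "prof {} i = 1" "prof {i} i = 2" by (simp_all add: prof_def)
  have neq: "l i = 1 \<Longrightarrow> l \<noteq> prof {i}" "l i = 2 \<Longrightarrow> l \<noteq> prof {}" for l
    using prof by auto
  from k show ?thesis
  proof
    assume k: "k = 1"
    have "(\<Sum>j\<in>{j. j i = 1}. (incidence_payoff E z i j - ?m) * p $ j) =
      (incidence_payoff E z i (prof {}) - ?m) * p $ prof {} +
      (\<Sum>j\<in>{j. j i = 1} - {prof {}}. (incidence_payoff E z i j - ?m) * p $ j)"
      by (rule sum.remove) (auto simp: prof)
    also have "(\<Sum>j\<in>{j. j i = 1} - {prof {}}. (incidence_payoff E z i j - ?m) * p $ j) =
      (\<Sum>j\<in>{j. j i = 1} - {prof {}}. (z $ Inr (i, j) - ?m) * p $ j)"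
      by (intro sum.cong) (auto simp: incidence_payoff_def neq)
    finally show ?thesis unfolding k by (simp add: p_def incidence_payoff_def)
  next
    assume k: "k = 2"
    have "(\<Sum>j\<in>{j. j i = 2}. (incidence_payoff E z i j - ?m) * clique_ratio E (potentials z) i j) =
      (incidence_payoff E z i (prof {i}) - ?m) * clique_ratio E (potentials z) i (prof {i}) +
      (\<Sum>j\<in>{j. j i = 2} - {prof {i}}. (incidence_payoff E z i j - ?m) * clique_ratio E (potentials z) i j)"
      by (rule sum.remove) (auto simp: prof)
    also have "(\<Sum>j\<in>{j. j i = 2} - {prof {i}}. (incidence_payoff E z i j - ?m) * clique_ratio E (potentials z) i j) =
      (\<Sum>j\<in>{j. j i = 2} - {prof {i}}. (z $ Inr (i, j) - ?m) * clique_ratio E (potentials z) i j)"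
      by (intro sum.cong) (auto simp: incidence_payoff_def neq)
    finally have *: "(\<Sum>j\<in>{j. j i = 2}. (incidence_payoff E z i j - ?m) * clique_ratio E (potentials z) i j) = 0"
      by (simp add: incidence_payoff_def)
    have "(\<Sum>j\<in>{j. j i = 2}. (incidence_payoff E z i j - ?m) * p $ j) =
      potentials z $ {i} * (\<Sum>j\<in>{j. j i = 2}. (incidence_payoff E z i j - ?m) * clique_ratio E (potentials z) i j)"
      unfolding sum_distrib_left p_def by (intro sum.cong) (auto simp: clique_product_ratio mult_ac)
    then show ?thesis unfolding k * by simp
  qed
qed

lemma det_spohn_matrix:
  "det (spohn_matrix X i p) =
    (\<Sum>j | j i = 1. p $ j) * (\<Sum>j | j i = 2. of_real (X $ (i, j)) * p $ j) -
    (\<Sum>j | j i = 1. of_real (X $ (i, j)) * p $ j) * (\<Sum>j | j i = 2. p $ j)"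
  by (simp add: det_2 spohn_matrix_def)

text \<open>Representatives of the points whose closure is the Spohn CI variety, see \<open>spohn_ci_variety_eq\<close>.\<close>

definition equilibrium_points :: "'n::finite set set \<Rightarrow> 'n game \<Rightarrow> (complex ^ 'n profile) set" where
  "equilibrium_points E X = {p \<in> torus_points E. \<forall>i. det (spohn_matrix X i p) = 0}"

lemma det_spohn_matrix_incidence:
  assumes "\<And>j. incidence_payoff E z i j = of_real (X $ (i, j))"
  shows "det (spohn_matrix X i (clique_product E (potentials z))) = 0"
proof -
  let ?p = "clique_product E (potentials z)" and ?m = "z $ Inr (i, prof {})"
  have "(\<Sum>j | j i = k. of_real (X $ (i, j)) * ?p $ j) = ?m * (\<Sum>j | j i = k. ?p $ j)" for k
    using incidence_payoff_indifference[where E = E and z = z and i = i and k = k] unfolding assms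
    by (simp add: algebra_simps sum_subtractf sum_distrib_left)
  then show ?thesis unfolding det_spohn_matrix by simp
qed

lemma sum_two_choices: "(\<Sum>j\<in>UNIV. f j) = (\<Sum>j | j i = 1. f j) + (\<Sum>j | j i = 2. f j)"
  for f :: "'n::finite profile \<Rightarrow> complex" 
proof -
  have "(UNIV :: 'n profile set) = {j. j i = 1} \<union> {j. j i = 2}" using exhaust_2 by auto
  then show ?thesis by (subst \<open>UNIV = _\<close>, subst sum.union_disjoint) auto
qed

text \<open>The total sum of \<open>p\<close> is nonzero, so the vanishing determinant makes the vector of payoff sums a
  multiple \<open>l i\<close> of the vector of probabilities.\<close>

lemma equilibrium_points_incidence:
  assumes "p \<in> equilibrium_points E X"
  obtains z where "p = clique_product E (potentials z)"
    "\<And>i j. incidence_payoff E z i j = of_real (X $ (i, j))"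
proof -
  obtain \<phi> where \<phi>: "p = clique_product E \<phi>" "\<And>K. \<phi> $ K \<noteq> 0" "(\<Sum>j\<in>UNIV. p $ j) \<noteq> 0"
    using assms by (auto simp: equilibrium_points_def torus_points_def)
  define u where "u i k = (\<Sum>j | j i = k. p $ j)" for i k
  define w where "w i k = (\<Sum>j | j i = k. of_real (X $ (i, j)) * p $ j)" for i k
  define l where "l i = (w i 1 + w i 2) / (u i 1 + u i 2)" for i
  have wl: "w i k = l i * u i k" for i k
  proof -
    have nz: "u i 1 + u i 2 \<noteq> 0" using \<phi>(3) sum_two_choices[of "\<lambda>j. p $ j" i] by (simp add: u_def)
    have "u i 1 * w i 2 - w i 1 * u i 2 = 0"
      using assms unfolding equilibrium_points_def u_def w_def by (auto simp: det_spohn_matrix)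
    then have "w i k * (u i 1 + u i 2) = (w i 1 + w i 2) * u i k"
      using exhaust_2[of k] by (auto simp: algebra_simps)
    then show ?thesis using nz by (simp add: l_def field_simps)
  qed
  define z where "z = (\<chi> v. case v of Inl K \<Rightarrow> \<phi> $ K
    | Inr (i, j) \<Rightarrow> if j = prof {} then l i else of_real (X $ (i, j)))"
  have pot: "potentials z = \<phi>" by (simp add: potentials_def z_def vec_eq_iff)
  have zl: "z $ Inr (i, prof {}) = l i" for i by (simp add: z_def)
  have zX: "z $ Inr (i, j) = of_real (X $ (i, j))" if "j \<noteq> prof {}" for i j using that by (simp add: z_def)
  have prof: "prof {} i = 1" "prof {i} i = 2" for i :: 'a by (simp_all add: prof_def)
  have zero: "(\<Sum>j | j i = k. (of_real (X $ (i, j)) - l i) * p $ j) = 0" for i k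
    using wl[of i k] unfolding u_def w_def by (simp add: algebra_simps sum_subtractf sum_distrib_left)
  have "incidence_payoff E z i j = of_real (X $ (i, j))" for i j
  proof -
    consider "j = prof {}" | "j = prof {i}" | "j \<noteq> prof {}" "j \<noteq> prof {i}" by blast
    then show ?thesis
    proof cases
      case 1
      have "0 = (of_real (X $ (i, prof {})) - l i) * p $ prof {} +
          (\<Sum>j\<in>{j. j i = 1} - {prof {}}. (of_real (X $ (i, j)) - l i) * p $ j)"
        unfolding zero[of i 1, symmetric] by (rule sum.remove) (auto simp: prof)
      also have "(\<Sum>j\<in>{j. j i = 1} - {prof {}}. (of_real (X $ (i, j)) - l i) * p $ j) =
          (\<Sum>j\<in>{j. j i = 1} - {prof {}}. (z $ Inr (i, j) - z $ Inr (i, prof {})) * p $ j)"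
        by (intro sum.cong) (auto simp: zl zX)
      finally show ?thesis using 1 \<phi>(1)
        by (simp add: incidence_payoff_def pot zl algebra_simps)
    next
      case 2
      have "\<phi> $ {i} * (\<Sum>j | j i = 2. (of_real (X $ (i, j)) - l i) * clique_ratio E \<phi> i j) =
          (\<Sum>j | j i = 2. (of_real (X $ (i, j)) - l i) * p $ j)"
        unfolding sum_distrib_left \<phi>(1) by (intro sum.cong) (auto simp: clique_product_ratio mult_ac)
      then have zero': "(\<Sum>j | j i = 2. (of_real (X $ (i, j)) - l i) * clique_ratio E \<phi> i j) = 0"
        using zero \<phi>(2) by simp
      have "0 = (of_real (X $ (i, prof {i})) - l i) * clique_ratio E \<phi> i (prof {i}) +
          (\<Sum>j\<in>{j. j i = 2} - {prof {i}}. (of_real (X $ (i, j)) - l i) * clique_ratio E \<phi> i j)"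
        unfolding zero'[symmetric] by (rule sum.remove) (auto simp: prof)
      also have "(\<Sum>j\<in>{j. j i = 2} - {prof {i}}. (of_real (X $ (i, j)) - l i) * clique_ratio E \<phi> i j) =
          (\<Sum>j\<in>{j. j i = 2} - {prof {i}}. (of_real (X $ (i, j)) - z $ Inr (i, prof {})) * clique_ratio E \<phi> i j)"
        by (simp only: zl)
      also have "\<dots> = (\<Sum>j\<in>{j. j i = 2} - {prof {i}}. (z $ Inr (i, j) - z $ Inr (i, prof {})) * clique_ratio E \<phi> i j)"
      proof (intro sum.cong refl)
        fix l assume l: "l \<in> {j. j i = 2} - {prof {i}}"
        then have "l \<noteq> prof {}" using prof(1)[of i] by auto
        then show "(of_real (X $ (i, l)) - z $ Inr (i, prof {})) * clique_ratio E \<phi> i l =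
            (z $ Inr (i, l) - z $ Inr (i, prof {})) * clique_ratio E \<phi> i l" by (simp add: zX)
      qed
      finally show ?thesis using 2
        by (simp add: incidence_payoff_def pot zl algebra_simps)
    next
      case 3
      then show ?thesis by (simp add: incidence_payoff_def zX)
    qed
  qed
  then show ?thesis using that[of z] \<phi>(1) pot by simp
qed

lemma fun_alg_incidence_payoff:
  assumes "\<And>K. K \<in> cliques E \<Longrightarrow> (\<lambda>z. z $ Inl K) \<in> fun_alg B"
    and "\<And>i j. j \<noteq> prof {i} \<Longrightarrow> (\<lambda>z. z $ Inr (i, j)) \<in> fun_alg B"
  shows "(\<lambda>z. incidence_payoff E z i j) \<in> fun_alg B"
proof -
  have "(\<lambda>z. clique_product E (potentials z) $ l) \<in> fun_alg B" for l
    using assms(1) by (intro fun_alg_clique_product) (simp add: potentials_def)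
  moreover have "(\<lambda>z. clique_ratio E (potentials z) i l) \<in> fun_alg B" for l
    unfolding clique_ratio_def potentials_def using assms(1) by (intro fun_alg_prod) simp
  moreover have "(\<lambda>z. z $ Inr (i, prof {})) \<in> fun_alg B" by (rule assms(2)) simp
  moreover have "l \<noteq> prof {i}" if "l i = 1" for l using that by (auto simp: prof_def)
  ultimately show ?thesis
    unfolding incidence_payoff_def using assms(2)
    by (intro fun_alg_if fun_alg_diff fun_alg_sum fun_alg.mult) auto
qed

lemma polyfun_incidence_map: "polyfun (\<lambda>z. incidence_map E z $ v)"
proof (cases v)
  case (Inl K)
  then show ?thesis
    by (cases "\<exists>i. K = {i}") (auto simp: incidence_map_simps intro: polyfun_nth)
next
  case (Inr a)
  then show ?thesis
    by (cases a) (auto simp: incidence_map_simps intro!: fun_alg_incidence_payoff polyfun_nth)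
qed

lemma potentials_line: "potentials (a + s *s b) = potentials a + s *s potentials b"
  by (simp add: potentials_def vec_eq_iff)

text \<open>At the chosen point all potentials are 1, all multipliers are 0, and the only nonzero payoff of player
  \<open>i\<close> is the one where exactly \<open>i\<close> and \<open>\<sigma> i\<close> choose \<open>2\<close>. A tangent vector \<open>h\<close> in the kernel of the derivative
  vanishes at the copied coordinates. The payoff at \<open>prof {}\<close> forces its multipliers to vanish, and the
  payoff of \<open>i\<close> at \<open>prof {i}\<close>, whose only varying factor is the potential of \<open>\<sigma> i\<close>, forces
  its entry at that potential to vanish. Every player is some \<open>\<sigma> i\<close>.\<close>

lemma incidence_map_regular_point:
  assumes "CARD('n::finite) \<ge> 2"
  shows "\<exists>z :: complex ^ 'n::finite incidence_index. det (jacobian_matrix (incidence_map E) z) \<noteq> 0"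
proof -
  obtain \<sigma> :: "'n \<Rightarrow> 'n" where \<sigma>: "surj \<sigma>" "\<And>i. \<sigma> i \<noteq> i" by (rule derangement_exists[OF assms]) (rule that)
  define z0 :: "complex ^ 'n incidence_index" where "z0 = (\<chi> v. case v of Inl K \<Rightarrow> 1
    | Inr (i, j) \<Rightarrow> if j = prof {i, \<sigma> i} then 1 else 0)"
  have z0: "z0 $ Inl K = 1" "z0 $ Inr (i, prof {i, \<sigma> i}) = 1"
    "j \<noteq> prof {i, \<sigma> i} \<Longrightarrow> z0 $ Inr (i, j) = 0" for K i j
    by (simp_all add: z0_def)
  have pot0: "potentials z0 $ K = 1" for K by (simp add: potentials_def z0)
  have "h = 0" if h: "jacobian_matrix (incidence_map E) z0 *v h = 0" for h
  proof -
    have deriv: "((\<lambda>s. incidence_map E (z0 + s *s h) $ v) has_field_derivative 0) (at 0)" for v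
    proof -
      have "(incidence_map E has_derivative (\<lambda>x. jacobian_matrix (incidence_map E) z0 *v x)) (at (z0 + 0 *s h))"
        using has_derivative_jacobian[OF polyfun_incidence_map, of E z0] by simp
      from has_field_derivative_on_line[OF this, of v] h show ?thesis by simp
    qed
    have lin: "c = 0" if "\<And>s. incidence_map E (z0 + s *s h) $ v = b + s * c" for v b c
    proof -
      have "((\<lambda>s. b + s * c) has_field_derivative c) (at 0)" by (auto intro!: derivative_eq_intros)
      then show ?thesis using deriv[of v] DERIV_unique unfolding that by blast
    qed
    have h1: "h $ Inl K = 0" if "\<nexists>i. K = {i}" for K
      by (rule lin[of "Inl K" "z0 $ Inl K"]) (simp add: incidence_map_simps that)
    have h2: "h $ Inr (i, prof {i}) = 0" for i
      by (rule lin[of "Inl {i}" "z0 $ Inr (i, prof {i})"]) (simp add: incidence_map_simps)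
    have h3: "h $ Inr (i, j) = 0" if "j \<noteq> prof {}" "j \<noteq> prof {i}" for i j
      by (rule lin[of "Inr (i, j)" "z0 $ Inr (i, j)"]) (simp add: incidence_map_simps incidence_payoff_def that)
    have h4: "h $ Inr (i, prof {}) = 0" for i
    proof -
      let ?N = "{l :: 'n profile. l i = 1}"
      (* To be shown: along the line the payoff is s * h $ Inr (i, prof {}) * q s, where q 0 = card ?N. *)
      define q where "q s = (\<Sum>l\<in>?N. clique_product E (potentials z0 + s *s potentials h) $ l)" for s
      have "polyfun (\<lambda>\<phi>. \<Sum>l\<in>?N. clique_product E \<phi> $ l)"
        by (intro fun_alg_sum polyfun_clique_product)
      then obtain r where r: "\<And>s. q s = poly r s"
        unfolding q_def by (rule polyfun_on_line[where a = "potentials z0" and b = "potentials h"]) blast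
      have mem: "prof {} \<in> ?N" by (simp add: prof_def)
      have eq: "incidence_map E (z0 + s *s h) $ Inr (i, prof {}) = s * (h $ Inr (i, prof {}) * poly r s)" for s
      proof -
        have zl: "(z0 + s *s h) $ Inr (i, prof {}) = s * h $ Inr (i, prof {})"
          by (simp add: z0)
        have "(\<Sum>l\<in>?N - {prof {}}. ((z0 + s *s h) $ Inr (i, l) - (z0 + s *s h) $ Inr (i, prof {})) *
            clique_product E (potentials (z0 + s *s h)) $ l) =
            (\<Sum>l\<in>?N - {prof {}}. - (s * h $ Inr (i, prof {})) * clique_product E (potentials z0 + s *s potentials h) $ l)"
        proof (rule sum.cong)
          fix l assume l: "l \<in> ?N - {prof {}}"
          then have "l \<noteq> prof {i}" "l \<noteq> prof {i, \<sigma> i}" by (auto simp: prof_def)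
          then show "((z0 + s *s h) $ Inr (i, l) - (z0 + s *s h) $ Inr (i, prof {})) *
            clique_product E (potentials (z0 + s *s h)) $ l =
            - (s * h $ Inr (i, prof {})) * clique_product E (potentials z0 + s *s potentials h) $ l"
            using l by (simp add: zl z0 h3 potentials_line)
        qed simp
        note sum_eq = this
        have "incidence_map E w $ Inr (i, prof {}) = w $ Inr (i, prof {}) -
            (\<Sum>l\<in>?N - {prof {}}. (w $ Inr (i, l) - w $ Inr (i, prof {})) * clique_product E (potentials w) $ l)" for w
          by (simp add: incidence_map_simps incidence_payoff_def)
        from this[of "z0 + s *s h", unfolded sum_eq]
        have "incidence_map E (z0 + s *s h) $ Inr (i, prof {}) = s * h $ Inr (i, prof {}) *
            (1 + (\<Sum>l\<in>?N - {prof {}}. clique_product E (potentials z0 + s *s potentials h) $ l))"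
          unfolding zl sum_distrib_left[symmetric] by (simp add: algebra_simps)
        also have "1 + (\<Sum>l\<in>?N - {prof {}}. clique_product E (potentials z0 + s *s potentials h) $ l) = q s"
          unfolding q_def using sum.remove[OF _ mem, of "\<lambda>l. clique_product E (potentials z0 + s *s potentials h) $ l"] by simp
        finally show ?thesis by (simp add: r mult.assoc)
      qed
      have "((\<lambda>s. s * (h $ Inr (i, prof {}) * poly r s)) has_field_derivative (h $ Inr (i, prof {}) * poly r 0)) (at 0)"
        by (auto intro!: derivative_eq_intros)
      then have "h $ Inr (i, prof {}) * poly r 0 = 0"
        using deriv[of "Inr (i, prof {})"] DERIV_unique unfolding eq by blast
      moreover have "poly r 0 = of_nat (card ?N)"
        unfolding r[symmetric] q_def by (simp add: clique_product_def pot0)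
      moreover have "card ?N \<noteq> 0" using mem by auto
      ultimately show ?thesis by simp
    qed
    have h5: "h $ Inl {\<sigma> i} = 0" for i
    proof -
      have mem: "prof {i, \<sigma> i} \<in> {l. l i = 2} - {prof {i}}"
      proof -
        have "prof {i, \<sigma> i} i = 2" by (simp add: prof_def)
        moreover have "prof {i, \<sigma> i} \<noteq> prof {i}" using \<sigma>(2)[of i] by auto
        ultimately show ?thesis by blast
      qed
      have eq: "incidence_map E (z0 + s *s h) $ Inr (i, prof {i}) = - 1 + s * - h $ Inl {\<sigma> i}" for s
      proof -
        let ?f = "\<lambda>l. z0 $ Inr (i, l) * clique_ratio E (potentials (z0 + s *s h)) i l"
        have "incidence_map E (z0 + s *s h) $ Inr (i, prof {i}) = - (\<Sum>l\<in>{l. l i = 2} - {prof {i}}. ?f l)"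
        proof -
          have "((z0 + s *s h) $ Inr (i, l) - (z0 + s *s h) $ Inr (i, prof {})) * clique_ratio E (potentials (z0 + s *s h)) i l = ?f l"
            if "l \<in> {l. l i = 2} - {prof {i}}" for l
          proof -
            have "l \<noteq> prof {}" "l \<noteq> prof {i}" using that by (auto simp: prof_def)
            then show ?thesis by (simp add: h3 h4 z0)
          qed
          then have "(\<Sum>l\<in>{l. l i = 2} - {prof {i}}. ((z0 + s *s h) $ Inr (i, l) - (z0 + s *s h) $ Inr (i, prof {})) *
              clique_ratio E (potentials (z0 + s *s h)) i l) = (\<Sum>l\<in>{l. l i = 2} - {prof {i}}. ?f l)"
            by (intro sum.cong refl)
          moreover have "incidence_map E w $ Inr (i, prof {i}) = w $ Inr (i, prof {}) -
              (\<Sum>l\<in>{l. l i = 2} - {prof {i}}. (w $ Inr (i, l) - w $ Inr (i, prof {})) *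
              clique_ratio E (potentials w) i l)" for w
            by (simp add: incidence_map_simps incidence_payoff_def)
          moreover have "(z0 + s *s h) $ Inr (i, prof {}) = 0" by (simp add: h4 z0)
          ultimately show ?thesis by simp
        qed
        also have "(\<Sum>l\<in>{l. l i = 2} - {prof {i}}. ?f l) = ?f (prof {i, \<sigma> i}) + (\<Sum>l\<in>{l. l i = 2} - {prof {i}} - {prof {i, \<sigma> i}}. ?f l)"
          by (rule sum.remove[OF _ mem]) simp
        also have "(\<Sum>l\<in>{l. l i = 2} - {prof {i}} - {prof {i, \<sigma> i}}. ?f l) = 0"
          by (intro sum.neutral) (simp add: z0)
        also have "?f (prof {i, \<sigma> i}) = 1 + s * h $ Inl {\<sigma> i}"
        proof -
          let ?KK = "{K \<in> cliques E. K \<subseteq> supp (prof {i, \<sigma> i}) \<and> K \<noteq> {i}}"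
          have "clique_ratio E (potentials (z0 + s *s h)) i (prof {i, \<sigma> i}) =
              (\<Prod>K\<in>{{\<sigma> i}}. potentials (z0 + s *s h) $ K)"
            unfolding clique_ratio_def
          proof (rule prod.mono_neutral_right)
            show "{{\<sigma> i}} \<subseteq> ?KK" using \<sigma>(2)[of i] singleton_clique[of "\<sigma> i" E] by auto
            show "\<forall>K\<in>?KK - {{\<sigma> i}}. potentials (z0 + s *s h) $ K = 1"
            proof
              fix K assume K: "K \<in> ?KK - {{\<sigma> i}}"
              have "\<nexists>k. K = {k}" using K by auto
              then show "potentials (z0 + s *s h) $ K = 1" by (simp add: potentials_def z0 h1)
            qed
          qed simp
          then show ?thesis by (simp add: z0 potentials_def)
        qed
        finally show ?thesis by simp
      qed
      have "- h $ Inl {\<sigma> i} = 0" by (rule lin[OF eq])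
      then show ?thesis by simp
    qed
    have "h $ v = 0" for v
    proof (cases v)
      case (Inl K)
      show ?thesis
      proof (cases "\<exists>k. K = {k}")
        case True
        then obtain k where "K = {k}" by blast
        then show ?thesis using Inl h5 \<sigma>(1) by (metis surjD)
      next
        case False
        then show ?thesis using Inl h1 by simp
      qed
    next
      case (Inr a)
      then show ?thesis using h2 h3 h4 by (cases a) metis
    qed
    then show ?thesis by (simp add: vec_eq_iff)
  qed
  then show ?thesis using det_nonzero_iff by blast
qed

lemma card_cliques_ge: "CARD('n) \<le> card (cliques (E :: 'n::finite set set))"
proof -
  have "card (range (\<lambda>i :: 'n. {i})) \<le> card (cliques E)"
    using singleton_clique[of _ E] by (intro card_mono) auto
  then show ?thesis by (simp add: card_image)
qed

lemma spohn_ci_variety_eq: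
  "spohn_ci_variety X (global_markov E) = zariski closure_of (proj_point ` equilibrium_points E X)"
proof -
  have scale: "det (spohn_matrix X i (c *s p)) = c\<^sup>2 * det (spohn_matrix X i p)" for i c p
  proof -
    have "(\<Sum>j | j i = k. (c *s p) $ j) = c * (\<Sum>j | j i = k. p $ j)"
      "(\<Sum>j | j i = k. of_real (X $ (i, j)) * (c *s p) $ j) = c * (\<Sum>j | j i = k. of_real (X $ (i, j)) * p $ j)" for k
      by (simp_all add: sum_distrib_left mult_ac)
    then show ?thesis unfolding det_spohn_matrix by (simp only: power2_eq_square) (simp add: algebra_simps)
  qed
  have "proj_point p \<in> spohn_variety X \<longleftrightarrow> (\<forall>i. det (spohn_matrix X i p) = 0)" if "p \<noteq> 0" for p
  proof
    assume "proj_point p \<in> spohn_variety X"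
    then obtain q where "proj_point p = proj_point q" "\<forall>i. det (spohn_matrix X i q) = 0"
      by (auto simp: spohn_variety_def proj_locus_def)
    then obtain c where "p = c *s q" using proj_point_eqD by metis
    then show "\<forall>i. det (spohn_matrix X i p) = 0" using \<open>\<forall>i. det (spohn_matrix X i q) = 0\<close> scale by simp
  next
    assume "\<forall>i. det (spohn_matrix X i p) = 0"
    then show "proj_point p \<in> spohn_variety X" using that by (auto simp: spohn_variety_def proj_locus_def)
  qed
  moreover have "p \<noteq> 0" if "p \<in> torus_points E" for p using that by (auto simp: torus_points_def)
  moreover have "(spohn_variety X \<inter> ci_model (global_markov E)) - special_hyperplanes =
      spohn_variety X \<inter> proj_point ` torus_points E"
    using ci_model_minus_special[of E] by blast
  ultimately have "(spohn_variety X \<inter> ci_model (global_markov E)) - special_hyperplanes =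
      proj_point ` equilibrium_points E X"
    unfolding equilibrium_points_def by auto
  then show ?thesis by (simp add: spohn_ci_variety_def)
qed

text \<open>The parameters of the incidence variety are the potentials of cliques and all \<open>Inr\<close> slots but
  \<open>Inr (i, prof {i})\<close>. They are fewer than the payoffs together with the coordinates in \<open>J\<close>.\<close>

lemma generic_coordinates_dependent:
  fixes E :: "'n::finite set set" and J :: "'n profile set"
  assumes J: "card J = Suc (card (cliques E) - CARD('n))"
  shows "\<exists>Q. polyfun Q \<and> (\<exists>x. Q x \<noteq> 0) \<and> (\<forall>X :: 'n game. Q (\<chi> a. of_real (X $ a)) \<noteq> 0 \<longrightarrow>
    coordinates_dependent J (equilibrium_points E X))"
proof -
  let ?free = "{(i, j). j \<noteq> prof {i}} :: ('n \<times> 'n profile) set"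
  let ?B = "(\<lambda>v (z :: complex ^ 'n incidence_index). z $ v) ` (cliques E <+> ?free)"
  have "card ?B \<le> card (cliques E <+> ?free)" by (rule card_image_le) simp
  also have "\<dots> = card (cliques E) + card ?free" by (simp add: card_Plus)
  also have "card ?free + CARD('n) = CARD('n \<times> 'n profile)"
  proof -
    have "inj (\<lambda>i :: 'n. (i, prof {i}))" by (simp add: inj_on_def)
    then have "card (range (\<lambda>i :: 'n. (i, prof {i}))) = CARD('n)" by (rule card_image)
    moreover have "?free = UNIV - range (\<lambda>i :: 'n. (i, prof {i}))" by auto
    moreover have "card (range (\<lambda>i :: 'n. (i, prof {i}))) \<le> CARD('n \<times> 'n profile)" by (intro card_mono) auto
    ultimately show ?thesis by (simp add: card_Diff_subset)
  qed
  then have "card (cliques E) + card ?free < CARD('n \<times> 'n profile) + card J"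
    using J card_cliques_ge[of E] by linarith
  finally have card: "card ?B < CARD('n \<times> 'n profile) + card J" .
  have gen: "(\<lambda>z. z $ Inl K) \<in> fun_alg ?B" if "K \<in> cliques E" for K
    using that by (intro fun_alg.gen) auto
  have gen': "(\<lambda>z. z $ Inr (i, j)) \<in> fun_alg ?B" if "j \<noteq> prof {i}" for i j
    using that by (intro fun_alg.gen) auto
  have pay: "(\<lambda>z. incidence_payoff E z (fst a) (snd a)) \<in> fun_alg ?B" for a
    by (rule fun_alg_incidence_payoff[OF gen gen'])
  have cp: "(\<lambda>z. clique_product E (potentials z) $ j) \<in> fun_alg ?B" for j
    using gen by (intro fun_alg_clique_product) (simp add: potentials_def)
  have "\<exists>D (C :: ('n profile \<Rightarrow> nat) \<Rightarrow> complex ^ ('n \<times> 'n profile) \<Rightarrow> complex). (\<forall>\<alpha>. polyfun (C \<alpha>)) \<and>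
    (\<exists>\<alpha>\<in>exponents J D. \<exists>y. C \<alpha> y \<noteq> 0) \<and>
    (\<forall>z. (\<Sum>\<alpha>\<in>exponents J D. C \<alpha> (\<chi> a. incidence_payoff E z (fst a) (snd a)) *
      (\<Prod>j\<in>J. clique_product E (potentials z) $ j ^ \<alpha> j)) = 0)"
    by (rule algebraic_relation_over_polynomials[OF _ _ card pay cp]) simp_all
  then obtain D and C :: "('n profile \<Rightarrow> nat) \<Rightarrow> complex ^ ('n \<times> 'n profile) \<Rightarrow> complex" where C:
    "\<And>\<alpha>. polyfun (C \<alpha>)" "\<exists>\<alpha>\<in>exponents J D. \<exists>y. C \<alpha> y \<noteq> 0"
    "\<And>z. (\<Sum>\<alpha>\<in>exponents J D. C \<alpha> (\<chi> a. incidence_payoff E z (fst a) (snd a)) *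
      (\<Prod>j\<in>J. clique_product E (potentials z) $ j ^ \<alpha> j)) = 0"
    by blast
  obtain \<alpha> y where \<alpha>: "\<alpha> \<in> exponents J D" "C \<alpha> y \<noteq> 0" using C(2) by blast
  have "coordinates_dependent J (equilibrium_points E X)"
    if X: "C \<alpha> (\<chi> a. of_real (X $ a)) \<noteq> 0" for X :: "'n game"
    unfolding coordinates_dependent_def
  proof (intro exI[of _ D] exI[of _ "\<lambda>\<alpha>. C \<alpha> (\<chi> a. of_real (X $ a))"] conjI ballI)
    show "\<exists>\<alpha>\<in>exponents J D. C \<alpha> (\<chi> a. of_real (X $ a)) \<noteq> 0" using \<alpha>(1) X by blast
    fix p assume "p \<in> equilibrium_points E X"
    then obtain z where z: "p = clique_product E (potentials z)"
      "\<And>i j. incidence_payoff E z i j = of_real (X $ (i, j))"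
      by (rule equilibrium_points_incidence) (rule that)
    show "(\<Sum>\<alpha>\<in>exponents J D. C \<alpha> (\<chi> a. of_real (X $ a)) * (\<Prod>j\<in>J. p $ j ^ \<alpha> j)) = 0"
      using C(3)[of z] by (simp add: z)
  qed
  then show ?thesis using C(1) \<alpha>(2) by blast
qed

text \<open>Local coordinates at the regular point are the values of \<open>incidence_map\<close>. Fixing the payoffs at those of \<open>X\<close>
  and letting the potentials of the cliques with at least two players vary gives a holomorphic
  family of equilibrium points of \<open>X\<close>.\<close>

lemma regular_game_dim_ge:
  fixes E :: "'n::finite set set" and X :: "'n game"
  assumes z: "\<And>a. incidence_map E z $ Inr a = of_real (X $ a)"
    and det: "det (jacobian_matrix (incidence_map E) z) \<noteq> 0"
    and nz: "(\<Prod>K\<in>UNIV. z $ Inl K) * (\<Sum>j\<in>UNIV. clique_product E (potentials z) $ j) \<noteq> 0"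
  shows "ereal (real (card (cliques E) - CARD('n))) \<le> proj_dim (spohn_ci_variety X (global_markov E))"
proof -
  let ?h = "\<lambda>z. (\<Prod>K\<in>UNIV. z $ Inl K) * (\<Sum>j\<in>UNIV. clique_product E (potentials z) $ j)"
  define y0 where "y0 = incidence_map E z"
  obtain V G where VG': "open V" "incidence_map E z \<in> V" "G (incidence_map E z) = z" "continuous_on V G"
    "\<And>y. y \<in> V \<Longrightarrow> incidence_map E (G y) = y"
    "\<And>y. y \<in> V \<Longrightarrow> \<exists>N. (G has_derivative (\<lambda>h. N *v h)) (at y)"
    by (rule holomorphic_local_inverse[OF polyfun_incidence_map det]) (rule that)
  note VG = VG'[folded y0_def]
  have "polyfun ?h"
    by (intro fun_alg_intros polyfun_nth fun_alg_clique_product) (simp add: potentials_def polyfun_nth)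
  then have "open (V \<inter> G -` {z. ?h z \<noteq> 0})"
    using VG(1,4) by (intro continuous_open_preimage open_Collect_neq polyfun_continuous continuous_on_const)
  moreover have "y0 \<in> V \<inter> G -` {z. ?h z \<noteq> 0}" using VG(2,3) nz by simp
  ultimately obtain \<epsilon> where \<epsilon>: "\<epsilon> > 0" "ball y0 \<epsilon> \<subseteq> V \<inter> G -` {z. ?h z \<noteq> 0}"
    using open_contains_ball by blast
  let ?\<gamma> = "\<lambda>y. clique_product E (potentials (G y))"
  let ?S = "range (\<lambda>i :: 'n. {i})"
  obtain ks :: "'n incidence_index list" where ks: "set ks = Inl ` (cliques E - ?S)" "distinct ks"
    using finite_distinct_list[of "Inl ` (cliques E - ?S) :: 'n incidence_index set"] by auto
  have nzG: "\<forall>L. potentials (G y) $ L \<noteq> 0" if "y \<in> ball y0 \<epsilon>" for y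
    using that \<epsilon>(2) by (auto simp: potentials_def)
  have "ereal (real (length ks)) \<le> proj_dim (spohn_ci_variety X (global_markov E))"
  proof (rule proj_dim_ge[where V = "ball y0 \<epsilon>" and \<gamma> = ?\<gamma> and ?y0.0 = y0])
    show "open (ball y0 \<epsilon>)" "convex (ball y0 \<epsilon>)" "y0 \<in> ball y0 \<epsilon>" using \<epsilon>(1) by auto
    show "(\<lambda>t. ?\<gamma> (a + t *s w) $ i) holomorphic_on {t. a + t *s w \<in> ball y0 \<epsilon>}" for a w i
    proof (rule polyfun_holomorphic[OF polyfun_clique_product])
      show "(\<lambda>t. potentials (G (a + t *s w)) $ K) holomorphic_on {t. a + t *s w \<in> ball y0 \<epsilon>}" for K
        unfolding potentials_def vec_lambda_beta
        by (rule holomorphic_on_line) (use VG(6) \<epsilon>(2) in blast)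
    qed
    show "closedin zariski (spohn_ci_variety X (global_markov E))" unfolding spohn_ci_variety_eq by simp
    show "distinct ks" by fact
    show "?\<gamma> y \<noteq> 0 \<and> proj_point (?\<gamma> y) \<in> spohn_ci_variety X (global_markov E)"
      if y: "y \<in> ball y0 \<epsilon>" and agree: "\<And>v. v \<notin> set ks \<Longrightarrow> y $ v = y0 $ v" for y
    proof -
      have yV: "y \<in> V" and hG: "?h (G y) \<noteq> 0" using y \<epsilon>(2) by auto
      have pay: "incidence_payoff E (G y) i j = of_real (X $ (i, j))" for i j
      proof -
        have "incidence_payoff E (G y) i j = incidence_map E (G y) $ Inr (i, j)"
          by (simp add: incidence_map_simps)
        also have "\<dots> = y $ Inr (i, j)" using VG(5)[OF yV] by simp
        also have "\<dots> = y0 $ Inr (i, j)" by (rule agree) (auto simp: ks)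
        also have "\<dots> = of_real (X $ (i, j))" unfolding y0_def by (rule z)
        finally show ?thesis .
      qed
      have "det (spohn_matrix X i (?\<gamma> y)) = 0" for i
        by (rule det_spohn_matrix_incidence) (rule pay)
      moreover have "?\<gamma> y \<in> torus_points E"
        unfolding torus_points_def using nzG[OF y] hG
        by (intro CollectI exI[of _ "potentials (G y)"]) auto
      ultimately have "?\<gamma> y \<in> equilibrium_points E X"
        unfolding equilibrium_points_def by simp
      moreover have "proj_point ` equilibrium_points E X \<subseteq> spohn_ci_variety X (global_markov E)"
        unfolding spohn_ci_variety_eq
      proof (rule closure_of_subset)
        show "proj_point ` equilibrium_points E X \<subseteq> topspace zariski"
          using irreducible_in_torus[of E] unfolding irreducible_in_def equilibrium_points_def by blast
      qed
      ultimately show ?thesis by auto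
    qed
    show "\<exists>d f g. homfun d f \<and> homfun d g \<and> (\<forall>y\<in>ball y0 \<epsilon>. (\<forall>v. v \<notin> set ks \<longrightarrow> y $ v = y0 $ v) \<longrightarrow>
        g (?\<gamma> y) \<noteq> 0 \<and> f (?\<gamma> y) = y $ v * g (?\<gamma> y))"
      if v: "v \<in> set ks" for v
    proof -
      obtain K where K: "v = Inl K" "K \<in> cliques E" "\<nexists>i. K = {i}" using v ks(1) by auto
      have "potentials (G y) $ K = y $ v" if "y \<in> ball y0 \<epsilon>" for y
      proof -
        have "y \<in> V" using that \<epsilon>(2) by blast
        then have "incidence_map E (G y) $ Inl K = y $ Inl K" using VG(5) by simp
        then show ?thesis using K(1,3) by (simp add: incidence_map_simps potentials_def)
      qed
      note pot = this
      from clique_coordinate[OF K(2)] obtain d f g where fg: "homfun d f" "homfun d g"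
        "\<And>\<phi>. \<forall>L. \<phi> $ L \<noteq> 0 \<Longrightarrow>
          g (clique_product E \<phi>) \<noteq> 0 \<and> f (clique_product E \<phi>) = \<phi> $ K * g (clique_product E \<phi>)" by auto
      have "g (?\<gamma> y) \<noteq> 0" "f (?\<gamma> y) = y $ v * g (?\<gamma> y)" if "y \<in> ball y0 \<epsilon>" for y
        using fg(3)[OF nzG[OF that]] by (simp_all add: pot[OF that])
      then show ?thesis
        by (intro exI[of _ d] exI[of _ f] exI[of _ g] conjI ballI impI fg(1,2))
    qed
  qed
  moreover have "length ks = card (cliques E) - CARD('n)"
  proof -
    have "length ks = card (set ks)" using distinct_card[OF ks(2)] by simp
    also have "\<dots> = card (cliques E - ?S)" unfolding ks(1) by (rule card_image) simp
    also have "\<dots> = card (cliques E) - card ?S"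
      using singleton_clique[of _ E] by (intro card_Diff_subset) auto
    finally show ?thesis by (simp add: card_image)
  qed
  ultimately show ?thesis by simp
qed

theorem theorem9:
  fixes E :: "'n::finite set set"
  assumes "CARD('n) \<ge> 2"
    and "undirected_graph E"
  shows "generic (\<lambda>X :: 'n game.
    proj_codim (spohn_ci_variety X (global_markov E)) (ci_model (global_markov E)) =
      ereal (real CARD('n)))"
proof -
  let ?d = "card (cliques E)" and ?k = "card (cliques E) - CARD('n)"
  let ?h = "\<lambda>z :: complex ^ 'n incidence_index.
    (\<Prod>K\<in>UNIV. z $ Inl K) * (\<Sum>j\<in>UNIV. clique_product E (potentials z) $ j)"
  obtain z0 :: "complex ^ 'n incidence_index" where z0: "det (jacobian_matrix (incidence_map E) z0) \<noteq> 0"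
    using incidence_map_regular_point[OF assms(1)] by blast
  have h: "polyfun ?h"
    by (intro fun_alg_intros polyfun_nth fun_alg_clique_product) (simp add: potentials_def polyfun_nth)
  have h1: "?h (\<chi> v. 1) \<noteq> 0" by (simp add: potentials_def clique_product_def)
  from generic_regular_preimage[OF polyfun_incidence_map z0 h h1]
  obtain R where R: "polyfun R" "\<exists>y. R y \<noteq> 0"
    "\<And>y. R y \<noteq> 0 \<Longrightarrow> \<exists>z. incidence_map E z = y \<and> det (jacobian_matrix (incidence_map E) z) \<noteq> 0 \<and> ?h z \<noteq> 0"
    by blast
  (* The potentials of a regular value y1 are kept, and only its payoffs are replaced by those of the game. *)
  obtain y1 where y1: "R y1 \<noteq> 0" using R(2) by blast
  define join where "join x = (\<chi> v. case v of Inl K \<Rightarrow> y1 $ Inl K | Inr a \<Rightarrow> x $ a)"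
    for x :: "complex ^ ('n \<times> 'n profile)"
  define Q0 where "Q0 x = R (join x)" for x
  have "polyfun (\<lambda>x. join x $ v)" for v
    unfolding join_def by (cases v) (auto intro: fun_alg.const polyfun_nth)
  then have Q0: "polyfun Q0" unfolding Q0_def[abs_def] by (rule polyfun_compose[OF R(1)])
  have "join (\<chi> a. y1 $ Inr a) = y1" by (auto simp: join_def vec_eq_iff split: sum.splits)
  then have Q0nz: "Q0 (\<chi> a. y1 $ Inr a) \<noteq> 0" using y1 by (simp add: Q0_def)
  let ?JJ = "{J :: 'n profile set. card J = Suc ?k}"
  define P where "P J Q \<longleftrightarrow> polyfun Q \<and> (\<exists>x. Q x \<noteq> 0) \<and> (\<forall>X :: 'n game. Q (\<chi> a. of_real (X $ a)) \<noteq> 0 \<longrightarrow>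
    coordinates_dependent J (equilibrium_points E X))" for J Q
  have "\<forall>J\<in>?JJ. \<exists>Q. P J Q" unfolding P_def using generic_coordinates_dependent by blast
  from bchoice[OF this] obtain Q where "\<forall>J\<in>?JJ. P J (Q J)" by blast
  then have Q: "\<And>J. J \<in> ?JJ \<Longrightarrow> polyfun (Q J)" "\<And>J. J \<in> ?JJ \<Longrightarrow> \<exists>x. Q J x \<noteq> 0"
    "\<And>J X. J \<in> ?JJ \<Longrightarrow> Q J (\<chi> a. of_real (X $ a)) \<noteq> 0 \<Longrightarrow> coordinates_dependent J (equilibrium_points E X)"
    unfolding P_def by blast+
  define T where "T x = Q0 x * (\<Prod>J\<in>?JJ. Q J x)" for x
  have prodQ: "polyfun (\<lambda>x. \<Prod>J\<in>?JJ. Q J x)" by (intro fun_alg_prod Q)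
  have T: "polyfun T" unfolding T_def[abs_def] by (intro fun_alg.mult Q0 prodQ)
  have "\<exists>x. (\<Prod>J\<in>?JJ. Q J x) \<noteq> 0" by (rule polyfun_prod_nonzero) (auto intro: Q)
  then have "\<exists>x. T x \<noteq> 0"
    using polyfun_mult_eq_0[OF Q0 prodQ _ Q0nz] unfolding T_def by blast
  then obtain x where x: "T x \<noteq> 0" by blast
  have "proj_codim (spohn_ci_variety X (global_markov E)) (ci_model (global_markov E)) = ereal (real CARD('n))"
    if X: "T (\<chi> a. of_real (X $ a)) \<noteq> 0" for X :: "'n game"
  proof -
    have "R (join (\<chi> a. of_real (X $ a))) \<noteq> 0" using X by (simp add: T_def Q0_def)
    then obtain z where z: "incidence_map E z = join (\<chi> a. of_real (X $ a))"
      "det (jacobian_matrix (incidence_map E) z) \<noteq> 0" "?h z \<noteq> 0" using R(3) by blast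
    have "incidence_map E z $ Inr a = of_real (X $ a)" for a by (simp add: z(1) join_def)
    then have ge: "ereal (real ?k) \<le> proj_dim (spohn_ci_variety X (global_markov E))"
      using regular_game_dim_ge z(2,3) by blast
    have "coordinates_dependent J (equilibrium_points E X)" if "card J = Suc ?k" for J
      using Q(3)[of J X] X that by (auto simp: T_def)
    then have "proj_dim (spohn_ci_variety X (global_markov E)) \<le> ereal (real ?k)"
      by (rule proj_dim_le[OF _ spohn_ci_variety_eq])
    with ge have "proj_dim (spohn_ci_variety X (global_markov E)) = ereal (real ?k)" by simp
    then show ?thesis
      unfolding proj_codim_def proj_dim_ci_model using card_cliques_ge[of E] by simp
  qed
  then show ?thesis
    using generic_polyfun[OF T x] unfolding generic_def by blast
qed

end
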